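(* Consider the weighted recursive tree with i.i.d. vertex-weights $(W_i)_{i\in\mathbb N}$ distributed as $W$, where $W$ satisfies: (1) $W$ takes values in $(0,1]$ and $\sup\{x\in\mathbb R:\mathbb P(W\le x)<1\}=1$; (2) there exist $C,\rho>0$ and $x_1\in(0,1)$ such that $\mathbb P(W\le x)\le Cx^\rho$ for all $x\in[0,x_1]$; (3) the distribution of $W$ belongs to the Gumbel maximum domain of attraction, so that there exist sequences $(a_n,b_n)_{n\in\mathbb N}$ such that $(\max_{i\in[n]}W_i-b_n)/a_n$ converges in distribution to a Gumbel random variable. (RV sub-case) Suppose that there exist $a,c_1,\tau>0$ and $b\in\mathbb R$ such that $\mathbb P(W>1-1/x)=\mathbb P((1-W)^{-1}>x)\sim a\,x^b\,e^{-(x/c_1)^\tau}$ as $x\to\infty$, and let $\gamma:=1/(1+\tau)$. Then, as $n\to\infty$, $$\max_{i\in[n]}\frac{\mathcal Z_n(i)-\log_\theta n}{(\log_\theta n)^{1-\gamma}}\xrightarrow{\ \mathbb P\ }-\frac{\tau^\gamma}{(1-\gamma)\log\theta}\Big(\frac{1-\theta^{-1}}{c_1}\Big)^{1-\gamma}.$$ (RaV sub-case) Suppose that there exist $a,c_1>0$, $b\in\mathbb R$ and $\tau>1$ such that $\mathbb P(W>1-1/x)=\mathbb P((1-W)^{-1}>x)\sim a(\log x)^b\,e^{-(\log(x)/c_1)^\tau}$ as $x\to\infty$. Then, as $n\to\infty$, $$\max_{i\in[n]}\frac{\mathcal Z_n(i)-\log_\theta n+C_1(\log_\theta\log_\theta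 n)^\tau-C_2(\log_\theta\log_\theta n)^{\tau-1}\log_\theta\log_\theta\log_\theta n}{(\log_\theta\log_\theta n)^{\tau-1}}\xrightarrow{\ \mathbb P\ }C_3,$$ where $$C_1:=(\log\theta)^{\tau-1}c_1^{-\tau},\qquad C_2:=(\log\theta)^{\tau-1}\tau(\tau-1)c_1^{-\tau},$$ $$C_3:=\big(\log_\theta(\log\theta)\,(\tau-1)\log\theta-\log(e\,c_1^\tau(1-\theta^{-1})/\tau)\big)(\log\theta)^{\tau-2}\tau c_1^{-\tau}.$$
   Context: Weighted recursive tree (WRT): let $(W_i)_{i\ge1}$ be i.i.d. copies of a random variable $W$ with $\mathbb P(W>0)=1$ and $S_n:=\sum_{i=1}^nW_i$. $T_1$ consists of the single vertex $1$ (the root) with vertex-weight $W_1$. For $n\ge1$, $T_{n+1}$ is obtained from $T_n$ by adding vertex $n+1$ with vertex-weight $W_{n+1}$ and, conditionally on $T_n$ (including its vertex-weights), connecting it to one vertex $i\in[n]:=\{1,\ldots,n\}$ chosen with probability $W_i/S_n$, by an edge directed from $n+1$ to $i$. $\mathcal Z_n(i)$ denotes the in-degree of vertex $i$ in $T_n$. Set $\theta:=1+\mathbb E[W]$; $\log_\theta$ is the logarithm to base $\theta$ and $\log$ the natural logarithm. $f(x)\sim g(x)$ means $f(x)/g(x)\to1$. *)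

theory Defs
  imports "HOL-Probability.Probability" "HOL-Real_Asymp.Real_Asymp" "Graph_Theory.Pair_Digraph"
begin

text \<open>The tree on the vertices \<open>1, \<dots>, n\<close> in the outcome \<open>\<omega>\<close>, where \<open>parent k \<omega>\<close> is the vertex
  to which vertex \<open>k \<ge> 2\<close> is attached; the values of \<open>parent 0\<close> and \<open>parent 1\<close> play no role.\<close>

definition wrt_tree :: "(nat \<Rightarrow> 'a \<Rightarrow> nat) \<Rightarrow> nat \<Rightarrow> 'a \<Rightarrow> nat pair_pre_digraph" where
  "wrt_tree parent n \<omega> = \<lparr> pverts = {1..n}, parcs = (\<lambda>k. (k, parent k \<omega>)) ` {2..n} \<rparr>"

text \<open>The sigma-algebra generated by the weights of the vertices \<open>1, \<dots>, m\<close> and by the tree on the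
  vertices \<open>1, \<dots>, n\<close>. For \<open>m = n\<close> this is the information contained in the weighted tree \<open>T\<^sub>n\<close>.\<close>

definition wrt_history ::
    "'a measure \<Rightarrow> (nat \<Rightarrow> 'a \<Rightarrow> real) \<Rightarrow> (nat \<Rightarrow> 'a \<Rightarrow> nat) \<Rightarrow> nat \<Rightarrow> nat \<Rightarrow> 'a measure" where
  "wrt_history M W parent m n =
     vimage_algebra (space M)
       (\<lambda>\<omega>. (\<lambda>i\<in>{1..m}. W i \<omega>, \<lambda>k\<in>{2..n}. parent k \<omega>))
       ((\<Pi>\<^sub>M i\<in>{1..m}. borel) \<Otimes>\<^sub>M (\<Pi>\<^sub>M k\<in>{2..n}. count_space UNIV))"

text \<open>The weights are i.i.d. with law \<open>\<nu>\<close>. The assumption \<open>new_weight\<close> makes explicit that the weight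
  brought by the new vertex \<open>n + 1\<close> is independent of all that precedes it, namely of \<open>T\<^sub>n\<close> and of
  the choice of the vertex to which \<open>n + 1\<close> is attached; independence of the weights among
  themselves would not entail this.\<close>

locale weighted_recursive_tree = prob_space M
  for M :: "'a measure" and \<nu> :: "real measure"
    and W :: "nat \<Rightarrow> 'a \<Rightarrow> real" and parent :: "nat \<Rightarrow> 'a \<Rightarrow> nat" +
  assumes weights_indep: "indep_vars (\<lambda>_. borel) W {1..}"
    and weights_distr: "\<And>i. i \<ge> 1 \<Longrightarrow> distr M borel (W i) = \<nu>"
    and weights_pos: "AE x in \<nu>. 0 < x"
    and parent_measurable: "\<And>n. n \<ge> 1 \<Longrightarrow> parent (n + 1) \<in> measurable M (count_space {1..n})"
    and attachment: "\<And>n i. n \<ge> 1 \<Longrightarrow> i \<in> {1..n} \<Longrightarrow>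
      (AE \<omega> in M. real_cond_exp M (wrt_history M W parent n n)
                     (indicator {\<omega> \<in> space M. parent (n + 1) \<omega> = i}) \<omega>
                   = W i \<omega> / (\<Sum>j=1..n. W j \<omega>))"
    and new_weight: "\<And>n. n \<ge> 1 \<Longrightarrow>
      indep_set (sets (vimage_algebra (space M) (W (n + 1)) borel))
                (sets (wrt_history M W parent n (n + 1)))"

definition wrt_indegree :: "(nat \<Rightarrow> 'a \<Rightarrow> nat) \<Rightarrow> nat \<Rightarrow> nat \<Rightarrow> 'a \<Rightarrow> real" where
  "wrt_indegree parent n i \<omega> = real (in_degree (with_proj (wrt_tree parent n \<omega>)) i)"

definition gumbel_distribution :: "real measure" where
  "gumbel_distribution = interval_measure (\<lambda>x. exp (- exp (- x)))"

lemma
  shows real_distribution_gumbel: "real_distribution gumbel_distribution"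
    and cdf_gumbel: "cdf gumbel_distribution x = exp (- exp (- x))"
proof -
  have 1: "((\<lambda>x::real. exp (- exp (- x))) \<longlongrightarrow> 0) at_bot" by real_asymp
  have 2: "((\<lambda>x::real. exp (- exp (- x))) \<longlongrightarrow> 1) at_top" by real_asymp
  show "real_distribution gumbel_distribution"
    unfolding gumbel_distribution_def
    by (rule real_distribution_interval_measure) (use 1 2 in \<open>auto intro!: continuous_intros\<close>)
  show "cdf gumbel_distribution x = exp (- exp (- x))"
    unfolding gumbel_distribution_def
    by (subst cdf_interval_measure) (use 1 in \<open>auto intro!: continuous_intros\<close>)
qed

definition converges_in_probability ::
    "'a measure \<Rightarrow> (nat \<Rightarrow> 'a \<Rightarrow> real) \<Rightarrow> real \<Rightarrow> bool" where
  "converges_in_probability M X c \<longleftrightarrow>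
     (\<forall>\<epsilon>>0. (\<lambda>n. measure M {\<omega> \<in> space M. \<bar>X n \<omega> - c\<bar> > \<epsilon>}) \<longlonglongrightarrow> 0)"

end

theory Submission
  imports Defs
begin

text \<open>
  Write \<open>\<mu> = \<theta> - 1\<close> for the mean weight. Given all the weights, the vertices choose their parents
  independently, so the in-degree of a vertex \<open>i\<close> of weight \<open>w\<close> is a sum of independent Bernoulli
  variables with parameters \<open>w / S\<^sub>j\<close>, \<open>j \<ge> i\<close>, and \<open>S\<^sub>j\<close> is close to \<open>\<mu> j\<close>. Sum the probabilities that
  the in-degree is at least \<open>k\<close> over vertices \<open>1, \<dots>, n\<close> of common weight \<open>w\<close>. The sum \<open>N n k\<close> obeys
  \<open>N (n + 1) (k + 1) = (1 - w / S\<^sub>n) N n (k + 1) + (w / S\<^sub>n) N n k\<close>, and for \<open>S\<^sub>n = \<mu> n\<close> an exact solution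
  is \<open>n q(w)\<^sup>k\<close> with \<open>q(w) = w / (\<mu> + w)\<close>. Comparison with this solution (\<open>vertex_sum_le\<close>,
  \<open>vertex_sum_ge\<close>) loses constant factors only. That precision is needed: in the second regime with
  \<open>\<tau> \<le> 2\<close> a factor that is a power of \<open>k\<close>, such as the one a Chernoff bound loses, would already be
  visible on the scale \<open>(log\<^sub>\<theta> log\<^sub>\<theta> n)\<^bsup>\<tau>-1\<^esup>\<close>.

  Hence the number of vertices of in-degree at least \<open>k\<close> has expectation of order \<open>n E[q(W)\<^sup>k]\<close>. If this
  is small, Markov's inequality excludes such vertices (\<open>upper_tail_bound\<close>). If it is large, the number
  of them given the weights has a variance below its mean, because two in-degrees are
  negatively correlated (\<open>joint_tail_given_weights\<close>), and Chebyshev's inequality produces such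
  a vertex (\<open>no_large_vertex_given_weights\<close>, \<open>lower_tail_bound\<close>).

  It remains to find the \<open>k\<close> with \<open>n E[q(W)\<^sup>k]\<close> of order one. With \<open>\<kappa> = 1 - 1 / \<theta>\<close> one has
  \<open>q(1 - v) \<approx> exp (- \<kappa> v) / \<theta>\<close> near \<open>v = 0\<close>, so \<open>E[q(W)\<^sup>k] = exp (- k ln \<theta> - \<Psi>(k) + o(\<sigma>(k)))\<close>, where
  \<open>\<Psi>(k)\<close> minimises over \<open>x\<close> the sum of the cost \<open>\<kappa> k / x\<close> of a weight \<open>1 - 1 / x\<close> and of the
  exponent of \<open>P(W > 1 - 1 / x)\<close>. Solving \<open>k ln \<theta> + \<Psi>(k) = ln n\<close> gives the maximal in-degree
  \<open>L - \<Psi>(L) / ln \<theta> + o(\<sigma>(L))\<close> with \<open>L = log\<^sub>\<theta> n\<close> (\<open>max_degree_concentration\<close>). In the first regime the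
  minimum of \<open>y + (A / y)\<^bsup>\<tau>\<^esup>\<close> is explicit; in the second one it is read off a tangent of the
  convex function \<open>z\<^bsup>\<tau>\<^esup>\<close>.
\<close>

section \<open>Tails of sums of independent Bernoulli variables\<close>

text \<open>\<open>tail_prob p n k\<close> is the probability of at least \<open>k\<close> successes in independent trials \<open>0, \<dots>, n - 1\<close>
  with success probabilities \<open>p\<close>. The recursion conditions on the last trial; it is the only
  property that the comparison arguments below use, so no probability space is attached.\<close>

primrec tail_prob :: "(nat \<Rightarrow> real) \<Rightarrow> nat \<Rightarrow> nat \<Rightarrow> real" where
  "tail_prob p 0 k = (if k = 0 then 1 else 0)"
| "tail_prob p (Suc n) k =
     (case k of 0 \<Rightarrow> 1 | Suc k' \<Rightarrow> (1 - p n) * tail_prob p n (Suc k') + p n * tail_prob p n k')"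

lemma tail_prob_0 [simp]: "tail_prob p n 0 = 1"
  by (cases n) auto

lemma tail_prob_Suc_Suc:
  "tail_prob p (Suc n) (Suc k) = (1 - p n) * tail_prob p n (Suc k) + p n * tail_prob p n k"
  by simp

declare tail_prob.simps(2) [simp del]

lemma tail_prob_no_trials:
  "(\<And>j. j < n \<Longrightarrow> p j = 0) \<Longrightarrow> tail_prob p n k = (if k = 0 then 1 else 0)"
  by (induction n arbitrary: k) (auto simp: tail_prob.simps split: nat.splits)

lemma tail_prob_range:
  assumes "\<And>j. j < n \<Longrightarrow> p j \<in> {0..1}"
  shows "tail_prob p n k \<in> {0..1}"
  using assms
proof (induction n arbitrary: k)
  case (Suc n)
  show ?case
  proof (cases k)
    case (Suc k')
    have "tail_prob p n (Suc k') \<in> {0..1}" "tail_prob p n k' \<in> {0..1}" "p n \<in> {0..1}"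
      using Suc.IH Suc.prems by auto
    then show ?thesis
      using convex_bound_le[of "tail_prob p n (Suc k')" 1 "tail_prob p n k'" "1 - p n" "p n"]
      by (auto simp: Suc tail_prob_Suc_Suc)
  qed auto
qed auto

lemma tail_prob_antitone:
  assumes "\<And>j. j < n \<Longrightarrow> p j \<in> {0..1}"
  shows "tail_prob p n (Suc k) \<le> tail_prob p n k"
  using assms
proof (induction n arbitrary: k)
  case (Suc n)
  show ?case
  proof (cases k)
    case 0
    have "tail_prob p (Suc n) (Suc k) \<in> {0..1}"
      by (rule tail_prob_range) (use Suc.prems in auto)
    with 0 show ?thesis by simp
  next
    case (Suc k')
    have "tail_prob p n (Suc (Suc k')) \<le> tail_prob p n (Suc k')"
         "tail_prob p n (Suc k') \<le> tail_prob p n k'" "p n \<in> {0..1}"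
      using Suc.IH Suc.prems by auto
    then show ?thesis
      by (auto simp: Suc tail_prob_Suc_Suc intro!: add_mono mult_left_mono)
  qed
qed auto

text \<open>Raising the last success probability helps because the tail decreases in \<open>k\<close>; raising the
  earlier ones helps by induction.\<close>
lemma tail_prob_mono:
  assumes "\<And>j. j < n \<Longrightarrow> 0 \<le> p j \<and> p j \<le> p' j \<and> p' j \<le> 1"
  shows "tail_prob p n k \<le> tail_prob p' n k"
  using assms
proof (induction n arbitrary: k)
  case (Suc n)
  show ?case
  proof (cases k)
    case (Suc k')
    have p: "0 \<le> p n" "p n \<le> p' n" "p' n \<le> 1" using Suc.prems by auto
    have "tail_prob p n (Suc k') \<le> tail_prob p n k'"
      by (rule tail_prob_antitone) (use Suc.prems less_Suc_eq in force)
    moreover have "tail_prob p n j \<le> tail_prob p' n j" for j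
      using Suc.IH Suc.prems by auto
    ultimately have "tail_prob p (Suc n) k \<le> (1 - p' n) * tail_prob p n (Suc k') + p' n * tail_prob p n k'"
      using p mult_mono[of "p n" "p' n" "tail_prob p n k' - tail_prob p n (Suc k')" "tail_prob p n k' - tail_prob p n (Suc k')"]
      by (simp add: Suc tail_prob_Suc_Suc algebra_simps)
    also have "\<dots> \<le> tail_prob p' (Suc n) k"
      using p \<open>\<And>j. tail_prob p n j \<le> tail_prob p' n j\<close>
      by (auto simp: Suc tail_prob_Suc_Suc intro!: add_mono mult_left_mono)
    finally show ?thesis .
  qed auto
qed auto

section \<open>Sums of degree tails over the vertices\<close>

text \<open>Vertex \<open>i\<close> takes part in the trials \<open>j \<ge> i\<close>, and trials before the time \<open>n\<^sub>0\<close> are ignored, because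
  the total weight is under control only from a random time on. Trial \<open>j\<close> is the attachment of
  vertex \<open>j + 1\<close>.\<close>
definition vertex_sum :: "(nat \<Rightarrow> real) \<Rightarrow> nat \<Rightarrow> nat \<Rightarrow> nat \<Rightarrow> real" where
  "vertex_sum rate n\<^sub>0 n k =
     (\<Sum>i=1..n. tail_prob (\<lambda>j. if n\<^sub>0 \<le> j \<and> i \<le> j then rate j else 0) n k)"

lemma vertex_sum_initial: "vertex_sum rate n\<^sub>0 n\<^sub>0 k = (if k = 0 then n\<^sub>0 else 0)"
  unfolding vertex_sum_def by (subst tail_prob_no_trials) auto

lemma vertex_sum_0: "vertex_sum rate n\<^sub>0 n 0 = n"
  by (simp add: vertex_sum_def)

text \<open>A new vertex starts with in-degree zero, so it adds nothing to the tails at \<open>k + 1\<close>; hence the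
  recursion for a single vertex passes to the sum.\<close>
lemma vertex_sum_Suc:
  assumes "n\<^sub>0 \<le> n"
  shows "vertex_sum rate n\<^sub>0 (Suc n) (Suc k)
           = (1 - rate n) * vertex_sum rate n\<^sub>0 n (Suc k) + rate n * vertex_sum rate n\<^sub>0 n k"
proof -
  let ?p = "\<lambda>i j. if n\<^sub>0 \<le> j \<and> i \<le> j then rate j else 0"
  have "tail_prob (?p (Suc n)) (Suc n) (Suc k) = 0"
    by (subst tail_prob_no_trials) auto
  then have "vertex_sum rate n\<^sub>0 (Suc n) (Suc k) = (\<Sum>i=1..n. tail_prob (?p i) (Suc n) (Suc k))"
    unfolding vertex_sum_def by simp
  also have "\<dots> = (\<Sum>i=1..n. (1 - rate n) * tail_prob (?p i) n (Suc k) + rate n * tail_prob (?p i) n k)"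
    by (intro sum.cong) (use assms in \<open>auto simp: tail_prob_Suc_Suc\<close>)
  finally show ?thesis
    by (simp add: vertex_sum_def sum.distrib sum_distrib_left)
qed

text \<open>Powers \<open>q\<^sup>k\<close> are eigenvectors of the recursion in \<open>k\<close>. For \<open>p = w / (\<mu> n)\<close> the factor is
  \<open>1 + 1 / n\<close> exactly when \<open>q = w / (\<mu> + w)\<close>, which makes \<open>n q\<^sup>k\<close> a solution.\<close>
lemma power_solution:
  fixes q :: real
  assumes "q \<noteq> 0"
  shows "(1 - p) * (a * q ^ Suc k) + p * (a * q ^ k) = a * (1 + p * (1 / q - 1)) * q ^ Suc k"
  using assms by (simp add: field_simps)

text \<open>The recursion is monotone, as its coefficients \<open>1 - r n\<close> and \<open>r n\<close> are nonnegative; so an ordering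
  on the boundary (\<open>n = n\<^sub>0\<close> or \<open>k = 0\<close>) propagates.\<close>
lemma comparison_principle:
  fixes A B :: "nat \<Rightarrow> nat \<Rightarrow> real"
  assumes init: "\<And>k. A n\<^sub>0 k \<le> B n\<^sub>0 k"
    and bound: "\<And>n. n \<ge> n\<^sub>0 \<Longrightarrow> A n 0 \<le> B n 0"
    and rate: "\<And>n. n \<ge> n\<^sub>0 \<Longrightarrow> r n \<in> {0..1}"
    and sub: "\<And>n k. n \<ge> n\<^sub>0 \<Longrightarrow> A (Suc n) (Suc k) \<le> (1 - r n) * A n (Suc k) + r n * A n k"
    and super: "\<And>n k. n \<ge> n\<^sub>0 \<Longrightarrow> (1 - r n) * B n (Suc k) + r n * B n k \<le> B (Suc n) (Suc k)"
    and "n \<ge> n\<^sub>0"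
  shows "A n k \<le> B n k"
  using \<open>n \<ge> n\<^sub>0\<close>
proof (induction n arbitrary: k rule: dec_induct)
  case (step n)
  show ?case
  proof (cases k)
    case (Suc k')
    have "A (Suc n) (Suc k') \<le> (1 - r n) * A n (Suc k') + r n * A n k'"
      using sub step.hyps by simp
    also have "\<dots> \<le> (1 - r n) * B n (Suc k') + r n * B n k'"
      using rate[of n] step by (intro add_mono mult_left_mono) auto
    also have "\<dots> \<le> B (Suc n) (Suc k')"
      using super step.hyps by simp
    finally show ?thesis by (simp add: Suc)
  qed (use bound step.hyps in simp)
qed (rule init)

text \<open>The function \<open>\<phi> n q\<^sup>k\<close> satisfies the recursion exactly. On the boundary \<open>k = 0\<close> it lies above because
  \<open>\<phi>\<close> grows at least like \<open>n\<close> when \<open>l n \<le> \<mu> n\<close>. The growth of \<open>\<phi>\<close> does not involve \<open>w\<close>, so the bound can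
  be integrated over the weight.\<close>
lemma vertex_sum_le:
  fixes \<phi> :: "nat \<Rightarrow> real"
  assumes \<mu>: "\<mu> > 0" and w: "w > 0"
    and l: "\<And>n. n \<ge> n\<^sub>0 \<Longrightarrow> w \<le> l n \<and> 0 < l n \<and> l n \<le> \<mu> * n"
    and \<phi>: "\<phi> n\<^sub>0 = n\<^sub>0" "\<And>n. n \<ge> n\<^sub>0 \<Longrightarrow> \<phi> (Suc n) = \<phi> n * (1 + \<mu> / l n)"
    and n: "n \<ge> n\<^sub>0"
  shows "vertex_sum (\<lambda>j. w / l j) n\<^sub>0 n k \<le> \<phi> n * (w / (\<mu> + w)) ^ k"
proof (rule comparison_principle[where r = "\<lambda>j. w / l j" and n\<^sub>0 = n\<^sub>0])
  let ?q = "w / (\<mu> + w)"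
  show "vertex_sum (\<lambda>j. w / l j) n\<^sub>0 n\<^sub>0 k \<le> \<phi> n\<^sub>0 * ?q ^ k" for k
    using \<mu> w by (simp add: vertex_sum_initial \<phi>)
  show "vertex_sum (\<lambda>j. w / l j) n\<^sub>0 n 0 \<le> \<phi> n * ?q ^ 0" if "n \<ge> n\<^sub>0" for n
    using that
  proof (induction n rule: dec_induct)
    case (step n)
    then have *: "real n \<le> \<phi> n" "0 < l n" "l n \<le> \<mu> * n" using l[of n] by (auto simp: vertex_sum_0)
    then have "1 \<le> n * (\<mu> / l n)" by (simp add: field_simps)
    also have "\<dots> \<le> \<phi> n * (\<mu> / l n)" using * \<mu> by (intro mult_right_mono) auto
    finally have "1 \<le> \<phi> n * (\<mu> / l n)" .
    with *(1) have "real (Suc n) \<le> \<phi> n * (1 + \<mu> / l n)" by (simp add: distrib_left)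
    then show ?case using step.hyps by (simp add: vertex_sum_0 \<phi>)
  qed (simp add: vertex_sum_0 \<phi>)
  show "w / l n \<in> {0..1}" if "n \<ge> n\<^sub>0" for n
    using l[OF that] w by auto
  show "vertex_sum (\<lambda>j. w / l j) n\<^sub>0 (Suc n) (Suc k)
          \<le> (1 - w / l n) * vertex_sum (\<lambda>j. w / l j) n\<^sub>0 n (Suc k) + w / l n * vertex_sum (\<lambda>j. w / l j) n\<^sub>0 n k"
    if "n \<ge> n\<^sub>0" for n k
    using vertex_sum_Suc[OF that] by simp
  show "(1 - w / l n) * (\<phi> n * ?q ^ Suc k) + w / l n * (\<phi> n * ?q ^ k) \<le> \<phi> (Suc n) * ?q ^ Suc k"
    if "n \<ge> n\<^sub>0" for n k
  proof -
    have "w / l n * (1 / ?q - 1) = \<mu> / l n" using \<mu> w l[OF that] by (simp add: field_simps)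
    then show ?thesis using \<mu> w by (subst power_solution) (auto simp: \<phi> that)
  qed
qed (rule n)

text \<open>At time \<open>n\<^sub>0\<close> all tails with \<open>k \<ge> 1\<close> vanish, so \<open>\<phi> n q\<^sup>k\<close> alone cannot be a lower bound. Subtracting the
  solution with a larger base \<open>r\<close> makes the initial value nonpositive, and the subtracted term
  grows more slowly in \<open>n\<close>.\<close>
lemma vertex_sum_ge:
  fixes \<phi> \<psi> :: "nat \<Rightarrow> real"
  assumes \<mu>: "\<mu> > 0" and w: "w > 0" and r: "w / (\<mu> + w) \<le> r"
    and u: "\<And>n. n \<ge> n\<^sub>0 \<Longrightarrow> w \<le> u n \<and> \<mu> * n \<le> u n"
    and \<phi>: "\<phi> n\<^sub>0 = n\<^sub>0" "\<And>n. n \<ge> n\<^sub>0 \<Longrightarrow> \<phi> (Suc n) = \<phi> n * (1 + \<mu> / u n)"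
    and \<psi>: "\<psi> n\<^sub>0 = n\<^sub>0" "\<And>n. n \<ge> n\<^sub>0 \<Longrightarrow> \<psi> (Suc n) = \<psi> n * (1 + w / u n * (1 / r - 1))"
    and r1: "r \<le> 1" and n: "n \<ge> n\<^sub>0"
  shows "\<phi> n * (w / (\<mu> + w)) ^ k - \<psi> n * r ^ k \<le> vertex_sum (\<lambda>j. w / u j) n\<^sub>0 n k"
proof (rule comparison_principle[where r = "\<lambda>j. w / u j" and n\<^sub>0 = n\<^sub>0])
  let ?q = "w / (\<mu> + w)"
  have q: "0 < ?q" using \<mu> w by simp
  have rp: "0 < r" using r q by linarith
  have u0: "u n > 0" if "n \<ge> n\<^sub>0" for n using u[OF that] w by linarith
  show "\<phi> n\<^sub>0 * ?q ^ k - \<psi> n\<^sub>0 * r ^ k \<le> vertex_sum (\<lambda>j. w / u j) n\<^sub>0 n\<^sub>0 k" for k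
    using power_mono[OF r, of k] q by (simp add: vertex_sum_initial \<phi> \<psi> mult_left_mono)
  have \<psi>0: "\<psi> n \<ge> 0" if "n \<ge> n\<^sub>0" for n
    using that
  proof (induction n rule: dec_induct)
    case (step n)
    then show ?case using u0[of n] w rp r1 by (simp add: \<psi>)
  qed (simp add: \<psi>)
  have \<phi>n: "\<phi> n \<le> n" if "n \<ge> n\<^sub>0" for n
    using that
  proof (induction n rule: dec_induct)
    case (step n)
    have "\<phi> n * (1 + \<mu> / u n) \<le> n * (1 + \<mu> / u n)"
      using step u0[of n] \<mu> by (intro mult_right_mono) auto
    also have "\<dots> \<le> real (Suc n)"
      using u[of n] u0[of n] step.hyps by (simp add: field_simps)
    finally show ?case using step.hyps by (simp add: \<phi>)
  qed (simp add: \<phi>)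
  show "\<phi> n * ?q ^ 0 - \<psi> n * r ^ 0 \<le> vertex_sum (\<lambda>j. w / u j) n\<^sub>0 n 0" if "n \<ge> n\<^sub>0" for n
    using \<psi>0[OF that] \<phi>n[OF that] by (simp add: vertex_sum_0)
  show "w / u n \<in> {0..1}" if "n \<ge> n\<^sub>0" for n
    using u[OF that] u0[OF that] w by auto
  show "(1 - w / u n) * vertex_sum (\<lambda>j. w / u j) n\<^sub>0 n (Suc k) + w / u n * vertex_sum (\<lambda>j. w / u j) n\<^sub>0 n k
          \<le> vertex_sum (\<lambda>j. w / u j) n\<^sub>0 (Suc n) (Suc k)"
    if "n \<ge> n\<^sub>0" for n k
    using vertex_sum_Suc[OF that] by simp
  show "\<phi> (Suc n) * ?q ^ Suc k - \<psi> (Suc n) * r ^ Suc k \<le>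
         (1 - w / u n) * (\<phi> n * ?q ^ Suc k - \<psi> n * r ^ Suc k) + w / u n * (\<phi> n * ?q ^ k - \<psi> n * r ^ k)"
    if "n \<ge> n\<^sub>0" for n k
  proof -
    have "w / u n * (1 / ?q - 1) = \<mu> / u n" using \<mu> w u0[OF that] by (simp add: field_simps)
    then have *: "(1 - w / u n) * (\<phi> n * ?q ^ Suc k) + w / u n * (\<phi> n * ?q ^ k) = \<phi> (Suc n) * ?q ^ Suc k"
      using \<mu> w by (subst power_solution) (auto simp: \<phi> that)
    have **: "(1 - w / u n) * (\<psi> n * r ^ Suc k) + w / u n * (\<psi> n * r ^ k) = \<psi> (Suc n) * r ^ Suc k"
      using rp by (subst power_solution) (auto simp: \<psi> that)
    show ?thesis unfolding *[symmetric] **[symmetric] by (simp add: algebra_simps)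
  qed
qed (rule n)

section \<open>The attachments given all the weights\<close>
lemma finite_measures_agree:
  assumes "finite_measure \<mu>" "finite_measure \<mu>'" and sets_eq: "sets \<mu> = sets \<mu>'"
    and G: "Int_stable G" "G \<subseteq> sets \<mu>"
    and agree: "\<And>A. A \<in> G \<Longrightarrow> emeasure \<mu> A = emeasure \<mu>' A"
    and total: "emeasure \<mu> (space \<mu>) = emeasure \<mu>' (space \<mu>)"
    and A: "A \<in> sigma_sets (space \<mu>) G"
  shows "emeasure \<mu> A = emeasure \<mu>' A"
proof -
  interpret m: finite_measure \<mu> by fact
  interpret m': finite_measure \<mu>' by fact
  have sp: "space \<mu>' = space \<mu>" using sets_eq_imp_space_eq[OF sets_eq] ..
  have GP: "G \<subseteq> Pow (space \<mu>)" using G(2) sets.space_closed by blast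
  have sub: "sigma_sets (space \<mu>) G \<subseteq> sets \<mu>"
    by (rule sets.sigma_sets_subset) (rule G(2))
  show ?thesis
    using G(1) GP A
  proof (induction rule: sigma_sets_induct_disjoint)
    case (compl A)
    then have "A \<in> sets \<mu>" "A \<in> sets \<mu>'" using sub sets_eq by auto
    then have "emeasure \<mu> (space \<mu> - A) = emeasure \<mu> (space \<mu>) - emeasure \<mu> A"
      "emeasure \<mu>' (space \<mu> - A) = emeasure \<mu>' (space \<mu>) - emeasure \<mu>' A"
      using emeasure_compl[of A \<mu>] emeasure_compl[of A \<mu>'] m.emeasure_finite m'.emeasure_finite
      by (auto simp: sp)
    then show ?case using compl total by simp
  next
    case (union A)
    have "range A \<subseteq> sets \<mu>" "range A \<subseteq> sets \<mu>'" using union sub sets_eq by auto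
    then show ?case using union suminf_emeasure[of A \<mu>] suminf_emeasure[of A \<mu>']
      by (metis (no_types, lifting) suminf_cong)
  qed (use agree in auto)
qed

context weighted_recursive_tree
begin

lemma weight_measurable [measurable]: "1 \<le> i \<Longrightarrow> W i \<in> borel_measurable M"
  using weights_indep by (auto simp: indep_vars_def)

lemma parent_in_range: "2 \<le> k \<Longrightarrow> \<omega> \<in> space M \<Longrightarrow> parent k \<omega> \<in> {1..<k}"
  using measurable_space[OF parent_measurable[of "k - 1"], of \<omega>] by fastforce

lemma parent_measurable_UNIV [measurable]:
  assumes "2 \<le> k"
  shows "parent k \<in> measurable M (count_space UNIV)"
proof -
  have "parent k \<in> measurable M (count_space {1..k - 1})"
    using parent_measurable[of "k - 1"] assms by simp
  then show ?thesis by (rule measurable_compose) simp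
qed

abbreviation history :: "nat \<Rightarrow> nat \<Rightarrow> 'a measure" where
  "history m n \<equiv> wrt_history M W parent m n"

lemma space_history [simp]: "space (history m n) = space M"
  by (simp add: wrt_history_def)

lemma history_map_measurable:
  assumes "space F = space M"
    and "\<And>i. i \<in> {1..m} \<Longrightarrow> W i \<in> borel_measurable F"
    and "\<And>k. k \<in> {2..n} \<Longrightarrow> parent k \<in> measurable F (count_space UNIV)"
  shows "(\<lambda>\<omega>. (\<lambda>i\<in>{1..m}. W i \<omega>, \<lambda>k\<in>{2..n}. parent k \<omega>)) \<in>
           measurable F ((\<Pi>\<^sub>M i\<in>{1..m}. borel) \<Otimes>\<^sub>M (\<Pi>\<^sub>M k\<in>{2..n}. count_space UNIV))"
  by (intro measurable_Pair measurable_restrict assms)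

lemma sets_history_subset:
  assumes "space F = space M"
    and "\<And>i. i \<in> {1..m} \<Longrightarrow> W i \<in> borel_measurable F"
    and "\<And>k. k \<in> {2..n} \<Longrightarrow> parent k \<in> measurable F (count_space UNIV)"
  shows "sets (history m n) \<subseteq> sets F"
  unfolding wrt_history_def using assms
  by (intro sets_image_in_sets history_map_measurable) auto

lemma subalgebra_history: "subalgebra M (history m n)"
  unfolding subalgebra_def by (intro conjI sets_history_subset) auto

lemma sigma_finite_history: "sigma_finite_subalgebra M (history m n)"
  using subalgebra_history
  by (intro finite_measure_subalgebra_is_sigma_finite) (simp add: finite_measure_subalgebra_def finite_measure_subalgebra_axioms_def finite_measure_axioms)

lemma history_map_measurable_history:
  "(\<lambda>\<omega>. (\<lambda>i\<in>{1..m}. W i \<omega>, \<lambda>k\<in>{2..n}. parent k \<omega>)) \<in>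
     measurable (history m n) ((\<Pi>\<^sub>M i\<in>{1..m}. borel) \<Otimes>\<^sub>M (\<Pi>\<^sub>M k\<in>{2..n}. count_space UNIV))"
  unfolding wrt_history_def
  by (rule measurable_vimage_algebra1)
     (use measurable_space[OF history_map_measurable[of M m n]] in auto)

lemma weight_measurable_history:
  assumes "i \<in> {1..m}"
  shows "W i \<in> borel_measurable (history m n)"
proof -
  have "(\<lambda>\<omega>. (\<lambda>i\<in>{1..m}. W i \<omega>) i) \<in> borel_measurable (history m n)"
    using measurable_compose[OF measurable_compose[OF history_map_measurable_history measurable_fst]
        measurable_component_singleton[OF assms]] by simp
  then show ?thesis using assms by simp
qed

lemma parent_measurable_history:
  assumes "k \<in> {2..n}"
  shows "parent k \<in> measurable (history m n) (count_space UNIV)"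
proof -
  have "(\<lambda>\<omega>. (\<lambda>k\<in>{2..n}. parent k \<omega>) k) \<in> measurable (history m n) (count_space UNIV)"
    using measurable_compose[OF measurable_compose[OF history_map_measurable_history measurable_snd]
        measurable_component_singleton[OF assms]] by simp
  then show ?thesis using assms by simp
qed

lemma sets_history_mono:
  assumes "m \<le> m'" "n \<le> n'"
  shows "sets (history m n) \<subseteq> sets (history m' n')"
  by (rule sets_history_subset) (use assms in \<open>auto intro!: weight_measurable_history parent_measurable_history\<close>)

lemma measurable_history_mono:
  assumes "f \<in> measurable (history m n) K" "m \<le> m'" "n \<le> n'"
  shows "f \<in> measurable (history m' n') K"
  using assms(1) by (rule measurable_from_subalg[rotated])
    (use sets_history_mono[OF assms(2,3)] in \<open>auto simp: subalgebra_def\<close>)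

definition total_weight :: "nat \<Rightarrow> 'a \<Rightarrow> real" where
  "total_weight n \<omega> = (\<Sum>j=1..n. W j \<omega>)"

text \<open>Clipping to \<open>[0, 1]\<close> makes bounds hold at every outcome; positivity of the weights, and with it
  \<open>share i n = W i / S\<^sub>n\<close>, holds almost surely only.\<close>
definition share :: "nat \<Rightarrow> nat \<Rightarrow> 'a \<Rightarrow> real" where
  "share i n \<omega> = (if i \<in> {1..n} then max 0 (min 1 (W i \<omega> / total_weight n \<omega>)) else 0)"

lemma share_range: "share i n \<omega> \<in> {0..1}"
  by (auto simp: share_def)

lemma share_measurable_history:
  assumes "n \<le> m"
  shows "share i n \<in> borel_measurable (history m k)"
proof (cases "i \<in> {1..n}")
  case True
  have [measurable]: "W j \<in> borel_measurable (history m k)" if "j \<in> {1..n}" for j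
    using that assms by (intro weight_measurable_history) auto
  have "(\<lambda>\<omega>. max 0 (min 1 (W i \<omega> / (\<Sum>j=1..n. W j \<omega>)))) \<in> borel_measurable (history m k)"
    using True by measurable
  then show ?thesis using True unfolding share_def total_weight_def by simp
next
  case False
  then have "share i n = (\<lambda>_. 0)" by (auto simp: share_def fun_eq_iff)
  then show ?thesis by simp
qed

lemma share_measurable [measurable]: "share i n \<in> borel_measurable M"
  using measurable_from_subalg[OF subalgebra_history share_measurable_history[OF order_refl]] .

lemma weight_positive: "1 \<le> i \<Longrightarrow> AE \<omega> in M. 0 < W i \<omega>"
proof -
  assume "1 \<le> i"
  have "AE x in distr M borel (W i). 0 < x"
    by (subst weights_distr) (use \<open>1 \<le> i\<close> weights_pos in auto)
  then show "AE \<omega> in M. 0 < W i \<omega>" using \<open>1 \<le> i\<close> by (subst (asm) AE_distr_iff) auto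
qed

lemma weights_positive: "AE \<omega> in M. \<forall>i\<ge>1. 0 < W i \<omega>"
  unfolding AE_all_countable by (auto intro: weight_positive)

lemma share_eq: "AE \<omega> in M. \<forall>n i. i \<in> {1..n} \<longrightarrow> share i n \<omega> = W i \<omega> / total_weight n \<omega>"
  using weights_positive
proof eventually_elim
  case (elim \<omega>)
  have "share i n \<omega> = W i \<omega> / total_weight n \<omega>" if i: "i \<in> {1..n}" for i n
  proof -
    have "W i \<omega> \<le> total_weight n \<omega>"
      unfolding total_weight_def using i elim by (intro member_le_sum) (auto intro: less_imp_le)
    moreover have "0 < W i \<omega>" using elim i by simp
    ultimately show ?thesis using i by (simp add: share_def)
  qed
  then show ?case by simp
qed

lemma shares_sum_le:
  assumes "i \<noteq> j"
  shows "AE \<omega> in M. \<forall>n. share i n \<omega> + share j n \<omega> \<le> 1"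
  using weights_positive share_eq
proof eventually_elim
  case (elim \<omega>)
  have "share i n \<omega> + share j n \<omega> \<le> 1" for n
  proof (cases "i \<in> {1..n} \<and> j \<in> {1..n}")
    case True
    have "(\<Sum>k\<in>{i, j}. W k \<omega>) \<le> total_weight n \<omega>"
      unfolding total_weight_def using True elim by (intro sum_mono2) (auto intro: less_imp_le)
    then have "W i \<omega> + W j \<omega> \<le> total_weight n \<omega>" using assms by simp
    moreover have "0 < W i \<omega>" "0 < W j \<omega>" using elim True by auto
    ultimately show ?thesis using True elim(2) by (simp add: add_divide_distrib[symmetric])
  next
    case False
    then show ?thesis using share_range[of i n \<omega>] share_range[of j n \<omega>] by (auto simp: share_def)
  qed
  then show ?case by simp
qed

lemma integrable_share: "integrable M (share i n)"
  by (rule integrable_const_bound[where B = 1]) (use share_range in auto)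

definition attaches :: "nat \<Rightarrow> nat \<Rightarrow> 'a set" where
  "attaches n i = {\<omega> \<in> space M. parent (n + 1) \<omega> = i}"

lemma attaches_in_history: "1 \<le> n \<Longrightarrow> n + 1 \<le> k \<Longrightarrow> attaches n i \<in> sets (history m k)"
  unfolding attaches_def
  using measurable_sets[OF parent_measurable_history[of "n + 1" k m], of "{i}"]
  by (auto simp: vimage_def Int_def conj_commute)

lemma attaches_event [measurable]: "1 \<le> n \<Longrightarrow> attaches n i \<in> events"
  using attaches_in_history[of n "n + 1" i 0] subalgebra_history by (auto simp: subalgebra_def)

lemma integrable_times_bounded:
  fixes \<Phi> b :: "'a \<Rightarrow> real"
  assumes "integrable M \<Phi>" "b \<in> borel_measurable M" "\<And>\<omega>. \<bar>b \<omega>\<bar> \<le> 1"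
  shows "integrable M (\<lambda>\<omega>. \<Phi> \<omega> * b \<omega>)"
  using assms(1)
proof (rule Bochner_Integration.integrable_bound)
  show "AE \<omega> in M. norm (\<Phi> \<omega> * b \<omega>) \<le> norm (\<Phi> \<omega>)"
    using assms(3) by (auto simp: abs_mult intro!: mult_left_le)
qed (use assms in auto)

text \<open>The attachment rule conditions on the weights of the present tree. Weights of later vertices can be
  added to the conditioning one at a time: vertex \<open>N + 1\<close> brings a weight independent of everything
  up to its own attachment, in particular of the attachment of vertex \<open>n + 1 \<le> N + 1\<close> and of the
  events of the smaller history. Intersections of such events with events of the new weight are
  stable under intersection and generate the larger history, so two finite measures that agree
  on them agree on it.\<close>
lemma attachment_given_history_aux:
  assumes n: "1 \<le> n" and i: "i \<in> {1..n}" and "n \<le> N" and "H \<in> sets (history N n)"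
  shows "prob (H \<inter> attaches n i) = (\<integral>\<omega>. indicator H \<omega> * share i n \<omega> \<partial>M)"
  using \<open>n \<le> N\<close> \<open>H \<in> sets (history N n)\<close>
proof (induction N arbitrary: H rule: dec_induct)
  case base
  interpret F: sigma_finite_subalgebra M "history n n" by (rule sigma_finite_history)
  have H: "H \<in> events" using base subalgebra_history by (auto simp: subalgebra_def)
  have "prob (H \<inter> attaches n i) = (\<integral>\<omega>. indicator H \<omega> * indicator (attaches n i) \<omega> \<partial>M)"
    using H n by (simp flip: indicator_inter_arith)
  also have "\<dots> = (\<integral>\<omega>. indicator H \<omega> * real_cond_exp M (history n n) (indicator (attaches n i)) \<omega> \<partial>M)"
    by (rule F.real_cond_exp_intg(2)[symmetric])
       (use H base n in \<open>auto simp flip: indicator_inter_arith simp: emeasure_eq_measure\<close>)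
  also have "\<dots> = (\<integral>\<omega>. indicator H \<omega> * share i n \<omega> \<partial>M)"
  proof (rule integral_cong_AE)
    show "AE \<omega> in M. indicator H \<omega> * real_cond_exp M (history n n) (indicator (attaches n i)) \<omega>
            = indicator H \<omega> * share i n \<omega>"
      using attachment[OF n i] share_eq
      by eventually_elim (use i in \<open>simp add: attaches_def total_weight_def\<close>)
  qed (use H in auto)
  finally show ?case .
next
  case (step N)
  let ?F = "history N n" and ?V = "vimage_algebra (space M) (W (N + 1)) borel"
  define G where "G = {A \<inter> B | A B. A \<in> sets ?F \<and> B \<in> sets ?V}"
  define \<mu> where "\<mu> = density M (\<lambda>\<omega>. ennreal (indicator (attaches n i) \<omega>))"
  define \<mu>' where "\<mu>' = density M (\<lambda>\<omega>. ennreal (share i n \<omega>))"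
  have V: "sets ?V \<subseteq> events"
    by (rule sets_image_in_sets) auto
  have F: "sets ?F \<subseteq> events" using subalgebra_history by (auto simp: subalgebra_def)
  have top: "space M \<in> sets ?F" "space M \<in> sets ?V"
    using sets.top[of ?F] sets.top[of ?V] by simp_all
  have G_sub: "G \<subseteq> events" unfolding G_def using V F by auto
  have G_pow: "G \<subseteq> Pow (space M)" using G_sub sets.space_closed by blast
  have em: "emeasure \<mu> A = ennreal (prob (A \<inter> attaches n i))" if "A \<in> events" for A
  proof -
    have "emeasure \<mu> A = (\<integral>\<^sup>+\<omega>. ennreal (indicator (attaches n i) \<omega>) * indicator A \<omega> \<partial>M)"
      unfolding \<mu>_def using that n by (subst emeasure_density) auto
    also have "\<dots> = (\<integral>\<^sup>+\<omega>. indicator (A \<inter> attaches n i) \<omega> \<partial>M)"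
      by (rule nn_integral_cong) (auto split: split_indicator)
    also have "\<dots> = emeasure M (A \<inter> attaches n i)" using that n by (intro nn_integral_indicator) auto
    finally show ?thesis by (simp add: emeasure_eq_measure)
  qed
  have em': "emeasure \<mu>' A = ennreal (\<integral>\<omega>. indicator A \<omega> * share i n \<omega> \<partial>M)" if "A \<in> events" for A
  proof -
    have "emeasure \<mu>' A = (\<integral>\<^sup>+\<omega>. ennreal (indicator A \<omega> * share i n \<omega>) \<partial>M)"
      unfolding \<mu>'_def using that
      by (subst emeasure_density) (auto intro!: nn_integral_cong split: split_indicator)
    also have "\<dots> = ennreal (\<integral>\<omega>. indicator A \<omega> * share i n \<omega> \<partial>M)"
    proof (rule nn_integral_eq_integral)
      show "integrable M (\<lambda>\<omega>. indicator A \<omega> * share i n \<omega>)"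
        using that integrable_share by (intro integrable_mult_indicator[of A M "share i n", simplified]) auto
    qed (use share_range in \<open>auto simp: indicator_def\<close>)
    finally show ?thesis .
  qed
  have step_eq: "prob (A \<inter> B \<inter> attaches n i) = (\<integral>\<omega>. indicator (A \<inter> B) \<omega> * share i n \<omega> \<partial>M)"
    if A: "A \<in> sets ?F" and B: "B \<in> sets ?V" for A B
  proof -
    have indep: "indep_set (sets ?V) (sets (history N (N + 1)))"
      using new_weight[of N] step.hyps n by simp
    have AE: "A \<in> events" "B \<in> events" using A B F V by auto
    have A': "A \<in> sets (history N (N + 1))"
      using A sets_history_mono[of N N n "N + 1"] step.hyps by auto
    have "A \<inter> attaches n i \<in> sets (history N (N + 1))"
      using A' attaches_in_history[of n "N + 1" i N] n step.hyps by auto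
    then have "prob (B \<inter> (A \<inter> attaches n i)) = prob B * prob (A \<inter> attaches n i)"
      using indep_setD[OF indep B] by blast
    also have "prob (A \<inter> attaches n i) = (\<integral>\<omega>. indicator A \<omega> * share i n \<omega> \<partial>M)"
      using step.IH A by simp
    also have "prob B * (\<integral>\<omega>. indicator A \<omega> * share i n \<omega> \<partial>M)
             = (\<integral>\<omega>. indicator B \<omega> * (indicator A \<omega> * share i n \<omega>) \<partial>M)"
    proof -
      let ?Y = "\<lambda>\<omega>. indicator A \<omega> * share i n \<omega>"
      have Y: "?Y \<in> borel_measurable (history N (N + 1))"
        using A' share_measurable_history[of n N i "N + 1"] step.hyps by auto
      have "indep_var borel (indicator B :: 'a \<Rightarrow> real) borel ?Y"
        unfolding indep_var_eq
      proof (intro conjI)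
        show "indep_set (sigma_sets (space M) {(indicator B :: 'a \<Rightarrow> real) -` X \<inter> space M |X. X \<in> sets borel})
          (sigma_sets (space M) {?Y -` X \<inter> space M |X. X \<in> sets borel})"
          using indep unfolding indep_set_def
        proof (rule indep_sets_mono_sets)
          have "sigma_sets (space M) {(indicator B :: 'a \<Rightarrow> real) -` X \<inter> space M |X. X \<in> sets borel} \<subseteq> sets ?V"
            using sets.sigma_sets_subset[of "{(indicator B :: 'a \<Rightarrow> real) -` X \<inter> space M |X. X \<in> sets borel}" ?V]
              measurable_sets[of "indicator B :: 'a \<Rightarrow> real" ?V borel] B by auto
          moreover have "sigma_sets (space M) {?Y -` X \<inter> space M |X. X \<in> sets borel} \<subseteq> sets (history N (N + 1))"
            using sets.sigma_sets_subset[of "{?Y -` X \<inter> space M |X. X \<in> sets borel}" "history N (N + 1)"]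
              measurable_sets[OF Y] by auto
          ultimately show "case_bool (sigma_sets (space M) {(indicator B :: 'a \<Rightarrow> real) -` X \<inter> space M |X. X \<in> sets borel})
             (sigma_sets (space M) {?Y -` X \<inter> space M |X. X \<in> sets borel}) b
             \<subseteq> case_bool (sets ?V) (sets (history N (N + 1))) b" for b
            by (cases b) auto
        qed
      qed (use AE in auto)
      moreover have "integrable M (indicator B :: 'a \<Rightarrow> real)" using AE by (simp add: emeasure_eq_measure)
      moreover have "integrable M ?Y"
        using AE integrable_share by (intro integrable_mult_indicator[of A M "share i n", simplified]) auto
      ultimately have "(\<integral>\<omega>. indicator B \<omega> * ?Y \<omega> \<partial>M) = (\<integral>\<omega>. indicator B \<omega> \<partial>M) * (\<integral>\<omega>. ?Y \<omega> \<partial>M)"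
        by (rule indep_var_lebesgue_integral)
      then show ?thesis using AE by simp
    qed
    also have "\<dots> = (\<integral>\<omega>. indicator (A \<inter> B) \<omega> * share i n \<omega> \<partial>M)"
      by (intro Bochner_Integration.integral_cong) (auto split: split_indicator)
    finally show ?thesis by (simp add: Int_ac)
  qed
  have "emeasure \<mu> H = emeasure \<mu>' H"
  proof (rule finite_measures_agree)
    show "finite_measure \<mu>" "finite_measure \<mu>'"
      using em[of "space M"] em'[of "space M"]
      by (auto intro!: finite_measureI simp: \<mu>_def \<mu>'_def)
    show "sets \<mu> = sets \<mu>'" by (simp add: \<mu>_def \<mu>'_def)
    show "G \<subseteq> sets \<mu>" using G_sub by (simp add: \<mu>_def)
    show "Int_stable G"
    proof (rule Int_stableI)
      fix X Y assume "X \<in> G" "Y \<in> G"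
      then obtain A B A' B' where *: "X = A \<inter> B" "Y = A' \<inter> B'" "A \<in> sets ?F" "B \<in> sets ?V"
        "A' \<in> sets ?F" "B' \<in> sets ?V" unfolding G_def by auto
      then have "X \<inter> Y = (A \<inter> A') \<inter> (B \<inter> B')" by auto
      with * show "X \<inter> Y \<in> G" unfolding G_def by blast
    qed
    show "emeasure \<mu> A = emeasure \<mu>' A" if "A \<in> G" for A
    proof -
      have "A \<in> events" using that G_sub by auto
      then show ?thesis using that step_eq by (auto simp: em em' G_def)
    qed
    show "emeasure \<mu> (space \<mu>) = emeasure \<mu>' (space \<mu>)"
      using step_eq[OF top] em[of "space M"] em'[of "space M"] by (simp add: \<mu>_def)
    have "sets (history (Suc N) n) \<subseteq> sets (sigma (space M) G)"
    proof (rule sets_history_subset)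
      have F_G: "A \<in> sets (sigma (space M) G)" if "A \<in> sets ?F" for A
      proof -
        have "A = A \<inter> space M" using that F sets.sets_into_space by blast
        then have "A \<in> G" unfolding G_def using that top by blast
        then show ?thesis using G_pow by (simp add: sets_measure_of)
      qed
      have V_G: "A \<in> sets (sigma (space M) G)" if "A \<in> sets ?V" for A
      proof -
        have "A = space M \<inter> A" using that V sets.sets_into_space by blast
        then have "A \<in> G" unfolding G_def using that top by blast
        then show ?thesis using G_pow by (simp add: sets_measure_of)
      qed
      have sub: "subalgebra (sigma (space M) G) ?F" "subalgebra (sigma (space M) G) ?V"
        using F_G V_G G_pow by (auto simp: subalgebra_def space_measure_of)
      show "space (sigma (space M) G) = space M" using G_pow by (simp add: space_measure_of)
      show "W j \<in> borel_measurable (sigma (space M) G)" if "j \<in> {1..Suc N}" for j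
      proof (cases "j = Suc N")
        case True
        have "W (N + 1) \<in> borel_measurable ?V" by (rule measurable_vimage_algebra1) simp
        then show ?thesis using measurable_from_subalg[OF sub(2)] True by simp
      next
        case False
        then show ?thesis using that
          by (intro measurable_from_subalg[OF sub(1)] weight_measurable_history) auto
      qed
      show "parent k \<in> measurable (sigma (space M) G) (count_space UNIV)" if "k \<in> {2..n}" for k
        using that by (intro measurable_from_subalg[OF sub(1)] parent_measurable_history)
    qed
    then show "H \<in> sigma_sets (space \<mu>) G" using step.prems G_pow by (auto simp: \<mu>_def sets_measure_of)
  qed
  moreover have "H \<in> events" using step.prems subalgebra_history by (auto simp: subalgebra_def)
  moreover have "0 \<le> (\<integral>\<omega>. indicator H \<omega> * share i n \<omega> \<partial>M)"
    using share_range by (intro integral_nonneg_AE) (auto simp: indicator_def)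
  ultimately show ?case by (simp add: em em')
qed

lemma attachment_given_history:
  assumes n: "1 \<le> n" "n \<le> N" and \<Phi>: "integrable M \<Phi>" "\<Phi> \<in> borel_measurable (history N n)"
  shows "(\<integral>\<omega>. \<Phi> \<omega> * of_bool (parent (n + 1) \<omega> = i) \<partial>M) = (\<integral>\<omega>. \<Phi> \<omega> * share i n \<omega> \<partial>M)"
proof (cases "i \<in> {1..n}")
  case True
  interpret F: sigma_finite_subalgebra M "history N n" by (rule sigma_finite_history)
  have [measurable]: "\<Phi> \<in> borel_measurable M" using \<Phi> by simp
  have ind: "integrable M (indicator (attaches n i) :: 'a \<Rightarrow> real)"
    using n by (simp add: emeasure_eq_measure)
  have "AE \<omega> in M. real_cond_exp M (history N n) (indicator (attaches n i)) \<omega> = share i n \<omega>"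
  proof (rule F.real_cond_exp_charact)
    fix A assume A: "A \<in> sets (history N n)"
    then have A': "A \<in> events" using subalgebra_history by (auto simp: subalgebra_def)
    have "(LINT \<omega>:A|M. indicator (attaches n i) \<omega>) = prob (A \<inter> attaches n i)"
      unfolding set_lebesgue_integral_def using A' n by (simp flip: indicator_inter_arith)
    then show "(LINT \<omega>:A|M. indicator (attaches n i) \<omega>) = (LINT \<omega>:A|M. share i n \<omega>)"
      using attachment_given_history_aux[OF n(1) True n(2) A] by (simp add: set_lebesgue_integral_def)
  qed (use ind integrable_share share_measurable_history n in auto)
  then have "(\<integral>\<omega>. \<Phi> \<omega> * share i n \<omega> \<partial>M) =
      (\<integral>\<omega>. \<Phi> \<omega> * real_cond_exp M (history N n) (indicator (attaches n i)) \<omega> \<partial>M)"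
    by (intro integral_cong_AE) auto
  also have "\<dots> = (\<integral>\<omega>. \<Phi> \<omega> * indicator (attaches n i) \<omega> \<partial>M)"
    by (rule F.real_cond_exp_intg(2)) (use \<Phi> n in \<open>auto intro!: integrable_times_bounded split: split_indicator\<close>)
  also have "\<dots> = (\<integral>\<omega>. \<Phi> \<omega> * of_bool (parent (n + 1) \<omega> = i) \<partial>M)"
    by (intro Bochner_Integration.integral_cong) (auto simp: attaches_def indicator_def)
  finally show ?thesis by simp
next
  case False
  have "(\<integral>\<omega>. \<Phi> \<omega> * of_bool (parent (n + 1) \<omega> = i) \<partial>M) = (\<integral>\<omega>. 0 \<partial>M)"
    using parent_in_range[of "n + 1"] False n by (intro Bochner_Integration.integral_cong) force+
  moreover have "share i n = (\<lambda>_. 0)" using False by (auto simp: share_def fun_eq_iff)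
  ultimately show ?thesis by simp
qed

section \<open>Degrees given the weights\<close>
definition new_children :: "nat \<Rightarrow> nat \<Rightarrow> nat \<Rightarrow> 'a \<Rightarrow> nat" where
  "new_children n\<^sub>0 n i \<omega> = card {j \<in> {n\<^sub>0..<n}. parent (j + 1) \<omega> = i}"

lemma new_children_initial: "n \<le> n\<^sub>0 \<Longrightarrow> new_children n\<^sub>0 n i \<omega> = 0"
  by (simp add: new_children_def)

lemma new_children_Suc:
  assumes "n\<^sub>0 \<le> n"
  shows "new_children n\<^sub>0 (Suc n) i \<omega> = new_children n\<^sub>0 n i \<omega> + of_bool (parent (n + 1) \<omega> = i)"
proof -
  have "{j \<in> {n\<^sub>0..<Suc n}. parent (j + 1) \<omega> = i} =
        (if parent (n + 1) \<omega> = i then insert n else id) {j \<in> {n\<^sub>0..<n}. parent (j + 1) \<omega> = i}"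
    using assms by (auto simp: less_Suc_eq)
  then show ?thesis unfolding new_children_def by simp
qed

lemma new_children_measurable_history:
  assumes "1 \<le> n\<^sub>0"
  shows "new_children n\<^sub>0 n i \<in> measurable (history m n) (count_space UNIV)"
proof (induction n)
  case (Suc n)
  show ?case
  proof (cases "n\<^sub>0 \<le> n")
    case True
    have [measurable]: "new_children n\<^sub>0 n i \<in> measurable (history m (Suc n)) (count_space UNIV)"
      using measurable_history_mono[OF Suc] by simp
    have [measurable]: "parent (n + 1) \<in> measurable (history m (Suc n)) (count_space UNIV)"
      using True assms by (intro parent_measurable_history) auto
    have "new_children n\<^sub>0 (Suc n) i =
        (\<lambda>\<omega>. new_children n\<^sub>0 n i \<omega> + of_bool (parent (n + 1) \<omega> = i))"
      using new_children_Suc[OF True] by auto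
    moreover have "(\<lambda>\<omega>. new_children n\<^sub>0 n i \<omega> + of_bool (parent (n + 1) \<omega> = i))
        \<in> measurable (history m (Suc n)) (count_space UNIV)"
      by measurable
    ultimately show ?thesis by simp
  next
    case False
    then have "new_children n\<^sub>0 (Suc n) i = (\<lambda>_. 0)" using new_children_initial by auto
    then show ?thesis by simp
  qed
next
  case 0
  have "new_children n\<^sub>0 0 i = (\<lambda>_. 0)" using new_children_initial by auto
  then show ?case by simp
qed

lemma new_children_measurable [measurable]:
  "1 \<le> n\<^sub>0 \<Longrightarrow> new_children n\<^sub>0 n i \<in> measurable M (count_space UNIV)"
  using measurable_from_subalg[OF subalgebra_history new_children_measurable_history] .

text \<open>A random variable that depends on the weights only: the conditional probability, given all the
  weights, that \<open>new_children\<close> is at least \<open>k\<close>, as the next lemmas show.\<close>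
definition degree_tail :: "nat \<Rightarrow> nat \<Rightarrow> nat \<Rightarrow> nat \<Rightarrow> 'a \<Rightarrow> real" where
  "degree_tail n\<^sub>0 n i k \<omega> = tail_prob (\<lambda>j. if n\<^sub>0 \<le> j then share i j \<omega> else 0) n k"

lemma degree_tail_range: "degree_tail n\<^sub>0 n i k \<omega> \<in> {0..1}"
  unfolding degree_tail_def using share_range by (intro tail_prob_range) auto

lemma degree_tail_antitone: "degree_tail n\<^sub>0 n i (Suc k) \<omega> \<le> degree_tail n\<^sub>0 n i k \<omega>"
  unfolding degree_tail_def using share_range by (intro tail_prob_antitone) auto

lemma degree_tail_0 [simp]: "degree_tail n\<^sub>0 n i 0 \<omega> = 1"
  by (simp add: degree_tail_def)

lemma degree_tail_initial: "degree_tail n\<^sub>0 n\<^sub>0 i k \<omega> = of_bool (k = 0)"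
  unfolding degree_tail_def by (subst tail_prob_no_trials) auto

lemma degree_tail_Suc_Suc:
  "n\<^sub>0 \<le> n \<Longrightarrow> degree_tail n\<^sub>0 (Suc n) i (Suc k) \<omega> =
     (1 - share i n \<omega>) * degree_tail n\<^sub>0 n i (Suc k) \<omega> + share i n \<omega> * degree_tail n\<^sub>0 n i k \<omega>"
  by (simp add: degree_tail_def tail_prob_Suc_Suc)

lemma degree_tail_measurable_history:
  assumes "n\<^sub>0 \<le> n" "n \<le> Suc m"
  shows "degree_tail n\<^sub>0 n i k \<in> borel_measurable (history m l)"
  using assms
proof (induction n arbitrary: k rule: dec_induct)
  case base
  have "degree_tail n\<^sub>0 n\<^sub>0 i k = (\<lambda>_. of_bool (k = 0))" by (auto simp: degree_tail_initial)
  then show ?case by simp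
next
  case (step n)
  have [measurable]: "degree_tail n\<^sub>0 n i k \<in> borel_measurable (history m l)" for k
    using step by simp
  have [measurable]: "share i n \<in> borel_measurable (history m l)"
    using step.prems by (intro share_measurable_history) simp
  show ?case
  proof (cases k)
    case (Suc k')
    have "degree_tail n\<^sub>0 (Suc n) i k = (\<lambda>\<omega>. (1 - share i n \<omega>) * degree_tail n\<^sub>0 n i (Suc k') \<omega>
        + share i n \<omega> * degree_tail n\<^sub>0 n i k' \<omega>)"
      using degree_tail_Suc_Suc[OF step.hyps(1)] by (auto simp: Suc)
    then show ?thesis by simp
  qed simp
qed

lemma degree_tail_measurable [measurable]:
  "n\<^sub>0 \<le> n \<Longrightarrow> degree_tail n\<^sub>0 n i k \<in> borel_measurable M"
  using measurable_from_subalg[OF subalgebra_history degree_tail_measurable_history[of n\<^sub>0 n n]] by simp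

text \<open>Conditional expectation given the weights is expressed by integrating against weight-measurable
  \<open>\<Phi>\<close>. This form suits the induction on \<open>n\<close>: the success probability of the last trial is itself
  weight-measurable and is absorbed into \<open>\<Phi>\<close>.\<close>
lemma tail_given_weights:
  assumes "1 \<le> n\<^sub>0" and "n\<^sub>0 \<le> n" and "n \<le> Suc N"
    and "integrable M \<Phi>" and "\<Phi> \<in> borel_measurable (history N 1)"
  shows "(\<integral>\<omega>. \<Phi> \<omega> * of_bool (k \<le> new_children n\<^sub>0 n i \<omega>) \<partial>M) = (\<integral>\<omega>. \<Phi> \<omega> * degree_tail n\<^sub>0 n i k \<omega> \<partial>M)"
  using assms(2-)
proof (induction n arbitrary: k \<Phi> rule: dec_induct)
  case base
  then show ?case by (simp add: new_children_initial degree_tail_initial)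
next
  case (step n)
  note [measurable] = new_children_measurable[OF assms(1)]
  have n: "1 \<le> n" "n \<le> N" using step assms by auto
  have sh: "share i n \<in> borel_measurable (history N l)" for l
    using n share_measurable_history by auto
  show ?case
  proof (cases k)
    case (Suc k')
    define x where "x k \<omega> = (of_bool (k \<le> new_children n\<^sub>0 n i \<omega>) :: real)" for k \<omega>
    have [measurable]: "x k \<in> borel_measurable M" for k unfolding x_def by measurable
    have xh: "x k \<in> borel_measurable (history N n)" for k
      unfolding x_def using new_children_measurable_history[OF assms(1), of n i N] by measurable
    have \<Phi>h: "\<Phi> \<in> borel_measurable (history N n)"
      using measurable_history_mono[OF step.prems(3)] n by simp
    have s: "\<bar>share i n \<omega>\<bar> \<le> 1" "\<bar>1 - share i n \<omega>\<bar> \<le> 1" for \<omega> using share_range[of i n \<omega>] by auto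
    have int: "integrable M (\<lambda>\<omega>. \<Phi> \<omega> * x k \<omega>)" "integrable M (\<lambda>\<omega>. \<Phi> \<omega> * share i n \<omega>)"
       "integrable M (\<lambda>\<omega>. \<Phi> \<omega> * (1 - share i n \<omega>))"
       "integrable M (\<lambda>\<omega>. \<Phi> \<omega> * (x k' \<omega> - x (Suc k') \<omega>))" for k
      using step.prems s by (auto intro!: integrable_times_bounded simp: x_def)
    have int2: "integrable M (\<lambda>\<omega>. \<Phi> \<omega> * (x k' \<omega> - x (Suc k') \<omega>) * of_bool (parent (n + 1) \<omega> = i))"
      "integrable M (\<lambda>\<omega>. \<Phi> \<omega> * (1 - share i n \<omega>) * x (Suc k') \<omega>)"
      "integrable M (\<lambda>\<omega>. \<Phi> \<omega> * share i n \<omega> * x k' \<omega>)"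
      "integrable M (\<lambda>\<omega>. \<Phi> \<omega> * (x k' \<omega> - x (Suc k') \<omega>) * share i n \<omega>)"
      "integrable M (\<lambda>\<omega>. \<Phi> \<omega> * (1 - share i n \<omega>) * degree_tail n\<^sub>0 n i (Suc k') \<omega>)"
      "integrable M (\<lambda>\<omega>. \<Phi> \<omega> * share i n \<omega> * degree_tail n\<^sub>0 n i k' \<omega>)"
      using int s parent_measurable_UNIV[of "n + 1"] n degree_tail_range[of n\<^sub>0 n i _] step.hyps
      by (auto intro!: integrable_times_bounded simp: x_def)
    have "(\<integral>\<omega>. \<Phi> \<omega> * of_bool (k \<le> new_children n\<^sub>0 (Suc n) i \<omega>) \<partial>M) =
          (\<integral>\<omega>. \<Phi> \<omega> * x (Suc k') \<omega> + \<Phi> \<omega> * (x k' \<omega> - x (Suc k') \<omega>) * of_bool (parent (n + 1) \<omega> = i) \<partial>M)"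
      using step.hyps by (intro Bochner_Integration.integral_cong) (auto simp: Suc x_def new_children_Suc)
    also have "\<dots> = (\<integral>\<omega>. \<Phi> \<omega> * x (Suc k') \<omega> \<partial>M) + (\<integral>\<omega>. \<Phi> \<omega> * (x k' \<omega> - x (Suc k') \<omega>) * of_bool (parent (n + 1) \<omega> = i) \<partial>M)"
      by (rule Bochner_Integration.integral_add) (use int int2 in auto)
    also have "(\<integral>\<omega>. \<Phi> \<omega> * (x k' \<omega> - x (Suc k') \<omega>) * of_bool (parent (n + 1) \<omega> = i) \<partial>M)
              = (\<integral>\<omega>. \<Phi> \<omega> * (x k' \<omega> - x (Suc k') \<omega>) * share i n \<omega> \<partial>M)"
      by (rule attachment_given_history[where N = N]) (use n int xh \<Phi>h in auto)
    also have "(\<integral>\<omega>. \<Phi> \<omega> * x (Suc k') \<omega> \<partial>M) + \<dots> =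
       (\<integral>\<omega>. \<Phi> \<omega> * (1 - share i n \<omega>) * x (Suc k') \<omega> + \<Phi> \<omega> * share i n \<omega> * x k' \<omega> \<partial>M)"
      by (subst Bochner_Integration.integral_add[symmetric])
         (use int int2 in \<open>auto intro!: Bochner_Integration.integral_cong simp: algebra_simps\<close>)
    also have "\<dots> = (\<integral>\<omega>. \<Phi> \<omega> * (1 - share i n \<omega>) * x (Suc k') \<omega> \<partial>M) + (\<integral>\<omega>. \<Phi> \<omega> * share i n \<omega> * x k' \<omega> \<partial>M)"
      by (rule Bochner_Integration.integral_add) (use int2 in auto)
    also have "(\<integral>\<omega>. \<Phi> \<omega> * (1 - share i n \<omega>) * x (Suc k') \<omega> \<partial>M)
             = (\<integral>\<omega>. \<Phi> \<omega> * (1 - share i n \<omega>) * degree_tail n\<^sub>0 n i (Suc k') \<omega> \<partial>M)"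
      unfolding x_def using step.prems int by (intro step.IH borel_measurable_times borel_measurable_diff sh) auto
    also have "(\<integral>\<omega>. \<Phi> \<omega> * share i n \<omega> * x k' \<omega> \<partial>M) = (\<integral>\<omega>. \<Phi> \<omega> * share i n \<omega> * degree_tail n\<^sub>0 n i k' \<omega> \<partial>M)"
      unfolding x_def using step.prems int by (intro step.IH borel_measurable_times sh) auto
    also have "(\<integral>\<omega>. \<Phi> \<omega> * (1 - share i n \<omega>) * degree_tail n\<^sub>0 n i (Suc k') \<omega> \<partial>M) + \<dots> =
       (\<integral>\<omega>. \<Phi> \<omega> * degree_tail n\<^sub>0 (Suc n) i k \<omega> \<partial>M)"
      by (subst Bochner_Integration.integral_add[symmetric])
         (use int2 step.hyps in \<open>auto intro!: Bochner_Integration.integral_cong simp: Suc degree_tail_Suc_Suc algebra_simps\<close>)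
    finally show ?thesis .
  qed simp
qed

text \<open>A trial that favours \<open>i\<close> cannot favour \<open>i'\<close>. With conditional tails \<open>f\<close>, \<open>h\<close> and success probabilities
  \<open>s\<close>, \<open>s'\<close>, the product of the two one-vertex recursions exceeds the joint recursion by
  \<open>s s' (f a' - f (a' + 1)) (h b' - h (b' + 1))\<close>, which is nonnegative by monotonicity in the
  threshold.\<close>
lemma joint_tail_given_weights:
  assumes "1 \<le> n\<^sub>0" and ne: "i \<noteq> i'" and "n\<^sub>0 \<le> n" and "n \<le> Suc N"
    and "integrable M \<Phi>" and "\<Phi> \<in> borel_measurable (history N 1)" and "AE \<omega> in M. 0 \<le> \<Phi> \<omega>"
  shows "(\<integral>\<omega>. \<Phi> \<omega> * (of_bool (a \<le> new_children n\<^sub>0 n i \<omega>) * of_bool (b \<le> new_children n\<^sub>0 n i' \<omega>)) \<partial>M)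
       \<le> (\<integral>\<omega>. \<Phi> \<omega> * (degree_tail n\<^sub>0 n i a \<omega> * degree_tail n\<^sub>0 n i' b \<omega>) \<partial>M)"
  using assms(3-)
proof (induction n arbitrary: a b \<Phi> rule: dec_induct)
  case base
  then show ?case by (simp add: new_children_initial degree_tail_initial)
next
  case (step n)
  note [measurable] = new_children_measurable[OF assms(1)]
  have n: "1 \<le> n" "n \<le> N" "n\<^sub>0 \<le> Suc n" using step assms by auto
  consider "a = 0" | "b = 0" | a' b' where "a = Suc a'" "b = Suc b'"
    by (cases a; cases b) auto
  then show ?case
  proof cases
    case 1
    then show ?thesis using tail_given_weights[OF assms(1) n(3) step.prems(1-3), where k = b and i = i'] by simp
  next
    case 2
    then show ?thesis using tail_given_weights[OF assms(1) n(3) step.prems(1-3), where k = a and i = i] by simp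
  next
    case 3
    define x where "x k \<omega> = (of_bool (k \<le> new_children n\<^sub>0 n i \<omega>) :: real)" for k \<omega>
    define y where "y k \<omega> = (of_bool (k \<le> new_children n\<^sub>0 n i' \<omega>) :: real)" for k \<omega>
    define f where "f = degree_tail n\<^sub>0 n i"
    define h where "h = degree_tail n\<^sub>0 n i'"
    define s where "s = share i n"
    define s' where "s' = share i' n"
    define X where "X \<omega> = x a' \<omega> - x (Suc a') \<omega>" for \<omega>
    define Y where "Y \<omega> = y b' \<omega> - y (Suc b') \<omega>" for \<omega>
    note defs = x_def y_def f_def h_def s_def s'_def X_def Y_def
    have range: "0 \<le> f k \<omega>" "f k \<omega> \<le> 1" "0 \<le> h k \<omega>" "h k \<omega> \<le> 1"
        "0 \<le> s \<omega>" "s \<omega> \<le> 1" "0 \<le> s' \<omega>" "s' \<omega> \<le> 1"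
        "0 \<le> x k \<omega>" "x k \<omega> \<le> 1" "0 \<le> y k \<omega>" "y k \<omega> \<le> 1" "0 \<le> X \<omega>" "X \<omega> \<le> 1" "0 \<le> Y \<omega>" "Y \<omega> \<le> 1"
        for k \<omega>
      using degree_tail_range[of n\<^sub>0 n _ k \<omega>] share_range[of _ n \<omega>] by (auto simp: defs)
    have meas [measurable]: "x k \<in> borel_measurable M" "y k \<in> borel_measurable M"
       "f k \<in> borel_measurable M" "h k \<in> borel_measurable M"
       "s \<in> borel_measurable M" "s' \<in> borel_measurable M"
       "X \<in> borel_measurable M" "Y \<in> borel_measurable M"
       for k using step.hyps unfolding defs by measurable
    have meas_h [measurable]: "x k \<in> borel_measurable (history N n)" "y k \<in> borel_measurable (history N n)"
      "\<Phi> \<in> borel_measurable (history N n)" for k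
      unfolding x_def y_def using new_children_measurable_history[OF assms(1), of n _ N]
        measurable_history_mono[OF step.prems(3)] n by auto
    have sh [measurable]: "s \<in> borel_measurable (history N l)" "s' \<in> borel_measurable (history N l)" for l
      unfolding s_def s'_def using n share_measurable_history by auto
    have bnd: "\<bar>f k \<omega>\<bar> \<le> 1" "\<bar>h k \<omega>\<bar> \<le> 1" "\<bar>s \<omega>\<bar> \<le> 1" "\<bar>s' \<omega>\<bar> \<le> 1" "\<bar>x k \<omega>\<bar> \<le> 1" "\<bar>y k \<omega>\<bar> \<le> 1"
       "\<bar>X \<omega>\<bar> \<le> 1" "\<bar>Y \<omega>\<bar> \<le> 1" "\<bar>1 - s \<omega> - s' \<omega>\<bar> \<le> 1" "\<bar>1 - s \<omega>\<bar> \<le> 1" "\<bar>1 - s' \<omega>\<bar> \<le> 1" for k \<omega>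
      using range(1-4)[of k \<omega>] range(5-8)[of \<omega>] range(9-12)[of k \<omega>] range(13-16)[of \<omega>] by auto
    have I: "integrable M (\<lambda>\<omega>. \<Psi> \<omega> * B \<omega>)"
      if "integrable M \<Psi>" "B \<in> borel_measurable M" "\<And>\<omega>. \<bar>B \<omega>\<bar> \<le> 1" for \<Psi> B :: "'a \<Rightarrow> real"
      using that by (rule integrable_times_bounded)
    note \<Phi> = step.prems(2)
    \<comment> \<open>The two indicators \<open>J\<close> and \<open>J'\<close> are never both one, so there is no \<open>J J'\<close> term below.\<close>
    define J where "J \<omega> = (of_bool (parent (n + 1) \<omega> = i) :: real)" for \<omega>
    define J' where "J' \<omega> = (of_bool (parent (n + 1) \<omega> = i') :: real)" for \<omega>
    have [measurable]: "J \<in> borel_measurable M" "J' \<in> borel_measurable M"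
      using parent_measurable_UNIV[of "n + 1"] n by (auto simp: J_def[abs_def] J'_def[abs_def])
    have bI: "\<bar>J \<omega>\<bar> \<le> 1" "\<bar>J' \<omega>\<bar> \<le> 1" for \<omega> by (auto simp: J_def J'_def)
    have "(\<integral>\<omega>. \<Phi> \<omega> * (of_bool (a \<le> new_children n\<^sub>0 (Suc n) i \<omega>) * of_bool (b \<le> new_children n\<^sub>0 (Suc n) i' \<omega>)) \<partial>M)
      = (\<integral>\<omega>. \<Phi> \<omega> * x (Suc a') \<omega> * y (Suc b') \<omega> + \<Phi> \<omega> * x (Suc a') \<omega> * Y \<omega> * J' \<omega>
             + \<Phi> \<omega> * X \<omega> * y (Suc b') \<omega> * J \<omega> \<partial>M)"
      using step.hyps ne by (intro Bochner_Integration.integral_cong) (auto simp: 3 defs J_def J'_def new_children_Suc)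
    also have "\<dots> = (\<integral>\<omega>. \<Phi> \<omega> * x (Suc a') \<omega> * y (Suc b') \<omega> \<partial>M)
         + (\<integral>\<omega>. \<Phi> \<omega> * x (Suc a') \<omega> * Y \<omega> * J' \<omega> \<partial>M) + (\<integral>\<omega>. \<Phi> \<omega> * X \<omega> * y (Suc b') \<omega> * J \<omega> \<partial>M)"
      by (simp add: I \<Phi> bnd bI)
    also have "(\<integral>\<omega>. \<Phi> \<omega> * x (Suc a') \<omega> * Y \<omega> * J' \<omega> \<partial>M) = (\<integral>\<omega>. \<Phi> \<omega> * x (Suc a') \<omega> * Y \<omega> * s' \<omega> \<partial>M)"
      unfolding s'_def J'_def by (rule attachment_given_history[where N = N])
        (use n I[OF I[OF \<Phi> meas(1)] meas(8)] bnd in \<open>auto simp: Y_def[abs_def]\<close>)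
    also have "(\<integral>\<omega>. \<Phi> \<omega> * X \<omega> * y (Suc b') \<omega> * J \<omega> \<partial>M) = (\<integral>\<omega>. \<Phi> \<omega> * X \<omega> * y (Suc b') \<omega> * s \<omega> \<partial>M)"
      unfolding s_def J_def by (rule attachment_given_history[where N = N])
        (use n I[OF I[OF \<Phi> meas(7)] meas(2)] bnd in \<open>auto simp: X_def[abs_def]\<close>)
    also have "(\<integral>\<omega>. \<Phi> \<omega> * x (Suc a') \<omega> * y (Suc b') \<omega> \<partial>M)
         + (\<integral>\<omega>. \<Phi> \<omega> * x (Suc a') \<omega> * Y \<omega> * s' \<omega> \<partial>M) + (\<integral>\<omega>. \<Phi> \<omega> * X \<omega> * y (Suc b') \<omega> * s \<omega> \<partial>M)
       = (\<integral>\<omega>. \<Phi> \<omega> * x (Suc a') \<omega> * y (Suc b') \<omega> + \<Phi> \<omega> * x (Suc a') \<omega> * Y \<omega> * s' \<omega>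
             + \<Phi> \<omega> * X \<omega> * y (Suc b') \<omega> * s \<omega> \<partial>M)"
      by (simp add: I \<Phi> bnd)
    also have "\<dots> = (\<integral>\<omega>. \<Phi> \<omega> * (1 - s \<omega> - s' \<omega>) * (x (Suc a') \<omega> * y (Suc b') \<omega>)
             + \<Phi> \<omega> * s' \<omega> * (x (Suc a') \<omega> * y b' \<omega>) + \<Phi> \<omega> * s \<omega> * (x a' \<omega> * y (Suc b') \<omega>) \<partial>M)"
      by (intro Bochner_Integration.integral_cong) (auto simp: X_def Y_def algebra_simps)
    also have "\<dots> = (\<integral>\<omega>. \<Phi> \<omega> * (1 - s \<omega> - s' \<omega>) * (x (Suc a') \<omega> * y (Suc b') \<omega>) \<partial>M)
             + (\<integral>\<omega>. \<Phi> \<omega> * s' \<omega> * (x (Suc a') \<omega> * y b' \<omega>) \<partial>M) + (\<integral>\<omega>. \<Phi> \<omega> * s \<omega> * (x a' \<omega> * y (Suc b') \<omega>) \<partial>M)"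
      by (simp add: I \<Phi> bnd mult.assoc[symmetric])
    also have "\<dots> \<le> (\<integral>\<omega>. \<Phi> \<omega> * (1 - s \<omega> - s' \<omega>) * (f (Suc a') \<omega> * h (Suc b') \<omega>) \<partial>M)
             + (\<integral>\<omega>. \<Phi> \<omega> * s' \<omega> * (f (Suc a') \<omega> * h b' \<omega>) \<partial>M) + (\<integral>\<omega>. \<Phi> \<omega> * s \<omega> * (f a' \<omega> * h (Suc b') \<omega>) \<partial>M)"
    proof -
      have nonneg: "AE \<omega> in M. 0 \<le> \<Phi> \<omega> * (1 - s \<omega> - s' \<omega>)"
        using step.prems(4) shares_sum_le[OF ne]
      proof eventually_elim
        case (elim \<omega>)
        then have "s \<omega> + s' \<omega> \<le> 1" by (simp add: s_def s'_def)
        then show ?case using elim by simp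
      qed
      have nonneg': "AE \<omega> in M. 0 \<le> \<Phi> \<omega> * s' \<omega>" "AE \<omega> in M. 0 \<le> \<Phi> \<omega> * s \<omega>"
        using step.prems(4) by (eventually_elim, simp add: range)+
      have m: "\<Phi> \<in> borel_measurable (history N 1)" by (rule step.prems)
      show ?thesis
        unfolding x_def y_def f_def h_def using n
        by (intro add_mono step.IH I \<Phi> nonneg nonneg' borel_measurable_times borel_measurable_diff
              borel_measurable_const sh m meas bnd) auto
    qed
    also have "\<dots> = (\<integral>\<omega>. \<Phi> \<omega> * (1 - s \<omega> - s' \<omega>) * (f (Suc a') \<omega> * h (Suc b') \<omega>)
             + \<Phi> \<omega> * s' \<omega> * (f (Suc a') \<omega> * h b' \<omega>) + \<Phi> \<omega> * s \<omega> * (f a' \<omega> * h (Suc b') \<omega>) \<partial>M)"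
      by (simp add: I \<Phi> bnd mult.assoc[symmetric])
    also have "\<dots> \<le> (\<integral>\<omega>. \<Phi> \<omega> * (((1 - s \<omega>) * f (Suc a') \<omega> + s \<omega> * f a' \<omega>)
                                    * ((1 - s' \<omega>) * h (Suc b') \<omega> + s' \<omega> * h b' \<omega>)) \<partial>M)"
    proof (rule integral_mono_AE)
      show "AE \<omega> in M. \<Phi> \<omega> * (1 - s \<omega> - s' \<omega>) * (f (Suc a') \<omega> * h (Suc b') \<omega>)
             + \<Phi> \<omega> * s' \<omega> * (f (Suc a') \<omega> * h b' \<omega>) + \<Phi> \<omega> * s \<omega> * (f a' \<omega> * h (Suc b') \<omega>)
           \<le> \<Phi> \<omega> * (((1 - s \<omega>) * f (Suc a') \<omega> + s \<omega> * f a' \<omega>) * ((1 - s' \<omega>) * h (Suc b') \<omega> + s' \<omega> * h b' \<omega>))"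
        using step.prems(4)
      proof eventually_elim
        case (elim \<omega>)
        have "0 \<le> \<Phi> \<omega> * (s \<omega> * s' \<omega> * ((f a' \<omega> - f (Suc a') \<omega>) * (h b' \<omega> - h (Suc b') \<omega>)))"
          using elim range(1-4)[of _ \<omega>] range(5-8)[of \<omega>] degree_tail_antitone by (auto simp: f_def h_def)
        then show ?case by (simp add: algebra_simps)
      qed
      have "integrable M (\<lambda>\<omega>. \<Phi> \<omega> * (((1 - s \<omega>) * f (Suc a') \<omega> + s \<omega> * f a' \<omega>) * ((1 - s' \<omega>) * h (Suc b') \<omega> + s' \<omega> * h b' \<omega>)))"
      proof (rule I[OF \<Phi>])
        fix \<omega>
        have "0 \<le> (1 - s \<omega>) * f (Suc a') \<omega> + s \<omega> * f a' \<omega>" "(1 - s \<omega>) * f (Suc a') \<omega> + s \<omega> * f a' \<omega> \<le> 1"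
          "0 \<le> (1 - s' \<omega>) * h (Suc b') \<omega> + s' \<omega> * h b' \<omega>" "(1 - s' \<omega>) * h (Suc b') \<omega> + s' \<omega> * h b' \<omega> \<le> 1"
          using range(1-4)[of _ \<omega>] range(5-8)[of \<omega>] by (auto intro!: convex_bound_le)
        then show "\<bar>((1 - s \<omega>) * f (Suc a') \<omega> + s \<omega> * f a' \<omega>) * ((1 - s' \<omega>) * h (Suc b') \<omega> + s' \<omega> * h b' \<omega>)\<bar> \<le> 1"
          by (simp add: mult_le_one)
      qed measurable
      then show "integrable M (\<lambda>\<omega>. \<Phi> \<omega> * (((1 - s \<omega>) * f (Suc a') \<omega> + s \<omega> * f a' \<omega>) * ((1 - s' \<omega>) * h (Suc b') \<omega> + s' \<omega> * h b' \<omega>)))" .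
    qed (simp add: I \<Phi> bnd mult.assoc[symmetric])
    also have "\<dots> = (\<integral>\<omega>. \<Phi> \<omega> * (degree_tail n\<^sub>0 (Suc n) i a \<omega> * degree_tail n\<^sub>0 (Suc n) i' b \<omega>) \<partial>M)"
      using step.hyps by (intro Bochner_Integration.integral_cong) (auto simp: 3 f_def h_def s_def s'_def degree_tail_Suc_Suc)
    finally show ?thesis .
  qed
qed

text \<open>Let \<open>X\<close> be the number of vertices of in-degree at least \<open>k\<close> and \<open>F\<close> its conditional mean. Negative
  correlation gives \<open>E[X\<^sup>2] \<le> F + F\<^sup>2\<close> given the weights, so \<open>X = 0\<close> has conditional probability at most
  \<open>1 / F\<close>. The weight-measurable multipliers \<open>\<Phi> = 1 / F\<^sup>2\<close> and \<open>\<Psi> = 1 / F\<close> on \<open>F \<ge> L\<close> carry out this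
  conditional Chebyshev bound inside unconditional integrals.\<close>
lemma no_large_vertex_given_weights:
  assumes n: "1 \<le> n\<^sub>0" "n\<^sub>0 \<le> n" and L: "0 < L"
  shows "prob {\<omega> \<in> space M. (\<forall>i\<in>{1..n}. new_children n\<^sub>0 n i \<omega> < k) \<and> L \<le> (\<Sum>i=1..n. degree_tail n\<^sub>0 n i k \<omega>)} \<le> 1 / L"
proof -
  note [measurable] = new_children_measurable[OF n(1)] degree_tail_measurable[OF n(2)]
  define F where "F \<omega> = (\<Sum>i=1..n. degree_tail n\<^sub>0 n i k \<omega>)" for \<omega>
  define x where "x i \<omega> = (of_bool (k \<le> new_children n\<^sub>0 n i \<omega>) :: real)" for i \<omega>
  define f where "f i = degree_tail n\<^sub>0 n i k" for i
  define X where "X \<omega> = (\<Sum>i=1..n. x i \<omega>)" for \<omega>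
  define \<Phi> where "\<Phi> \<omega> = of_bool (L \<le> F \<omega>) / (F \<omega>)\<^sup>2" for \<omega>
  define \<Psi> where "\<Psi> \<omega> = of_bool (L \<le> F \<omega>) / F \<omega>" for \<omega>
  have F_f: "F \<omega> = (\<Sum>i=1..n. f i \<omega>)" for \<omega> by (simp add: F_def f_def)
  have [measurable]: "f i \<in> borel_measurable (history n 1)" for i
    unfolding f_def using degree_tail_measurable_history[OF n(2)] by simp
  have [measurable]: "F \<in> borel_measurable (history n 1)"
    unfolding F_f[abs_def] by measurable
  have mh: "\<Phi> \<in> borel_measurable (history n 1)" "\<Psi> \<in> borel_measurable (history n 1)"
    unfolding \<Phi>_def[abs_def] \<Psi>_def[abs_def] by measurable
  have [measurable]: "\<Phi> \<in> borel_measurable M" "\<Psi> \<in> borel_measurable M" "F \<in> borel_measurable M"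
     "f i \<in> borel_measurable M" "x i \<in> borel_measurable M" "X \<in> borel_measurable M" for i
    using measurable_from_subalg[OF subalgebra_history mh(1)] measurable_from_subalg[OF subalgebra_history mh(2)]
    by (simp_all add: f_def F_def[abs_def] x_def[abs_def] X_def[abs_def])
  have \<Phi>0: "0 \<le> \<Phi> \<omega>" "0 \<le> \<Psi> \<omega>" "\<bar>\<Phi> \<omega>\<bar> \<le> 1 / L\<^sup>2" "\<bar>\<Psi> \<omega>\<bar> \<le> 1 / L" for \<omega>
    using L by (auto simp: \<Phi>_def \<Psi>_def intro!: divide_left_mono power_mono)
  have int: "integrable M \<Phi>" "integrable M \<Psi>"
    using \<Phi>0(3,4) integrable_const_bound[of \<Phi> "1 / L\<^sup>2"] integrable_const_bound[of \<Psi> "1 / L"]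
    by simp_all
  have x01: "\<bar>x i \<omega>\<bar> \<le> 1" "x i \<omega> * x i \<omega> = x i \<omega>" for i \<omega> by (auto simp: x_def)
  have f01: "\<bar>f i \<omega>\<bar> \<le> 1" "0 \<le> f i \<omega>" for i \<omega> using degree_tail_range[of n\<^sub>0 n i k \<omega>] by (auto simp: f_def)
  have I: "integrable M (\<lambda>\<omega>. A \<omega> * B \<omega>)"
      if "integrable M A" "B \<in> borel_measurable M" "\<And>\<omega>. \<bar>B \<omega>\<bar> \<le> 1" for A B :: "'a \<Rightarrow> real"
    using that by (rule integrable_times_bounded)
  have \<Phi>F: "\<Phi> \<omega> * F \<omega> = \<Psi> \<omega>" for \<omega> using L by (auto simp: \<Phi>_def \<Psi>_def power2_eq_square)
  have XX: "\<Phi> \<omega> * (X \<omega>)\<^sup>2 = (\<Sum>i=1..n. \<Sum>j=1..n. \<Phi> \<omega> * (x i \<omega> * x j \<omega>))" for \<omega>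
    by (simp only: X_def power2_eq_square sum_product) (simp only: sum_distrib_left)
  have FF: "\<Psi> \<omega> * F \<omega> = (\<Sum>i=1..n. \<Sum>j=1..n. \<Phi> \<omega> * (f i \<omega> * f j \<omega>))" for \<omega>
  proof -
    have "\<Psi> \<omega> * F \<omega> = \<Phi> \<omega> * (F \<omega> * F \<omega>)" by (simp add: \<Phi>F[symmetric])
    also have "\<dots> = (\<Sum>i=1..n. \<Sum>j=1..n. \<Phi> \<omega> * (f i \<omega> * f j \<omega>))"
      by (simp only: F_f sum_product) (simp only: sum_distrib_left)
    finally show ?thesis .
  qed
  have intXX: "integrable M (\<lambda>\<omega>. \<Phi> \<omega> * (X \<omega>)\<^sup>2)"
    unfolding XX by (intro Bochner_Integration.integrable_sum I int) (use x01 in \<open>auto simp: abs_mult mult_le_one\<close>)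
  have intXF: "integrable M (\<lambda>\<omega>. \<Psi> \<omega> * X \<omega>)" "integrable M (\<lambda>\<omega>. \<Psi> \<omega> * F \<omega>)"
    unfolding X_def F_f sum_distrib_left
    by (intro Bochner_Integration.integrable_sum I int; use x01 f01 in auto)+
  have E1: "(\<integral>\<omega>. \<Psi> \<omega> * X \<omega> \<partial>M) = (\<integral>\<omega>. \<Psi> \<omega> * F \<omega> \<partial>M)"
  proof -
    have "(\<integral>\<omega>. \<Psi> \<omega> * X \<omega> \<partial>M) = (\<Sum>i=1..n. \<integral>\<omega>. \<Psi> \<omega> * x i \<omega> \<partial>M)"
      unfolding X_def sum_distrib_left by (intro Bochner_Integration.integral_sum I int) (use x01 in auto)
    also have "\<dots> = (\<Sum>i=1..n. \<integral>\<omega>. \<Psi> \<omega> * f i \<omega> \<partial>M)"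
      unfolding x_def f_def by (intro sum.cong tail_given_weights[where N = n]) (use n int mh in auto)
    also have "\<dots> = (\<integral>\<omega>. \<Psi> \<omega> * F \<omega> \<partial>M)"
      unfolding F_f sum_distrib_left by (intro Bochner_Integration.integral_sum[symmetric] I int) (use f01 in auto)
    finally show ?thesis .
  qed
  have E2: "(\<integral>\<omega>. \<Phi> \<omega> * (X \<omega>)\<^sup>2 \<partial>M) \<le> (\<integral>\<omega>. \<Psi> \<omega> \<partial>M) + (\<integral>\<omega>. \<Psi> \<omega> * F \<omega> \<partial>M)"
  proof -
    have Ix: "integrable M (\<lambda>\<omega>. \<Phi> \<omega> * (x i \<omega> * x j \<omega>))" "integrable M (\<lambda>\<omega>. \<Phi> \<omega> * (f i \<omega> * f j \<omega>))" 
      "integrable M (\<lambda>\<omega>. \<Phi> \<omega> * f i \<omega>)" for i j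
      by (intro I int; use x01 f01 in \<open>auto simp: abs_mult mult_le_one\<close>)+
    have "(\<integral>\<omega>. \<Phi> \<omega> * (X \<omega>)\<^sup>2 \<partial>M) = (\<Sum>i=1..n. \<Sum>j=1..n. \<integral>\<omega>. \<Phi> \<omega> * (x i \<omega> * x j \<omega>) \<partial>M)"
      unfolding XX by (simp add: Ix)
    also have "\<dots> \<le> (\<Sum>i=1..n. \<Sum>j=1..n. (\<integral>\<omega>. \<Phi> \<omega> * (f i \<omega> * f j \<omega>) \<partial>M)
                        + (if i = j then \<integral>\<omega>. \<Phi> \<omega> * f i \<omega> \<partial>M else 0))"
    proof (intro sum_mono)
      fix i j
      show "(\<integral>\<omega>. \<Phi> \<omega> * (x i \<omega> * x j \<omega>) \<partial>M) \<le> (\<integral>\<omega>. \<Phi> \<omega> * (f i \<omega> * f j \<omega>) \<partial>M)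
                        + (if i = j then \<integral>\<omega>. \<Phi> \<omega> * f i \<omega> \<partial>M else 0)"
      proof (cases "i = j")
        case True
        have "(\<integral>\<omega>. \<Phi> \<omega> * (x i \<omega> * x i \<omega>) \<partial>M) = (\<integral>\<omega>. \<Phi> \<omega> * f i \<omega> \<partial>M)"
          unfolding x01(2) unfolding x_def f_def by (intro tail_given_weights[where N = n]) (use n int mh in auto)
        moreover have "0 \<le> (\<integral>\<omega>. \<Phi> \<omega> * (f i \<omega> * f i \<omega>) \<partial>M)"
          using \<Phi>0 by (intro integral_nonneg_AE) auto
        ultimately show ?thesis using True by simp
      next
        case False
        then show ?thesis
          unfolding x_def f_def using joint_tail_given_weights[OF n(1) False n(2), of n \<Phi> k k] int mh \<Phi>0 by simp
      qed
    qed
    also have "\<dots> = (\<Sum>i=1..n. \<Sum>j=1..n. \<integral>\<omega>. \<Phi> \<omega> * (f i \<omega> * f j \<omega>) \<partial>M) + (\<Sum>i=1..n. \<integral>\<omega>. \<Phi> \<omega> * f i \<omega> \<partial>M)"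
      by (simp add: sum.distrib)
    also have "(\<Sum>i=1..n. \<Sum>j=1..n. \<integral>\<omega>. \<Phi> \<omega> * (f i \<omega> * f j \<omega>) \<partial>M) = (\<integral>\<omega>. \<Psi> \<omega> * F \<omega> \<partial>M)"
      unfolding FF by (simp add: Ix)
    also have "(\<Sum>i=1..n. \<integral>\<omega>. \<Phi> \<omega> * f i \<omega> \<partial>M) = (\<integral>\<omega>. \<Psi> \<omega> \<partial>M)"
      unfolding \<Phi>F[symmetric] F_f sum_distrib_left by (simp add: Ix)
    finally show ?thesis by simp
  qed
  have eq: "{\<omega> \<in> space M. (\<forall>i\<in>{1..n}. new_children n\<^sub>0 n i \<omega> < k) \<and> L \<le> (\<Sum>i=1..n. degree_tail n\<^sub>0 n i k \<omega>)}
      = {\<omega> \<in> space M. X \<omega> = 0 \<and> L \<le> F \<omega>}"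
    by (auto simp: X_def F_def x_def sum_nonneg_eq_0_iff not_le)
  have "prob {\<omega> \<in> space M. X \<omega> = 0 \<and> L \<le> F \<omega>} = (\<integral>\<omega>. indicator {\<omega> \<in> space M. X \<omega> = 0 \<and> L \<le> F \<omega>} \<omega> \<partial>M)"
    by simp
  also have "\<dots> \<le> (\<integral>\<omega>. \<Phi> \<omega> * (X \<omega>)\<^sup>2 - 2 * (\<Psi> \<omega> * X \<omega>) + \<Psi> \<omega> * F \<omega> \<partial>M)"
  proof (rule integral_mono)
    fix \<omega> assume "\<omega> \<in> space M"
    have "\<Phi> \<omega> * (X \<omega>)\<^sup>2 - 2 * (\<Psi> \<omega> * X \<omega>) + \<Psi> \<omega> * F \<omega> = \<Phi> \<omega> * (X \<omega> - F \<omega>)\<^sup>2"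
      by (simp add: \<Phi>F[symmetric] power2_eq_square algebra_simps)
    moreover have "\<Phi> \<omega> * (X \<omega> - F \<omega>)\<^sup>2 = 1" if "X \<omega> = 0" "L \<le> F \<omega>"
      using that L by (simp add: \<Phi>_def)
    ultimately show "indicat_real {\<omega> \<in> space M. X \<omega> = 0 \<and> L \<le> F \<omega>} \<omega> \<le>
         \<Phi> \<omega> * (X \<omega>)\<^sup>2 - 2 * (\<Psi> \<omega> * X \<omega>) + \<Psi> \<omega> * F \<omega>"
      using \<Phi>0(1)[of \<omega>] by (auto simp: indicator_def)
  qed (use intXX intXF in \<open>auto simp: emeasure_eq_measure\<close>)
  also have "\<dots> = (\<integral>\<omega>. \<Phi> \<omega> * (X \<omega>)\<^sup>2 \<partial>M) - 2 * (\<integral>\<omega>. \<Psi> \<omega> * X \<omega> \<partial>M) + (\<integral>\<omega>. \<Psi> \<omega> * F \<omega> \<partial>M)"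
    using intXX intXF by simp
  also have "\<dots> \<le> (\<integral>\<omega>. \<Psi> \<omega> \<partial>M)" using E1 E2 by simp
  also have "\<dots> \<le> (\<integral>\<omega>. 1 / L \<partial>M)"
    using \<Phi>0(4) int by (intro integral_mono) (auto simp: abs_le_iff)
  finally show ?thesis unfolding eq by (simp add: prob_space)
qed

end

text \<open>A lower tail bound in terms of the mean alone, also when that mean is far smaller than the number
  of summands: the chord bound \<open>exp (- y) \<le> 1 - y / 2\<close> on \<open>[0, 1]\<close> gives
  \<open>E[exp (- \<Sum> Y)] \<le> exp (- A / 2)\<close>, and Markov's inequality at level \<open>exp (- A / 4)\<close> finishes.\<close>
lemma (in prob_space) indep_sum_lower_tail:
  fixes Y :: "'b \<Rightarrow> 'a \<Rightarrow> real"
  assumes fin: "finite I" and indep: "indep_vars (\<lambda>_. borel) Y I"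
    and range: "\<And>i. i \<in> I \<Longrightarrow> AE \<omega> in M. Y i \<omega> \<in> {0..1}"
    and A: "A = (\<Sum>i\<in>I. expectation (Y i))"
  shows "prob {\<omega> \<in> space M. (\<Sum>i\<in>I. Y i \<omega>) \<le> A / 4} \<le> exp (- A / 4)"
proof -
  have [measurable]: "Y i \<in> borel_measurable M" if "i \<in> I" for i
    using indep that by (auto simp: indep_vars_def)
  have chord: "exp (- x) \<le> 1 - x / 2" if "x \<in> {0..1}" for x :: real
  proof -
    have "exp ((1 - x) *\<^sub>R 0 + x *\<^sub>R (-1)) \<le> (1 - x) * exp 0 + x * exp (-1::real)"
      using that by (intro convex_onD[OF exp_convex]) auto
    moreover have "exp (-1::real) \<le> 1 / 2"
      using exp_ge_add_one_self[of "1::real"] by (simp add: exp_minus field_simps)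
    then have "x * exp (-1::real) \<le> x * (1 / 2)" using that by (intro mult_left_mono) auto
    ultimately show ?thesis by simp
  qed
  have bnd: "AE \<omega> in M. exp (- Y i \<omega>) \<le> 1 - Y i \<omega> / 2" "AE \<omega> in M. \<bar>Y i \<omega>\<bar> \<le> 1" "AE \<omega> in M. exp (- Y i \<omega>) \<le> 1" if "i \<in> I" for i
    using range[OF that] by (eventually_elim, use chord in auto)+
  have int: "integrable M (Y i)" "integrable M (\<lambda>\<omega>. exp (- Y i \<omega>))" if "i \<in> I" for i
    using that bnd[OF that] by (auto intro!: integrable_const_bound[where B = 1])
  have indep': "indep_vars (\<lambda>_. borel) (\<lambda>i \<omega>. exp (- Y i \<omega>)) I"
    by (rule indep_vars_compose2[OF indep]) auto
  have prod_int: "integrable M (\<lambda>\<omega>. \<Prod>i\<in>I. exp (- Y i \<omega>))"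
    using indep_vars_integrable[OF fin indep'] int by auto
  have prod_eq: "exp (- (\<Sum>i\<in>I. Y i \<omega>)) = (\<Prod>i\<in>I. exp (- Y i \<omega>))" for \<omega>
    using fin by (simp add: exp_sum sum_negf[symmetric])
  have "prob {\<omega> \<in> space M. (\<Sum>i\<in>I. Y i \<omega>) \<le> A / 4}
          \<le> prob {\<omega> \<in> space M. exp (- A / 4) \<le> exp (- (\<Sum>i\<in>I. Y i \<omega>))}"
    by (intro finite_measure_mono) auto
  also have "\<dots> \<le> (\<integral>\<omega>. exp (- (\<Sum>i\<in>I. Y i \<omega>)) \<partial>M) / exp (- A / 4)"
    using prod_int by (intro integral_Markov_inequality_measure[where A = "space M"]) (auto simp: prod_eq intro!: prod_nonneg)
  also have "(\<integral>\<omega>. exp (- (\<Sum>i\<in>I. Y i \<omega>)) \<partial>M) = (\<Prod>i\<in>I. \<integral>\<omega>. exp (- Y i \<omega>) \<partial>M)"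
    unfolding prod_eq using indep_vars_lebesgue_integral[OF fin indep'] int by auto
  also have "\<dots> \<le> (\<Prod>i\<in>I. exp (- (expectation (Y i) / 2)))"
  proof (intro prod_mono conjI)
    fix i assume i: "i \<in> I"
    show "0 \<le> (\<integral>\<omega>. exp (- Y i \<omega>) \<partial>M)" by (intro integral_nonneg_AE) auto
    have "(\<integral>\<omega>. exp (- Y i \<omega>) \<partial>M) \<le> (\<integral>\<omega>. 1 - Y i \<omega> / 2 \<partial>M)"
      using i int bnd by (intro integral_mono_AE) auto
    also have "\<dots> = 1 + - (expectation (Y i) / 2)" using int i by (simp add: prob_space)
    also have "\<dots> \<le> exp (- (expectation (Y i) / 2))" by (rule exp_ge_add_one_self)
    finally show "(\<integral>\<omega>. exp (- Y i \<omega>) \<partial>M) \<le> exp (- (expectation (Y i) / 2))" .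
  qed
  also have "\<dots> = exp (- A / 2)"
    using fin by (simp add: A exp_sum[symmetric] sum_negf sum_divide_distrib)
  finally have "prob {\<omega> \<in> space M. (\<Sum>i\<in>I. Y i \<omega>) \<le> A / 4} \<le> exp (- A / 2) / exp (- A / 4)"
    by (simp add: divide_right_mono)
  also have "\<dots> = exp (- A / 4)" by (simp add: exp_diff[symmetric])
  finally show ?thesis .
qed

section \<open>Weights bounded by one\<close>
lemma tail_prob_measurable [measurable (raw)]:
  assumes "\<And>j. p j \<in> borel_measurable N"
  shows "(\<lambda>w. tail_prob (\<lambda>j. p j w) n k) \<in> borel_measurable N"
proof (induction n arbitrary: k)
  case (Suc n)
  note [measurable] = Suc assms
  show ?case
  proof (cases k)
    case (Suc k')
    show ?thesis unfolding Suc tail_prob_Suc_Suc by measurable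
  qed simp
qed simp

locale bounded_weights_tree = weighted_recursive_tree +
  fixes \<theta> :: real
  assumes theta: "\<theta> = 1 + (\<integral>x. x \<partial>\<nu>)"
    and weights_bounded: "AE x in \<nu>. x \<in> {0<..1}"
begin

abbreviation \<mu> :: real where "\<mu> \<equiv> \<theta> - 1"

lemma sets_law [measurable_cong]: "sets \<nu> = sets borel"
  using weights_distr[of 1] by (metis order_refl sets_distr)

lemma space_law [simp]: "space \<nu> = UNIV"
  using sets_eq_imp_space_eq[OF sets_law] by simp

sublocale law: prob_space \<nu>
  using weights_distr[of 1] weight_measurable[of 1] prob_space_distr[of "W 1" borel] by auto

lemma expectation_weight:
  assumes "1 \<le> i" and "g \<in> borel_measurable borel"
  shows "(\<integral>\<omega>. g (W i \<omega>) \<partial>M) = (\<integral>x. g x \<partial>\<nu> :: real)"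
  using integral_distr[of "W i" M borel g] assms by (simp add: weights_distr)

lemma AE_weight:
  assumes "1 \<le> i" and "AE x in \<nu>. P x" and "Measurable.pred borel P"
  shows "AE \<omega> in M. P (W i \<omega>)"
proof -
  have "AE x in distr M borel (W i). P x"
    by (subst weights_distr) (use assms in auto)
  then show ?thesis using assms by (subst (asm) AE_distr_iff) auto
qed

lemma weights_in_unit: "AE \<omega> in M. \<forall>i\<ge>1. W i \<omega> \<in> {0<..1}"
  unfolding AE_all_countable using AE_weight[OF _ weights_bounded] by auto

lemma integrable_law: "integrable \<nu> (\<lambda>x. x)"
  using weights_bounded by (intro law.integrable_const_bound[where B = 1]) auto

lemma theta_range: "1 < \<theta>" "\<theta> \<le> 2"
proof -
  have "(\<integral>x. x \<partial>\<nu>) \<le> (\<integral>x. 1 \<partial>\<nu>)"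
    using weights_bounded integrable_law by (intro integral_mono_AE) auto
  then show "\<theta> \<le> 2" using theta law.prob_space by simp
  have "law.expectation (\<lambda>_. 0) < law.expectation (\<lambda>x. x)"
    using weights_bounded integrable_law law.emeasure_space_1
    by (intro law.integral_less_AE_space) (auto elim!: eventually_mono)
  then show "1 < \<theta>" using theta by simp
qed

text \<open>The relative error \<open>j\<^bsup>-1/4\<^esup>\<close> serves two ends: it exceeds the fluctuations \<open>j\<^bsup>-1/2\<^esup>\<close> of \<open>S\<^sub>j / j\<close> by enough for
  summable failure probabilities, and \<open>\<Sum> j\<^bsup>-1/4\<^esup> / j\<close> converges, so its accumulated effect on the
  solution of the recursion is a constant factor.\<close>
definition lower_total :: "nat \<Rightarrow> real" where
  "lower_total j = \<mu> * j * (1 - real j powr (- 1 / 4))"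

definition upper_total :: "nat \<Rightarrow> real" where
  "upper_total j = \<mu> * j * (1 + real j powr (- 1 / 4))"

definition concentrated :: "nat \<Rightarrow> nat \<Rightarrow> 'a set" where
  "concentrated n\<^sub>0 n = {\<omega> \<in> space M. \<forall>j\<in>{n\<^sub>0..<n}. total_weight j \<omega> \<in> {lower_total j..upper_total j}}"

lemma total_weight_measurable [measurable]: "total_weight n \<in> borel_measurable M"
  unfolding total_weight_def[abs_def] by (intro borel_measurable_sum) auto

lemma concentrated_event [measurable]: "concentrated n\<^sub>0 n \<in> events"
  unfolding concentrated_def by measurable

lemma total_weight_deviation:
  assumes "1 \<le> j"
  shows "prob {\<omega> \<in> space M. total_weight j \<omega> \<notin> {lower_total j..upper_total j}}
           \<le> 2 * exp (- 2 * \<mu>\<^sup>2 * sqrt j)"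
proof -
  interpret H: Hoeffding_ineq_iid M "{1..j}" W "W 1" 0 1 \<mu>
  proof unfold_locales
    show "indep_vars (\<lambda>_. borel) W {1..j}"
      by (rule indep_vars_subset[OF weights_indep]) auto
    show "AE x in M. W 1 x \<in> {0..1}"
      using weights_in_unit by eventually_elim (auto intro: less_imp_le)
    have "expectation (W 1) = \<mu>" using expectation_weight[of 1 "\<lambda>x. x"] theta by simp
    then show "\<mu> \<equiv> expectation (W 1)" by simp
  qed (auto simp: weights_distr)
  define e where "e = \<mu> * j * real j powr (- 1 / 4)"
  have e: "0 \<le> e" using theta_range by (simp add: e_def)
  have "prob {\<omega> \<in> space M. total_weight j \<omega> \<notin> {lower_total j..upper_total j}}
     \<le> prob {\<omega> \<in> space M. \<bar>(\<Sum>i\<in>{1..j}. W i \<omega>) - real (card {1..j}) * \<mu>\<bar> \<ge> e}"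
    by (intro finite_measure_mono)
       (auto simp: total_weight_def lower_total_def upper_total_def e_def algebra_simps)
  also have "\<dots> \<le> 2 * exp (- 2 * e\<^sup>2 / (real (card {1..j}) * (1 - 0)\<^sup>2))"
    by (rule H.Hoeffding_ineq_abs_ge) (use e assms in auto)
  also have "e\<^sup>2 = \<mu>\<^sup>2 * (real j)\<^sup>2 * real j powr (- 1 / 2)"
  proof -
    have "(real j powr (- 1 / 4))\<^sup>2 = real j powr (- 1 / 4) * real j powr (- 1 / 4)"
      by (rule power2_eq_square)
    also have "\<dots> = real j powr (- 1 / 2)" by (simp add: powr_add[symmetric])
    finally show ?thesis by (simp add: e_def power_mult_distrib)
  qed
  also have "real j powr (- 1 / 2) = sqrt j / j"
    using assms by (simp add: powr_minus powr_half_sqrt field_simps)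
  also have "- 2 * (\<mu>\<^sup>2 * (real j)\<^sup>2 * (sqrt j / j)) / (real (card {1..j}) * (1 - 0)\<^sup>2) = - 2 * \<mu>\<^sup>2 * sqrt j"
    using assms by (simp add: power2_eq_square[of "real j"])
  finally show ?thesis .
qed

lemma concentrated_likely:
  assumes "0 < \<epsilon>"
  shows "\<forall>\<^sub>F n\<^sub>0 in sequentially. \<forall>n. prob (space M - concentrated n\<^sub>0 n) \<le> \<epsilon>"
proof -
  have \<mu>: "0 < \<mu>\<^sup>2" using theta_range by simp
  have "summable (\<lambda>j. 2 * exp (- 2 * \<mu>\<^sup>2 * sqrt (real j)))"
  proof (rule summable_comparison_test_bigo)
    show "summable (\<lambda>j. norm (1 / real j ^ 2))"
      using inverse_power_summable[of 2, where 'a = real] by (simp add: field_simps)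
    show "(\<lambda>j. 2 * exp (- 2 * \<mu>\<^sup>2 * sqrt (real j))) \<in> O(\<lambda>j. 1 / real j ^ 2)"
      using \<mu> by real_asymp
  qed
  then obtain N where N: "\<And>m n. m \<ge> N \<Longrightarrow> norm (\<Sum>j=m..<n. 2 * exp (- 2 * \<mu>\<^sup>2 * sqrt (real j))) < \<epsilon>"
    using assms unfolding summable_Cauchy by blast
  show ?thesis
  proof (rule eventually_sequentiallyI[of "max 1 N"], intro allI)
    fix n\<^sub>0 n assume n\<^sub>0: "max 1 N \<le> n\<^sub>0"
    have "space M - concentrated n\<^sub>0 n =
        (\<Union>j\<in>{n\<^sub>0..<n}. {\<omega> \<in> space M. total_weight j \<omega> \<notin> {lower_total j..upper_total j}})"
      by (auto simp: concentrated_def)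
    also have "prob \<dots> \<le> (\<Sum>j=n\<^sub>0..<n. prob {\<omega> \<in> space M. total_weight j \<omega> \<notin> {lower_total j..upper_total j}})"
      by (intro measure_UNION_le) auto
    also have "\<dots> \<le> (\<Sum>j=n\<^sub>0..<n. 2 * exp (- 2 * \<mu>\<^sup>2 * sqrt (real j)))"
      using n\<^sub>0 by (intro sum_mono total_weight_deviation) auto
    also have "\<dots> \<le> \<epsilon>" using N[of n\<^sub>0 n] n\<^sub>0 by simp
    finally show "prob (space M - concentrated n\<^sub>0 n) \<le> \<epsilon>" .
  qed
qed

text \<open>The degree tail of vertex \<open>i\<close> with weight \<open>w\<close> when the total weights are replaced by a deterministic
  sequence \<open>s\<close>. Unlike \<open>degree_tail\<close> it depends on the single weight \<open>w\<close>, so for different vertices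
  these quantities, evaluated at the weights, are independent.\<close>
definition vertex_tail :: "(nat \<Rightarrow> real) \<Rightarrow> nat \<Rightarrow> nat \<Rightarrow> nat \<Rightarrow> nat \<Rightarrow> real \<Rightarrow> real" where
  "vertex_tail s n\<^sub>0 n i k w = tail_prob (\<lambda>j. if n\<^sub>0 \<le> j \<and> i \<le> j then w / s j else 0) n k"

lemma vertex_tail_measurable [measurable]: "vertex_tail s n\<^sub>0 n i k \<in> borel_measurable borel"
  unfolding vertex_tail_def[abs_def] by measurable

lemma vertex_sum_eq: "vertex_sum (\<lambda>j. w / s j) n\<^sub>0 n k = (\<Sum>i=1..n. vertex_tail s n\<^sub>0 n i k w)"
  by (simp add: vertex_sum_def vertex_tail_def)

lemma vertex_tail_range:
  assumes "w \<in> {0..1}" "\<And>j. n\<^sub>0 \<le> j \<Longrightarrow> 1 \<le> s j"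
  shows "vertex_tail s n\<^sub>0 n i k w \<in> {0..1}"
  unfolding vertex_tail_def using assms
  by (intro tail_prob_range) (force simp: divide_le_eq_1 intro: order_trans)

lemma integrable_vertex_tail:
  assumes "\<And>j. n\<^sub>0 \<le> j \<Longrightarrow> 1 \<le> s j"
  shows "integrable \<nu> (vertex_tail s n\<^sub>0 n i k)"
proof (rule law.integrable_const_bound[where B = 1])
  show "AE w in \<nu>. norm (vertex_tail s n\<^sub>0 n i k w) \<le> 1"
    using weights_bounded
  proof eventually_elim
    case (elim w)
    then show ?case using vertex_tail_range[of w n\<^sub>0 s n i k] assms by auto
  qed
qed measurable

lemma sum_expectation_vertex_tail:
  assumes "\<And>j. n\<^sub>0 \<le> j \<Longrightarrow> 1 \<le> s j"
  shows "(\<Sum>i=1..n. \<integral>\<omega>. vertex_tail s n\<^sub>0 n i k (W i \<omega>) \<partial>M) = (\<integral>w. vertex_sum (\<lambda>j. w / s j) n\<^sub>0 n k \<partial>\<nu>)"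
  unfolding vertex_sum_eq using integrable_vertex_tail[OF assms]
  by (subst Bochner_Integration.integral_sum) (auto intro!: sum.cong expectation_weight)

text \<open>On the good event \<open>W i / upper_total j \<le> W i / S\<^sub>j \<le> W i / lower_total j\<close>, and tails are monotone in the
  success probabilities.\<close>
lemma degree_tail_bounds:
  assumes "1 \<le> n\<^sub>0" and lower: "\<And>j. n\<^sub>0 \<le> j \<Longrightarrow> 1 \<le> lower_total j" and "1 \<le> i"
  shows "AE \<omega> in M. \<omega> \<in> concentrated n\<^sub>0 n \<longrightarrow>
           vertex_tail upper_total n\<^sub>0 n i k (W i \<omega>) \<le> degree_tail n\<^sub>0 n i k \<omega> \<and>
           degree_tail n\<^sub>0 n i k \<omega> \<le> vertex_tail lower_total n\<^sub>0 n i k (W i \<omega>)"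
  using weights_in_unit share_eq
proof eventually_elim
  case (elim \<omega>)
  have W: "0 < W i \<omega>" "W i \<omega> \<le> 1" using elim assms by auto
  show ?case
  proof
    assume conc: "\<omega> \<in> concentrated n\<^sub>0 n"
    have "0 \<le> (if n\<^sub>0 \<le> j \<and> i \<le> j then W i \<omega> / upper_total j else 0) \<and>
        (if n\<^sub>0 \<le> j \<and> i \<le> j then W i \<omega> / upper_total j else 0) \<le> (if n\<^sub>0 \<le> j then share i j \<omega> else 0) \<and>
        (if n\<^sub>0 \<le> j then share i j \<omega> else 0) \<le> (if n\<^sub>0 \<le> j \<and> i \<le> j then W i \<omega> / lower_total j else 0) \<and>
        (if n\<^sub>0 \<le> j \<and> i \<le> j then W i \<omega> / lower_total j else 0) \<le> 1" if "j < n" for j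
    proof (cases "n\<^sub>0 \<le> j \<and> i \<le> j")
      case True
      have s: "1 \<le> lower_total j" "lower_total j \<le> total_weight j \<omega>" "total_weight j \<omega> \<le> upper_total j"
        using conc True lower that by (auto simp: concentrated_def)
      have "share i j \<omega> = W i \<omega> / total_weight j \<omega>" using elim True assms by auto
      then show ?thesis using True s W by (auto intro!: divide_left_mono)
    next
      case False
      then show ?thesis by (auto simp: share_def)
    qed
    then show "vertex_tail upper_total n\<^sub>0 n i k (W i \<omega>) \<le> degree_tail n\<^sub>0 n i k \<omega> \<and>
           degree_tail n\<^sub>0 n i k \<omega> \<le> vertex_tail lower_total n\<^sub>0 n i k (W i \<omega>)"
      unfolding vertex_tail_def degree_tail_def using share_range
      by (intro conjI tail_prob_mono) (auto simp: share_range[simplified])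
  qed
qed

text \<open>Union bound over the vertices on the good event. The weights have a common law \<open>\<nu>\<close>, so the sum over
  vertices of expectations becomes the integral of a sum over vertices of equal weight.\<close>
lemma first_moment_bound:
  assumes n: "1 \<le> n\<^sub>0" "n\<^sub>0 \<le> n" and lower: "\<And>j. n\<^sub>0 \<le> j \<Longrightarrow> 1 \<le> lower_total j"
  shows "prob {\<omega> \<in> space M. \<exists>i\<in>{1..n}. k \<le> new_children n\<^sub>0 n i \<omega>}
           \<le> prob (space M - concentrated n\<^sub>0 n) + (\<integral>w. vertex_sum (\<lambda>j. w / lower_total j) n\<^sub>0 n k \<partial>\<nu>)"
proof -
  note [measurable] = new_children_measurable[OF n(1)] degree_tail_measurable[OF n(2)]
  let ?C = "concentrated n\<^sub>0 n"
  define \<Phi> :: "'a \<Rightarrow> real" where "\<Phi> = indicator ?C"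
  have tw: "total_weight j \<in> borel_measurable (history n 1)" if "j \<le> n" for j
    unfolding total_weight_def[abs_def] using that
    by (intro borel_measurable_sum weight_measurable_history) auto
  have "{\<omega> \<in> space (history n 1). total_weight j \<omega> \<in> {lower_total j..upper_total j}} \<in> sets (history n 1)"
    if "j \<in> {n\<^sub>0..<n}" for j
    using measurable_sets[OF tw[of j], of "{lower_total j..upper_total j}"] that
    by (simp add: vimage_def Int_def conj_commute)
  then have "{\<omega> \<in> space (history n 1). \<forall>j\<in>{n\<^sub>0..<n}. total_weight j \<omega> \<in> {lower_total j..upper_total j}} \<in> sets (history n 1)"
    by (intro sets.sets_Collect_finite_All) auto
  then have "?C \<in> sets (history n 1)" by (simp add: concentrated_def)
  then have \<Phi>h: "\<Phi> \<in> borel_measurable (history n 1)" by (simp add: \<Phi>_def)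
  have int\<Phi>: "integrable M \<Phi>" by (simp add: \<Phi>_def emeasure_eq_measure)
  have int: "integrable M (\<lambda>\<omega>. vertex_tail lower_total n\<^sub>0 n i k (W i \<omega>))" if "i \<in> {1..n}" for i
    using integrable_vertex_tail[OF lower, where n = n and i = i and k = k] that
    by (intro integrable_distr[of "W i" M borel]) (auto simp: weights_distr)
  have "{\<omega> \<in> space M. \<exists>i\<in>{1..n}. k \<le> new_children n\<^sub>0 n i \<omega>}
      \<subseteq> (space M - ?C) \<union> (\<Union>i\<in>{1..n}. ?C \<inter> {\<omega> \<in> space M. k \<le> new_children n\<^sub>0 n i \<omega>})" by auto
  then have "prob {\<omega> \<in> space M. \<exists>i\<in>{1..n}. k \<le> new_children n\<^sub>0 n i \<omega>}
     \<le> prob ((space M - ?C) \<union> (\<Union>i\<in>{1..n}. ?C \<inter> {\<omega> \<in> space M. k \<le> new_children n\<^sub>0 n i \<omega>}))"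
    by (intro finite_measure_mono) auto
  also have "\<dots> \<le> prob (space M - ?C) + prob (\<Union>i\<in>{1..n}. ?C \<inter> {\<omega> \<in> space M. k \<le> new_children n\<^sub>0 n i \<omega>})"
    by (intro measure_Un_le) auto
  also have "prob (\<Union>i\<in>{1..n}. ?C \<inter> {\<omega> \<in> space M. k \<le> new_children n\<^sub>0 n i \<omega>})
      \<le> (\<Sum>i=1..n. prob (?C \<inter> {\<omega> \<in> space M. k \<le> new_children n\<^sub>0 n i \<omega>}))"
    by (intro measure_UNION_le) auto
  also have "\<dots> \<le> (\<Sum>i=1..n. \<integral>\<omega>. vertex_tail lower_total n\<^sub>0 n i k (W i \<omega>) \<partial>M)"
  proof (intro sum_mono)
    fix i assume i: "i \<in> {1..n}"
    have "prob (?C \<inter> {\<omega> \<in> space M. k \<le> new_children n\<^sub>0 n i \<omega>})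
        = (\<integral>\<omega>. indicator (?C \<inter> {\<omega> \<in> space M. k \<le> new_children n\<^sub>0 n i \<omega>}) \<omega> \<partial>M)" by simp
    also have "\<dots> = (\<integral>\<omega>. \<Phi> \<omega> * of_bool (k \<le> new_children n\<^sub>0 n i \<omega>) \<partial>M)"
      by (intro Bochner_Integration.integral_cong) (auto simp: \<Phi>_def indicator_def)
    also have "\<dots> = (\<integral>\<omega>. \<Phi> \<omega> * degree_tail n\<^sub>0 n i k \<omega> \<partial>M)"
      by (rule tail_given_weights[where N = n]) (use n int\<Phi> \<Phi>h in auto)
    also have "\<dots> \<le> (\<integral>\<omega>. vertex_tail lower_total n\<^sub>0 n i k (W i \<omega>) \<partial>M)"
    proof (rule integral_mono_AE)
      have "AE \<omega> in M. \<omega> \<in> ?C \<longrightarrow> vertex_tail upper_total n\<^sub>0 n i k (W i \<omega>) \<le> degree_tail n\<^sub>0 n i k \<omega> \<and>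
           degree_tail n\<^sub>0 n i k \<omega> \<le> vertex_tail lower_total n\<^sub>0 n i k (W i \<omega>)"
        using i by (intro degree_tail_bounds n lower) auto
      with weights_in_unit
      show "AE \<omega> in M. \<Phi> \<omega> * degree_tail n\<^sub>0 n i k \<omega> \<le> vertex_tail lower_total n\<^sub>0 n i k (W i \<omega>)"
      proof eventually_elim
        case (elim \<omega>)
        have "0 \<le> vertex_tail lower_total n\<^sub>0 n i k (W i \<omega>)"
          using vertex_tail_range[of "W i \<omega>" n\<^sub>0 lower_total n i k] elim i lower by force
        then show ?case using elim by (auto simp: \<Phi>_def indicator_def)
      qed
      show "integrable M (\<lambda>\<omega>. \<Phi> \<omega> * degree_tail n\<^sub>0 n i k \<omega>)"
        using int\<Phi> degree_tail_range[of n\<^sub>0 n i k] by (intro integrable_times_bounded) auto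
    qed (rule int[OF i])
    finally show "prob (?C \<inter> {\<omega> \<in> space M. k \<le> new_children n\<^sub>0 n i \<omega>})
       \<le> (\<integral>\<omega>. vertex_tail lower_total n\<^sub>0 n i k (W i \<omega>) \<partial>M)" .
  qed
  also have "\<dots> = (\<integral>w. vertex_sum (\<lambda>j. w / lower_total j) n\<^sub>0 n k \<partial>\<nu>)"
    by (rule sum_expectation_vertex_tail[OF lower])
  finally show ?thesis by simp
qed

text \<open>If no vertex is large, then the total weight deviates, or the sum \<open>H\<close> of the independent variables
  \<open>vertex_tail\<close> is at most a quarter of its mean \<open>A\<close>, or no vertex is large although the conditional
  mean, which is at least \<open>H\<close>, exceeds \<open>A / 4\<close>. The last two events have probability at most \<open>4 / A\<close> each.\<close>
lemma second_moment_bound: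
  assumes n: "1 \<le> n\<^sub>0" "n\<^sub>0 \<le> n" and lower: "\<And>j. n\<^sub>0 \<le> j \<Longrightarrow> 1 \<le> lower_total j"
    and A: "A = (\<integral>w. vertex_sum (\<lambda>j. w / upper_total j) n\<^sub>0 n k \<partial>\<nu>)" "0 < A"
  shows "prob {\<omega> \<in> space M. \<forall>i\<in>{1..n}. new_children n\<^sub>0 n i \<omega> < k}
           \<le> prob (space M - concentrated n\<^sub>0 n) + 8 / A"
proof -
  note [measurable] = new_children_measurable[OF n(1)] degree_tail_measurable[OF n(2)]
  let ?C = "concentrated n\<^sub>0 n" and ?H = "\<lambda>\<omega>. \<Sum>i=1..n. vertex_tail upper_total n\<^sub>0 n i k (W i \<omega>)"
  let ?E = "{\<omega> \<in> space M. \<forall>i\<in>{1..n}. new_children n\<^sub>0 n i \<omega> < k}"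
  let ?L = "{\<omega> \<in> space M. ?H \<omega> \<le> A / 4}"
  let ?S = "{\<omega> \<in> space M. (\<forall>i\<in>{1..n}. new_children n\<^sub>0 n i \<omega> < k) \<and> A / 4 \<le> (\<Sum>i=1..n. degree_tail n\<^sub>0 n i k \<omega>)}"
  have upper: "1 \<le> upper_total j" if "n\<^sub>0 \<le> j" for j
  proof -
    have "lower_total j \<le> upper_total j"
      unfolding lower_total_def upper_total_def using theta_range by (intro mult_left_mono) auto
    then show ?thesis using lower[OF that] by simp
  qed
  have meas [measurable]: "(\<lambda>\<omega>. vertex_tail upper_total n\<^sub>0 n i k (W i \<omega>)) \<in> borel_measurable M" if "i \<in> {1..n}" for i
    using that by (intro measurable_compose[OF _ vertex_tail_measurable]) auto
  have "AE \<omega> in M. \<forall>i\<in>{1..n}. \<omega> \<in> ?C \<longrightarrow> vertex_tail upper_total n\<^sub>0 n i k (W i \<omega>) \<le> degree_tail n\<^sub>0 n i k \<omega> \<and>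
           degree_tail n\<^sub>0 n i k \<omega> \<le> vertex_tail lower_total n\<^sub>0 n i k (W i \<omega>)"
    by (intro AE_finite_allI degree_tail_bounds n lower) auto
  then have "AE \<omega> in M. \<omega> \<in> ?E \<longrightarrow> \<omega> \<in> (space M - ?C) \<union> ?L \<union> ?S"
  proof eventually_elim
    case (elim \<omega>)
    show ?case
    proof
      assume E: "\<omega> \<in> ?E"
      show "\<omega> \<in> (space M - ?C) \<union> ?L \<union> ?S"
      proof (cases "\<omega> \<in> ?C \<and> A / 4 < ?H \<omega>")
        case True
        then have "?H \<omega> \<le> (\<Sum>i=1..n. degree_tail n\<^sub>0 n i k \<omega>)"
          using elim by (intro sum_mono) auto
        then have "\<omega> \<in> ?S" using True E by simp
        then show ?thesis by blast
      next
        case False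
        then have "\<omega> \<in> (space M - ?C) \<or> \<omega> \<in> ?L" using E by (simp add: not_less)
        then show ?thesis by blast
      qed
    qed
  qed
  then have "prob ?E \<le> prob ((space M - ?C) \<union> ?L \<union> ?S)"
    by (intro finite_measure_mono_AE) auto
  also have "\<dots> \<le> prob ((space M - ?C) \<union> ?L) + prob ?S"
    by (intro measure_Un_le) auto
  also have "prob ((space M - ?C) \<union> ?L) \<le> prob (space M - ?C) + prob ?L"
    by (intro measure_Un_le) auto
  also have "prob ?S \<le> 1 / (A / 4)"
    by (rule no_large_vertex_given_weights) (use n A in auto)
  also have "prob ?L \<le> exp (- A / 4)"
  proof (rule indep_sum_lower_tail)
    show "indep_vars (\<lambda>_. borel) (\<lambda>i \<omega>. vertex_tail upper_total n\<^sub>0 n i k (W i \<omega>)) {1..n}"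
      by (rule indep_vars_compose2[OF indep_vars_subset[OF weights_indep]]) auto
    show "AE \<omega> in M. vertex_tail upper_total n\<^sub>0 n i k (W i \<omega>) \<in> {0..1}" if "i \<in> {1..n}" for i
      using weights_in_unit
    proof eventually_elim
      case (elim \<omega>)
      then have "W i \<omega> \<in> {0..1}" using that by (auto intro: less_imp_le)
      then show ?case using upper by (intro vertex_tail_range) auto
    qed
    show "A = (\<Sum>i=1..n. \<integral>\<omega>. vertex_tail upper_total n\<^sub>0 n i k (W i \<omega>) \<partial>M)"
      unfolding A by (rule sum_expectation_vertex_tail[OF upper, symmetric])
  qed auto
  also have "exp (- A / 4) \<le> 4 / A"
  proof -
    have "A / 4 \<le> exp (A / 4)" using exp_ge_add_one_self[of "A / 4"] by linarith
    then have "1 / exp (A / 4) \<le> 1 / (A / 4)" using A by (intro divide_left_mono) auto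
    then show ?thesis by (simp add: exp_minus inverse_eq_divide)
  qed
  finally show ?thesis by simp
qed

end

section \<open>Tail bounds for the maximal degree\<close>

text \<open>The growth factors of the two comparison solutions differ from \<open>1 + 1 / j\<close>, whose product is
  \<open>n / n\<^sub>0\<close>, by a factor of at most \<open>1 + 2 \<delta>\<^sub>j / j\<close>.\<close>
lemma growth_product_bounds:
  fixes \<delta> :: "nat \<Rightarrow> real"
  assumes n\<^sub>0: "1 \<le> n\<^sub>0" and \<delta>: "\<And>j. n\<^sub>0 \<le> j \<Longrightarrow> 0 \<le> \<delta> j \<and> \<delta> j \<le> 1 / 2" and n: "n\<^sub>0 \<le> n"
  shows "real n\<^sub>0 * (\<Prod>j=n\<^sub>0..<n. 1 + 1 / (j * (1 - \<delta> j))) \<le> n * (\<Prod>j=n\<^sub>0..<n. 1 + 2 * \<delta> j / j)"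
    and "real n \<le> real n\<^sub>0 * (\<Prod>j=n\<^sub>0..<n. 1 + 1 / (j * (1 + \<delta> j))) * (\<Prod>j=n\<^sub>0..<n. 1 + 2 * \<delta> j / j)"
proof -
  have key: "1 + 1 / (x * (1 - d)) \<le> (1 + 1 / x) * (1 + 2 * d / x)"
    "1 + 1 / x \<le> (1 + 1 / (x * (1 + d))) * (1 + 2 * d / x)" if "1 \<le> x" "0 \<le> d" "d \<le> 1 / 2" for x d :: real
  proof -
    have "1 / (1 - d) \<le> 1 + 2 * d"
      using that mult_left_mono[of "2 * d" 1 d] by (simp add: field_simps)
    then have "1 / (x * (1 - d)) \<le> (1 + 2 * d) / x"
      using that divide_right_mono[of "1 / (1 - d)" "1 + 2 * d" x] by (simp add: mult.commute)
    also have "\<dots> \<le> 1 / x + 2 * d / x + 1 / x * (2 * d / x)"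
      using that by (simp add: add_divide_distrib)
    also have "1 + \<dots> = (1 + 1 / x) * (1 + 2 * d / x)" by (simp add: divide_inverse algebra_simps)
    finally show "1 + 1 / (x * (1 - d)) \<le> (1 + 1 / x) * (1 + 2 * d / x)" by simp
    have "1 - d \<le> 1 / (1 + d)" using that by (simp add: field_simps)
    then have "(1 - d) / x \<le> 1 / (x * (1 + d))"
      using that divide_right_mono[of "1 - d" "1 / (1 + d)" x] by (simp add: mult.commute)
    moreover have "0 \<le> 1 / (x * (1 + d)) * (2 * d / x)" using that by simp
    moreover have "1 / x \<le> (1 - d) / x + 2 * d / x"
      using that by (simp add: field_simps)
    ultimately show "1 + 1 / x \<le> (1 + 1 / (x * (1 + d))) * (1 + 2 * d / x)"
      by (simp add: algebra_simps)
  qed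
  let ?P = "\<lambda>n. \<Prod>j=n\<^sub>0..<n. 1 + 2 * \<delta> j / j"
  have P0: "0 \<le> ?P n" for n using \<delta> by (intro prod_nonneg) auto
  show "real n\<^sub>0 * (\<Prod>j=n\<^sub>0..<n. 1 + 1 / (j * (1 - \<delta> j))) \<le> n * ?P n"
    using n
  proof (induction n rule: dec_induct)
    case (step n)
    have n1: "1 \<le> real n" using step.hyps n\<^sub>0 by simp
    have k: "1 + 1 / (n * (1 - \<delta> n)) \<le> (1 + 1 / n) * (1 + 2 * \<delta> n / n)"
      using key(1)[of n "\<delta> n"] n1 \<delta>[of n] step.hyps by auto
    have "real n\<^sub>0 * (\<Prod>j=n\<^sub>0..<Suc n. 1 + 1 / (j * (1 - \<delta> j)))
        = real n\<^sub>0 * (\<Prod>j=n\<^sub>0..<n. 1 + 1 / (j * (1 - \<delta> j))) * (1 + 1 / (n * (1 - \<delta> n)))"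
      using step.hyps by simp
    also have "\<dots> \<le> (n * ?P n) * ((1 + 1 / n) * (1 + 2 * \<delta> n / n))"
      by (rule mult_mono[OF step.IH k]) (use P0[of n] \<delta>[of n] step.hyps n1 in auto)
    also have "\<dots> = (n * (1 + 1 / n)) * (?P n * (1 + 2 * \<delta> n / n))" by (simp only: ac_simps)
    also have "n * (1 + 1 / n) = Suc n" using n1 by (simp add: field_simps)
    finally show ?case using step.hyps by simp
  qed simp
  show "real n \<le> real n\<^sub>0 * (\<Prod>j=n\<^sub>0..<n. 1 + 1 / (j * (1 + \<delta> j))) * ?P n"
    using n
  proof (induction n rule: dec_induct)
    case (step n)
    have n1: "1 \<le> real n" using step.hyps n\<^sub>0 by simp
    have k: "1 + 1 / n \<le> (1 + 1 / (n * (1 + \<delta> n))) * (1 + 2 * \<delta> n / n)"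
      using key(2)[of n "\<delta> n"] n1 \<delta>[of n] step.hyps by auto
    have "real (Suc n) = n * (1 + 1 / n)" using n1 by (simp add: field_simps)
    also have "\<dots> \<le> (real n\<^sub>0 * (\<Prod>j=n\<^sub>0..<n. 1 + 1 / (j * (1 + \<delta> j))) * ?P n)
                      * ((1 + 1 / (n * (1 + \<delta> n))) * (1 + 2 * \<delta> n / n))"
      by (rule mult_mono[OF step.IH k])
         (use P0[of n] \<delta> step.hyps n1 in \<open>auto intro!: mult_nonneg_nonneg prod_nonneg\<close>)
    also have "\<dots> = real n\<^sub>0 * ((\<Prod>j=n\<^sub>0..<n. 1 + 1 / (j * (1 + \<delta> j))) * (1 + 1 / (n * (1 + \<delta> n)))) * (?P n * (1 + 2 * \<delta> n / n))"
      by (simp only: ac_simps)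
    finally show ?case using step.hyps by simp
  qed simp
qed

lemma summable_corrections: "summable (\<lambda>j. 2 * real j powr (- 1 / 4) / j)"
proof (rule summable_comparison_test_bigo)
  show "summable (\<lambda>j. norm (real j powr (- 5 / 4)))"
    by (simp add: summable_real_powr_iff)
  show "(\<lambda>j. 2 * real j powr (- 1 / 4) / j) \<in> O(\<lambda>j. real j powr (- 5 / 4))"
    by real_asymp
qed

lemma corrections_bounded:
  obtains C where "1 \<le> C" "\<And>m n. (\<Prod>j=m..<n. 1 + 2 * real j powr (- 1 / 4) / j) \<le> C"
proof
  define x where "x j = 2 * real j powr (- 1 / 4) / j" for j :: nat
  have x0: "0 \<le> x j" for j by (simp add: x_def)
  have sx: "summable x" using summable_corrections by (simp add: x_def[abs_def])
  show "1 \<le> exp (\<Sum>j. x j)" using suminf_nonneg[OF sx x0] by simp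
  fix m n
  have "(\<Prod>j=m..<n. 1 + x j) \<le> (\<Prod>j=m..<n. exp (x j))"
    using x0 by (intro prod_mono) auto
  also have "\<dots> = exp (\<Sum>j=m..<n. x j)" by (simp add: exp_sum)
  also have "\<dots> \<le> exp (\<Sum>j. x j)" using sum_le_suminf[OF sx, of "{m..<n}"] x0 by simp
  finally show "(\<Prod>j=m..<n. 1 + 2 * real j powr (- 1 / 4) / j) \<le> exp (\<Sum>j. x j)"
    by (simp add: x_def)
qed

text \<open>Since \<open>1 + s / j \<le> (j / (j - 1))\<^bsup>s\<^esup>\<close>, the product telescopes.\<close>
lemma power_growth_bound:
  fixes n\<^sub>0 n :: nat and s :: real
  assumes "2 \<le> n\<^sub>0" "n\<^sub>0 \<le> n" "0 \<le> s" and x: "\<And>j. n\<^sub>0 \<le> j \<Longrightarrow> 0 \<le> x j \<and> x j \<le> s / j"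
  shows "real n\<^sub>0 * (\<Prod>j=n\<^sub>0..<n. 1 + x j) \<le> n\<^sub>0 * n powr s"
proof -
  have "real n\<^sub>0 * (\<Prod>j=n\<^sub>0..<n. 1 + x j) \<le> n\<^sub>0 * (real n - 1) powr s"
    using \<open>n\<^sub>0 \<le> n\<close>
  proof (induction n rule: dec_induct)
    case base
    then show ?case using assms by (simp add: ge_one_powr_ge_zero)
  next
    case (step n)
    have n: "2 \<le> real n" using step assms by simp
    have xn: "0 \<le> x n" "x n \<le> s / n" using x[of n] step.hyps by auto
    have "ln (1 - 1 / real n) \<le> - (1 / n)"
      using ln_add_one_self_le_self2[of "- (1 / real n)"] n by simp
    then have "1 / n \<le> ln (real n / (real n - 1))"
      using n by (simp add: ln_div diff_divide_distrib) (simp add: field_simps ln_div)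
    then have "1 + s * (1 / n) \<le> 1 + s * ln (real n / (real n - 1))"
      using assms by (intro add_left_mono mult_left_mono) auto
    also have "\<dots> \<le> exp (s * ln (real n / (real n - 1)))" by (rule exp_ge_add_one_self)
    also have "\<dots> = (real n / (real n - 1)) powr s" using n by (simp add: powr_def)
    finally have step_le: "1 + x n \<le> (real n / (real n - 1)) powr s" using xn by simp
    have "real n\<^sub>0 * (\<Prod>j=n\<^sub>0..<Suc n. 1 + x j) = real n\<^sub>0 * (\<Prod>j=n\<^sub>0..<n. 1 + x j) * (1 + x n)"
      using step.hyps by simp
    also have "\<dots> \<le> n\<^sub>0 * (real n - 1) powr s * (real n / (real n - 1)) powr s"
      by (rule mult_mono[OF step.IH step_le]) (use xn in auto)
    also have "\<dots> = n\<^sub>0 * (real (Suc n) - 1) powr s" using n by (simp add: powr_divide)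
    finally show ?case .
  qed
  also have "\<dots> \<le> n\<^sub>0 * real n powr s" using assms by (intro mult_left_mono powr_mono2) auto
  finally show ?thesis .
qed

context bounded_weights_tree
begin

text \<open>The base \<open>q(w)\<close> of the solution \<open>n q(w)\<^sup>k\<close>: degrees of vertices of weight \<open>w\<close> are asymptotically
  geometric with this ratio.\<close>
definition geometric_ratio :: "real \<Rightarrow> real" where
  "geometric_ratio w = w / (\<mu> + w)"

lemma geometric_ratio_mono:
  assumes "0 \<le> w" "w \<le> w'"
  shows "geometric_ratio w \<le> geometric_ratio w'"
proof -
  have "w * \<mu> \<le> w' * \<mu>" using assms theta_range by (intro mult_right_mono) auto
  then show ?thesis using assms theta_range by (simp add: geometric_ratio_def frac_le_eq field_simps divide_simps)
qed

lemma geometric_ratio_range: "0 \<le> w \<Longrightarrow> geometric_ratio w \<in> {0..1}"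
  using theta_range by (simp add: geometric_ratio_def)

lemma geometric_ratio_measurable [measurable]: "geometric_ratio \<in> borel_measurable borel"
  unfolding geometric_ratio_def[abs_def] by measurable

lemma integrable_ratio_power: "integrable \<nu> (\<lambda>w. geometric_ratio w ^ k)"
proof (rule law.integrable_const_bound[where B = 1])
  show "AE w in \<nu>. norm (geometric_ratio w ^ k) \<le> 1"
    using weights_bounded
  proof eventually_elim
    case (elim w)
    then show ?case using geometric_ratio_range[of w] by (auto intro!: power_le_one)
  qed
qed measurable

lemma in_degree_eq:
  assumes "1 \<le> n"
  shows "wrt_indegree parent n i \<omega> = new_children 1 n i \<omega>"
proof -
  have "in_arcs (with_proj (wrt_tree parent n \<omega>)) i = (\<lambda>j. (j + 1, parent (j + 1) \<omega>)) ` {j \<in> {1..<n}. parent (j + 1) \<omega> = i}"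
  proof -
    have eq: "{2..n} = Suc ` {1..<n}" using assms by (auto simp: image_Suc_atLeastLessThan)
    have "in_arcs (with_proj (wrt_tree parent n \<omega>)) i = {e \<in> (\<lambda>k. (k, parent k \<omega>)) ` (Suc ` {1..<n}). snd e = i}"
      unfolding in_arcs_def wrt_tree_def eq by simp
    also have "\<dots> = (\<lambda>j. (j + 1, parent (j + 1) \<omega>)) ` {j \<in> {1..<n}. parent (j + 1) \<omega> = i}"
      unfolding image_image by auto
    finally show ?thesis .
  qed
  then have "in_degree (with_proj (wrt_tree parent n \<omega>)) i = new_children 1 n i \<omega>"
    unfolding in_degree_def new_children_def by (simp add: card_image inj_on_def)
  then show ?thesis by (simp add: wrt_indegree_def)
qed

text \<open>Ignoring the attachments before the fixed time \<open>n\<^sub>0\<close> changes in-degrees by at most \<open>n\<^sub>0\<close>.\<close>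
lemma new_children_restart:
  assumes "1 \<le> n\<^sub>0"
  shows "new_children n\<^sub>0 n i \<omega> \<le> new_children 1 n i \<omega>"
    and "new_children 1 n i \<omega> \<le> n\<^sub>0 + new_children n\<^sub>0 n i \<omega>"
proof -
  show "new_children n\<^sub>0 n i \<omega> \<le> new_children 1 n i \<omega>"
    unfolding new_children_def using assms by (intro card_mono) auto
  have "new_children 1 n i \<omega> \<le> card ({1..<n\<^sub>0} \<union> {j \<in> {n\<^sub>0..<n}. parent (j + 1) \<omega> = i})"
    unfolding new_children_def by (intro card_mono) auto
  also have "\<dots> \<le> card {1..<n\<^sub>0} + card {j \<in> {n\<^sub>0..<n}. parent (j + 1) \<omega> = i}"
    by (rule card_Un_le)
  finally show "new_children 1 n i \<omega> \<le> n\<^sub>0 + new_children n\<^sub>0 n i \<omega>"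
    by (simp add: new_children_def)
qed

lemma restart_time:
  assumes "0 < \<epsilon>"
  obtains n\<^sub>0 where "2 \<le> n\<^sub>0" "\<And>j. n\<^sub>0 \<le> j \<Longrightarrow> 1 \<le> lower_total j"
    "\<And>j. n\<^sub>0 \<le> j \<Longrightarrow> real j powr (- 1 / 4) \<le> 1 / 2"
    "\<And>n. prob (space M - concentrated n\<^sub>0 n) \<le> \<epsilon>"
proof -
  have \<mu>: "0 < \<mu>" using theta_range by simp
  have "\<forall>\<^sub>F j in sequentially. 1 \<le> lower_total j"
    unfolding lower_total_def using \<mu> by real_asymp
  moreover have "\<forall>\<^sub>F j in sequentially. real j powr (- 1 / 4) \<le> 1 / 2"
    by real_asymp
  ultimately have "\<forall>\<^sub>F n\<^sub>0 in sequentially. \<forall>j\<ge>n\<^sub>0. 1 \<le> lower_total j \<and> real j powr (- 1 / 4) \<le> 1 / 2"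
    by (intro eventually_all_ge_at_top eventually_conj)
  with concentrated_likely[OF assms] eventually_ge_at_top[of 2]
  have "\<forall>\<^sub>F n\<^sub>0 in sequentially. 2 \<le> n\<^sub>0 \<and> (\<forall>n. prob (space M - concentrated n\<^sub>0 n) \<le> \<epsilon>) \<and>
     (\<forall>j\<ge>n\<^sub>0. 1 \<le> lower_total j \<and> real j powr (- 1 / 4) \<le> 1 / 2)"
    by eventually_elim auto
  then show thesis using that by (auto simp: eventually_sequentially)
qed

lemma upper_tail_bound:
  assumes "0 < \<epsilon>"
  obtains n\<^sub>0 C where "0 < C"
    "\<And>n k. n\<^sub>0 \<le> n \<Longrightarrow> prob {\<omega> \<in> space M. \<exists>i\<in>{1..n}. k + n\<^sub>0 \<le> new_children 1 n i \<omega>}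
        \<le> \<epsilon> + C * n * (\<integral>w. geometric_ratio w ^ k \<partial>\<nu>)"
proof -
  obtain n\<^sub>0 where n\<^sub>0: "2 \<le> n\<^sub>0" "\<And>j. n\<^sub>0 \<le> j \<Longrightarrow> 1 \<le> lower_total j"
    "\<And>j. n\<^sub>0 \<le> j \<Longrightarrow> real j powr (- 1 / 4) \<le> 1 / 2"
    "\<And>n. prob (space M - concentrated n\<^sub>0 n) \<le> \<epsilon>"
    using restart_time[OF assms] by blast
  obtain C where C: "1 \<le> C" "\<And>m n. (\<Prod>j=m..<n. 1 + 2 * real j powr (- 1 / 4) / j) \<le> C"
    using corrections_bounded by blast
  have \<mu>: "0 < \<mu>" using theta_range by simp
  define \<phi> where "\<phi> n = n\<^sub>0 * (\<Prod>j=n\<^sub>0..<n. 1 + \<mu> / lower_total j)" for n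
  have "prob {\<omega> \<in> space M. \<exists>i\<in>{1..n}. k + n\<^sub>0 \<le> new_children 1 n i \<omega>} \<le> \<epsilon> + C * n * (\<integral>w. geometric_ratio w ^ k \<partial>\<nu>)"
    if n: "n\<^sub>0 \<le> n" for n k
  proof -
    have n1: "1 \<le> n\<^sub>0" using n\<^sub>0 by simp
    have int: "integrable \<nu> (\<lambda>w. geometric_ratio w ^ k)" by (rule integrable_ratio_power)
    have "\<phi> n = n\<^sub>0 * (\<Prod>j=n\<^sub>0..<n. 1 + 1 / (j * (1 - real j powr (- 1 / 4))))"
      using \<mu> by (simp add: \<phi>_def lower_total_def)
    also have "\<dots> \<le> n * (\<Prod>j=n\<^sub>0..<n. 1 + 2 * real j powr (- 1 / 4) / j)"
      by (rule growth_product_bounds) (use n n\<^sub>0 in auto)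
    also have "\<dots> \<le> n * C" by (intro mult_left_mono C) auto
    finally have \<phi>: "\<phi> n \<le> C * n" by (simp add: mult.commute)
    have le: "AE w in \<nu>. vertex_sum (\<lambda>j. w / lower_total j) n\<^sub>0 n k \<le> C * n * geometric_ratio w ^ k"
      using weights_bounded
    proof eventually_elim
      case (elim w)
      have "vertex_sum (\<lambda>j. w / lower_total j) n\<^sub>0 n k \<le> \<phi> n * (w / (\<mu> + w)) ^ k"
      proof (rule vertex_sum_le)
        fix j assume j: "n\<^sub>0 \<le> j"
        have "\<mu> * j * (1 - real j powr (- 1 / 4)) \<le> \<mu> * j * 1"
          using \<mu> by (intro mult_left_mono) auto
        then show "w \<le> lower_total j \<and> 0 < lower_total j \<and> lower_total j \<le> \<mu> * j"
          using n\<^sub>0(2)[OF j] elim by (auto simp: lower_total_def)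
      qed (use \<mu> elim n in \<open>auto simp: \<phi>_def\<close>)
      also have "\<dots> \<le> C * n * geometric_ratio w ^ k"
        unfolding geometric_ratio_def using \<phi> elim \<mu> by (intro mult_right_mono) auto
      finally show ?case .
    qed
    have "{\<omega> \<in> space M. \<exists>i\<in>{1..n}. k + n\<^sub>0 \<le> new_children 1 n i \<omega>}
        \<subseteq> {\<omega> \<in> space M. \<exists>i\<in>{1..n}. k \<le> new_children n\<^sub>0 n i \<omega>}"
    proof safe
      fix \<omega> i assume "i \<in> {1..n}" "k + n\<^sub>0 \<le> new_children 1 n i \<omega>"
      then show "\<exists>i\<in>{1..n}. k \<le> new_children n\<^sub>0 n i \<omega>"
        using new_children_restart(2)[OF n1, of n i \<omega>] by (intro bexI[of _ i]) linarith+
    qed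
    moreover note [measurable] = new_children_measurable[OF n1]
    ultimately have "prob {\<omega> \<in> space M. \<exists>i\<in>{1..n}. k + n\<^sub>0 \<le> new_children 1 n i \<omega>}
        \<le> prob {\<omega> \<in> space M. \<exists>i\<in>{1..n}. k \<le> new_children n\<^sub>0 n i \<omega>}"
      by (intro finite_measure_mono) auto
    also have "\<dots> \<le> prob (space M - concentrated n\<^sub>0 n) + (\<integral>w. vertex_sum (\<lambda>j. w / lower_total j) n\<^sub>0 n k \<partial>\<nu>)"
      by (rule first_moment_bound) (use n n1 n\<^sub>0 in auto)
    also have "(\<integral>w. vertex_sum (\<lambda>j. w / lower_total j) n\<^sub>0 n k \<partial>\<nu>) \<le> (\<integral>w. C * n * geometric_ratio w ^ k \<partial>\<nu>)"
    proof (rule integral_mono_AE)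
      show "integrable \<nu> (\<lambda>w. vertex_sum (\<lambda>j. w / lower_total j) n\<^sub>0 n k)"
        unfolding vertex_sum_eq by (intro Bochner_Integration.integrable_sum integrable_vertex_tail n\<^sub>0)
    qed (use le int in auto)
    finally show ?thesis using n\<^sub>0(4)[of n] int by simp
  qed
  with C(1) show thesis by (intro that[of C n\<^sub>0]) auto
qed

text \<open>The base \<open>r = \<theta>\<^bsup>-1/2\<^esup>\<close> of the subtracted solution lies above every \<open>q(w)\<close>, \<open>w \<le> 1\<close>, and makes it grow
  like \<open>n\<^sup>s\<close> with \<open>s = 1 / (sqrt \<theta> + 1) < 1 / 2\<close>. At \<open>k \<approx> log\<^sub>\<theta> n\<close> the subtracted term is then
  \<open>n\<^bsup>s - 1/2\<^esup>\<close>, whereas \<open>n q(w)\<^sup>k\<close> is \<open>n\<^bsup>o(1)\<^esup>\<close> for \<open>w\<close> near one. By monotonicity in the weight all vertices of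
  weight above \<open>1 - v\<close> may be treated as having weight \<open>1 - v\<close>.\<close>
lemma lower_tail_bound:
  assumes "0 < \<epsilon>"
  obtains n\<^sub>0 C where "0 < C"
    "\<And>n k v A. n\<^sub>0 \<le> n \<Longrightarrow> v \<in> {0<..<1} \<Longrightarrow>
        A = measure \<nu> {1 - v<..} * (n / C * geometric_ratio (1 - v) ^ k - C * n powr (1 / (sqrt \<theta> + 1)) * (1 / sqrt \<theta>) ^ k) \<Longrightarrow>
        0 < A \<Longrightarrow> prob {\<omega> \<in> space M. \<forall>i\<in>{1..n}. new_children 1 n i \<omega> < k} \<le> \<epsilon> + 8 / A"
proof -
  obtain n\<^sub>0 where n\<^sub>0: "2 \<le> n\<^sub>0" "\<And>j. n\<^sub>0 \<le> j \<Longrightarrow> 1 \<le> lower_total j"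
    "\<And>j. n\<^sub>0 \<le> j \<Longrightarrow> real j powr (- 1 / 4) \<le> 1 / 2"
    "\<And>n. prob (space M - concentrated n\<^sub>0 n) \<le> \<epsilon>"
    using restart_time[OF assms] by blast
  obtain C where C: "1 \<le> C" "\<And>m n. (\<Prod>j=m..<n. 1 + 2 * real j powr (- 1 / 4) / j) \<le> C"
    using corrections_bounded by blast
  define r where "r = 1 / sqrt \<theta>"
  define s where "s = 1 / (sqrt \<theta> + 1)"
  have \<mu>: "0 < \<mu>" using theta_range by simp
  have sq: "1 < sqrt \<theta>" "sqrt \<theta> * sqrt \<theta> = \<theta>" using theta_range by auto
  have s: "1 / r - 1 = \<mu> * s" "0 \<le> s"
  proof -
    have "(sqrt \<theta> - 1) * (sqrt \<theta> + 1) = \<mu>" using sq by (simp add: algebra_simps)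
    then show "1 / r - 1 = \<mu> * s" 
      using sq(1) theta_range by (simp add: r_def s_def eq_divide_eq add_pos_pos[THEN less_imp_neq, THEN not_sym])
  qed (use sq in \<open>simp add: s_def\<close>)
  have upper: "1 \<le> upper_total j" "\<mu> * j \<le> upper_total j" if "n\<^sub>0 \<le> j" for j
  proof -
    have "lower_total j \<le> upper_total j" "\<mu> * j * 1 \<le> upper_total j"
      unfolding lower_total_def upper_total_def using \<mu> by (intro mult_left_mono; simp)+
    then show "1 \<le> upper_total j" "\<mu> * j \<le> upper_total j" using n\<^sub>0(2)[OF that] by auto
  qed
  have main: "prob {\<omega> \<in> space M. \<forall>i\<in>{1..n}. new_children 1 n i \<omega> < k} \<le> \<epsilon> + 8 / A"
    if n: "n\<^sub>0 \<le> n" and v: "v \<in> {0<..<1}" and A0: "0 < A" and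
      A: "A = measure \<nu> {1 - v<..} * (n / (C * n\<^sub>0) * geometric_ratio (1 - v) ^ k - (C * n\<^sub>0) * n powr s * r ^ k)" for n k v A
  proof -
    have n1: "1 \<le> n\<^sub>0" using n\<^sub>0 by simp
    define w\<^sub>0 where "w\<^sub>0 = 1 - v"
    have w\<^sub>0: "0 < w\<^sub>0" "w\<^sub>0 < 1" using v by (auto simp: w\<^sub>0_def)
    define \<phi> where "\<phi> n = n\<^sub>0 * (\<Prod>j=n\<^sub>0..<n. 1 + \<mu> / upper_total j)" for n
    define \<psi> where "\<psi> n = n\<^sub>0 * (\<Prod>j=n\<^sub>0..<n. 1 + w\<^sub>0 / upper_total j * (1 / r - 1))" for n
    define N where "N w = vertex_sum (\<lambda>j. w / upper_total j) n\<^sub>0 n k" for w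
    have \<psi>: "\<psi> n \<le> n\<^sub>0 * n powr s"
      unfolding \<psi>_def
    proof (rule power_growth_bound)
      fix j assume j: "n\<^sub>0 \<le> j"
      have "w\<^sub>0 / upper_total j \<le> 1 / (\<mu> * j)"
        using upper[OF j] w\<^sub>0 \<mu> n\<^sub>0(1) j by (intro frac_le) auto
      then have "w\<^sub>0 / upper_total j * (\<mu> * s) \<le> 1 / (\<mu> * j) * (\<mu> * s)"
        using s \<mu> by (intro mult_right_mono) auto
      then show "0 \<le> w\<^sub>0 / upper_total j * (1 / r - 1) \<and> w\<^sub>0 / upper_total j * (1 / r - 1) \<le> s / j"
        using upper[OF j] w\<^sub>0 \<mu> s by simp
    qed (use n n\<^sub>0 s in auto)
    have \<phi>: "n / C \<le> \<phi> n"
    proof -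
      have "real n \<le> \<phi> n * (\<Prod>j=n\<^sub>0..<n. 1 + 2 * real j powr (- 1 / 4) / j)"
        using growth_product_bounds(2)[of n\<^sub>0 "\<lambda>j. real j powr (- 1 / 4)" n] n n1 n\<^sub>0(3) \<mu>
        by (simp add: \<phi>_def upper_total_def)
      also have "\<dots> \<le> \<phi> n * C"
        using C \<mu> upper by (intro mult_left_mono) (force simp: \<phi>_def intro!: mult_nonneg_nonneg prod_nonneg)+
      finally show ?thesis using C by (simp add: field_simps)
    qed
    have "\<phi> n * (w\<^sub>0 / (\<mu> + w\<^sub>0)) ^ k - \<psi> n * r ^ k \<le> N w\<^sub>0"
      unfolding N_def
    proof (rule vertex_sum_ge)
      have "geometric_ratio w\<^sub>0 \<le> geometric_ratio 1" using w\<^sub>0 by (intro geometric_ratio_mono) auto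
      also have "sqrt \<theta> * 1 \<le> sqrt \<theta> * sqrt \<theta>" using sq by (intro mult_left_mono) auto
      then have "geometric_ratio 1 \<le> r"
        using sq theta_range by (simp add: geometric_ratio_def r_def field_simps)
      finally show "w\<^sub>0 / (\<mu> + w\<^sub>0) \<le> r" by (simp add: geometric_ratio_def)
      show "w\<^sub>0 \<le> upper_total j \<and> \<mu> * j \<le> upper_total j" if "n\<^sub>0 \<le> j" for j
        using upper[OF that] w\<^sub>0 by auto
    qed (use \<mu> w\<^sub>0 n sq in \<open>auto simp: \<phi>_def \<psi>_def r_def\<close>)
    moreover have "n / (C * n\<^sub>0) * geometric_ratio w\<^sub>0 ^ k \<le> \<phi> n * (w\<^sub>0 / (\<mu> + w\<^sub>0)) ^ k"
    proof -
      have "n / (C * n\<^sub>0) \<le> n / C" using n1 C by (intro divide_left_mono) auto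
      then show ?thesis unfolding geometric_ratio_def using \<phi> w\<^sub>0 \<mu> by (intro mult_right_mono) auto
    qed
    moreover have "\<psi> n * r ^ k \<le> (C * n\<^sub>0) * n powr s * r ^ k"
    proof -
      have "1 * (real n\<^sub>0 * n powr s) \<le> C * (n\<^sub>0 * n powr s)"
        using C by (intro mult_right_mono) auto
      then show ?thesis using \<psi> sq by (intro mult_right_mono) (auto simp: r_def mult.assoc)
    qed
    ultimately have N0: "n / (C * n\<^sub>0) * geometric_ratio (1 - v) ^ k - (C * n\<^sub>0) * n powr s * r ^ k \<le> N w\<^sub>0"
      by (simp add: w\<^sub>0_def)
    have int: "integrable \<nu> N"
      unfolding N_def[abs_def] vertex_sum_eq by (intro Bochner_Integration.integrable_sum integrable_vertex_tail upper)
    have "A \<le> measure \<nu> {w\<^sub>0<..} * N w\<^sub>0"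
      unfolding A w\<^sub>0_def[symmetric] using N0 by (intro mult_left_mono) (auto simp: w\<^sub>0_def)
    also have "\<dots> = (\<integral>w. indicator {w\<^sub>0<..} w * N w\<^sub>0 \<partial>\<nu>)"
      by (simp add: sets_law)
    also have "\<dots> \<le> (\<integral>w. N w \<partial>\<nu>)"
    proof (rule integral_mono_AE)
      show "AE w in \<nu>. indicator {w\<^sub>0<..} w * N w\<^sub>0 \<le> N w"
        using weights_bounded
      proof eventually_elim
        case (elim w)
        have "0 \<le> N w"
          unfolding N_def vertex_sum_eq using elim upper
          by (intro sum_nonneg) (use vertex_tail_range[of w n\<^sub>0 upper_total] in force)
        moreover have "N w\<^sub>0 \<le> N w" if "w\<^sub>0 < w"
          unfolding N_def vertex_sum_def
        proof (intro sum_mono tail_prob_mono)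
          fix i j
          show "0 \<le> (if n\<^sub>0 \<le> j \<and> i \<le> j then w\<^sub>0 / upper_total j else 0) \<and>
            (if n\<^sub>0 \<le> j \<and> i \<le> j then w\<^sub>0 / upper_total j else 0) \<le> (if n\<^sub>0 \<le> j \<and> i \<le> j then w / upper_total j else 0) \<and>
            (if n\<^sub>0 \<le> j \<and> i \<le> j then w / upper_total j else 0) \<le> 1"
            using that elim upper[of j] w\<^sub>0 by (auto intro!: divide_right_mono)
        qed
        ultimately show ?case by (auto simp: indicator_def)
      qed
    qed (use int in \<open>auto simp: sets_law law.emeasure_eq_measure\<close>)
    finally have AN: "A \<le> (\<integral>w. N w \<partial>\<nu>)" .
    note [measurable] = new_children_measurable[OF n1]
    have "prob {\<omega> \<in> space M. \<forall>i\<in>{1..n}. new_children 1 n i \<omega> < k}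
        \<le> prob {\<omega> \<in> space M. \<forall>i\<in>{1..n}. new_children n\<^sub>0 n i \<omega> < k}"
    proof (intro finite_measure_mono subsetI)
      fix \<omega> assume "\<omega> \<in> {\<omega> \<in> space M. \<forall>i\<in>{1..n}. new_children 1 n i \<omega> < k}"
      then show "\<omega> \<in> {\<omega> \<in> space M. \<forall>i\<in>{1..n}. new_children n\<^sub>0 n i \<omega> < k}"
        using le_less_trans[OF new_children_restart(1)[OF n1]] by blast
    qed measurable
    also have "\<dots> \<le> prob (space M - concentrated n\<^sub>0 n) + 8 / (\<integral>w. N w \<partial>\<nu>)"
      unfolding N_def by (rule second_moment_bound) (use n n1 n\<^sub>0 AN A0 in \<open>auto simp: N_def\<close>)
    also have "8 / (\<integral>w. N w \<partial>\<nu>) \<le> 8 / A" using AN A0 by (intro divide_left_mono) auto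
    finally show ?thesis using n\<^sub>0(4)[of n] by simp
  qed
  have "0 < C * n\<^sub>0" using C(1) n\<^sub>0(1) by simp
  then show thesis
    using main by (intro that[of "C * n\<^sub>0" n\<^sub>0]) (auto simp: r_def s_def)
qed

end

section \<open>From the decay of moments to the maximal degree\<close>
lemma nat_ceiling_asymp:
  fixes y L :: "nat \<Rightarrow> real"
  assumes "((\<lambda>n. y n / L n) \<longlongrightarrow> 1) sequentially" "filterlim L at_top sequentially"
  shows "((\<lambda>n. real (nat \<lceil>y n\<rceil> - m) / L n) \<longlongrightarrow> 1) sequentially"
    and "\<forall>\<^sub>F n in sequentially. real (nat \<lceil>y n\<rceil> - m) = \<lceil>y n\<rceil> - real m"
    and "filterlim (\<lambda>n. nat \<lceil>y n\<rceil> - m) at_top sequentially"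
proof -
  have L0: "\<forall>\<^sub>F n in sequentially. 0 < L n"
    using assms(2) by (simp add: filterlim_at_top_dense)
  have ytop: "filterlim y at_top sequentially"
  proof (rule filterlim_cong[THEN iffD1, OF refl refl])
    show "filterlim (\<lambda>n. y n / L n * L n) at_top sequentially"
      by (rule filterlim_tendsto_pos_mult_at_top[OF assms(1) _ assms(2)]) simp
    show "\<forall>\<^sub>F n in sequentially. y n / L n * L n = y n"
      using L0 by eventually_elim simp
  qed
  show eq: "\<forall>\<^sub>F n in sequentially. real (nat \<lceil>y n\<rceil> - m) = \<lceil>y n\<rceil> - real m"
    using eventually_ge_at_top[of 0] ytop[unfolded filterlim_at_top, rule_format, of m]
    by eventually_elim (simp add: of_nat_diff nat_le_iff, linarith)
  have lim: "((\<lambda>n. (y n - c) / L n) \<longlongrightarrow> 1) sequentially" for c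
  proof -
    have "((\<lambda>n. y n / L n - c / L n) \<longlongrightarrow> 1 - 0) sequentially"
      by (intro tendsto_diff assms(1) tendsto_divide_0[OF tendsto_const] filterlim_at_top_imp_at_infinity assms(2))
    then show ?thesis by (simp add: diff_divide_distrib)
  qed
  show "((\<lambda>n. real (nat \<lceil>y n\<rceil> - m) / L n) \<longlongrightarrow> 1) sequentially"
  proof (rule tendsto_sandwich[OF _ _ lim[of m] lim[of "real m - 1"]])
    show "\<forall>\<^sub>F n in sequentially. (y n - real m) / L n \<le> real (nat \<lceil>y n\<rceil> - m) / L n"
      using eq L0 by eventually_elim (auto intro!: divide_right_mono)
    show "\<forall>\<^sub>F n in sequentially. real (nat \<lceil>y n\<rceil> - m) / L n \<le> (y n - (real m - 1)) / L n"
      using eq L0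
    proof eventually_elim
      case (elim n)
      have "real (nat \<lceil>y n\<rceil> - m) \<le> y n - (real m - 1)" using elim(1) by linarith
      then show ?case using elim(2) by (intro divide_right_mono) auto
    qed
  qed
  show "filterlim (\<lambda>n. nat \<lceil>y n\<rceil> - m) at_top sequentially"
    unfolding filterlim_at_top
  proof
    fix Z :: nat
    show "\<forall>\<^sub>F n in sequentially. Z \<le> nat \<lceil>y n\<rceil> - m"
      using ytop[unfolded filterlim_at_top, rule_format, of "Z + m"]
      by eventually_elim (simp add: le_diff_conv2 le_nat_iff, linarith)
  qed
qed

definition (in bounded_weights_tree) centred_max :: "(nat \<Rightarrow> real) \<Rightarrow> (nat \<Rightarrow> real) \<Rightarrow> nat \<Rightarrow> 'a \<Rightarrow> real" where
  "centred_max a b n \<omega> = Max ((\<lambda>i. (wrt_indegree parent n i \<omega> - a n) / b n) ` {1..n})"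

text \<open>The assumptions say that \<open>E[q(W)\<^sup>k]\<close> equals \<open>exp (- k ln \<theta> - \<Psi>(k) + o(\<sigma>(k)))\<close>, with a lower bound that is
  already attained on weights above some \<open>1 - v(k)\<close> with \<open>v(k) \<longrightarrow> 0\<close>, and that \<open>\<Psi>\<close> and \<open>\<sigma>\<close>, both of smaller
  order than the identity, vary so slowly that arguments with ratio tending to one may be exchanged
  up to \<open>o(\<sigma>)\<close>.\<close>
locale tail_rate = bounded_weights_tree +
  fixes \<Psi> \<sigma> :: "real \<Rightarrow> real"
  assumes upper: "\<And>\<epsilon>. 0 < \<epsilon> \<Longrightarrow> \<forall>\<^sub>F k in sequentially.
        (\<integral>w. geometric_ratio w ^ k \<partial>\<nu>) \<le> exp (- (real k * ln \<theta>) - \<Psi> k + \<epsilon> * \<sigma> k)"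
    and lower: "\<And>\<epsilon>. 0 < \<epsilon> \<Longrightarrow> \<exists>v :: nat \<Rightarrow> real. v \<longlonglongrightarrow> 0 \<and> (\<forall>\<^sub>F k in sequentially. v k \<in> {0<..<1} \<and>
        exp (- (real k * ln \<theta>) - \<Psi> k - \<epsilon> * \<sigma> k) \<le> measure \<nu> {1 - v k<..} * geometric_ratio (1 - v k) ^ k)"
    and \<sigma>_top: "filterlim \<sigma> at_top at_top"
    and small: "((\<lambda>x. \<sigma> x / x) \<longlongrightarrow> 0) at_top" "((\<lambda>x. \<Psi> x / x) \<longlongrightarrow> 0) at_top"
    and regular: "\<And>f L :: nat \<Rightarrow> real. filterlim L at_top sequentially \<Longrightarrow> (\<lambda>n. f n / L n) \<longlonglongrightarrow> 1 \<Longrightarrow>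
        (\<lambda>n. (\<Psi> (f n) - \<Psi> (L n)) / \<sigma> (L n)) \<longlonglongrightarrow> 0 \<and> (\<lambda>n. \<sigma> (f n) / \<sigma> (L n)) \<longlonglongrightarrow> 1"
begin

text \<open>At the level \<open>k = L - \<Psi>(L) / ln \<theta> + c \<sigma>(L)\<close> one has \<open>ln n - k ln \<theta> - \<Psi>(k) = - c \<sigma>(L) ln \<theta> + o(\<sigma>(L))\<close>, since
  \<open>\<Psi>(k)\<close> may be replaced by \<open>\<Psi>(L)\<close>. So \<open>n E[q(W)\<^sup>k]\<close> tends to \<open>0\<close> for \<open>c = \<epsilon>\<close> and to infinity for
  \<open>c = - \<epsilon>\<close>.\<close>
lemma max_degree_concentration:
  assumes \<epsilon>: "0 < \<epsilon>"
  shows "(\<lambda>n. prob {\<omega> \<in> space M. \<exists>i\<in>{1..n}. log \<theta> n - \<Psi> (log \<theta> n) / ln \<theta> + \<epsilon> * \<sigma> (log \<theta> n) < new_children 1 n i \<omega>}) \<longlonglongrightarrow> 0"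
    and "(\<lambda>n. prob {\<omega> \<in> space M. \<forall>i\<in>{1..n}. new_children 1 n i \<omega> < log \<theta> n - \<Psi> (log \<theta> n) / ln \<theta> - \<epsilon> * \<sigma> (log \<theta> n)}) \<longlonglongrightarrow> 0"
proof -
  define L where "L n = log \<theta> (real n)" for n :: nat
  have l\<theta>: "0 < ln \<theta>" using theta_range by simp
  have L_ln: "L n * ln \<theta> = ln n" for n using l\<theta> by (simp add: L_def log_def)
  have Ltop: "filterlim L at_top sequentially"
    unfolding L_def using theta_range by real_asymp
  have L0: "\<forall>\<^sub>F n in sequentially. 0 < L n"
    using Ltop by (simp add: filterlim_at_top_dense)
  have \<sigma>L: "filterlim (\<lambda>n. \<sigma> (L n)) at_top sequentially"
    using \<sigma>_top Ltop by (rule filterlim_compose)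
  have \<sigma>L0: "\<forall>\<^sub>F n in sequentially. 0 < \<sigma> (L n)"
    using \<sigma>L by (simp add: filterlim_at_top_dense)
  define y where "y c n = L n - \<Psi> (L n) / ln \<theta> + c * \<sigma> (L n)" for c n
  have y_L: "(\<lambda>n. y c n / L n) \<longlonglongrightarrow> 1" for c
  proof (rule Lim_transform_eventually)
    have "(\<lambda>n. 1 - \<Psi> (L n) / L n / ln \<theta> + c * (\<sigma> (L n) / L n)) \<longlonglongrightarrow> 1 - 0 / ln \<theta> + c * 0"
      using l\<theta> by (intro tendsto_intros filterlim_compose[OF small(1) Ltop] filterlim_compose[OF small(2) Ltop]) auto
    then show "(\<lambda>n. 1 - \<Psi> (L n) / L n / ln \<theta> + c * (\<sigma> (L n) / L n)) \<longlonglongrightarrow> 1" by simp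
    show "\<forall>\<^sub>F n in sequentially. 1 - \<Psi> (L n) / L n / ln \<theta> + c * (\<sigma> (L n) / L n) = y c n / L n"
      using L0 by eventually_elim (simp add: y_def field_simps)
  qed
  have exponent_lim: "(\<lambda>n. (\<Psi> (L n) - \<Psi> (f n) + e * \<sigma> (f n) + c * \<sigma> (L n) + d) / \<sigma> (L n)) \<longlonglongrightarrow> e + c"
    if f: "(\<lambda>n. f n / L n) \<longlonglongrightarrow> 1" for f e c d
  proof (rule Lim_transform_eventually)
    have "(\<lambda>n. - ((\<Psi> (f n) - \<Psi> (L n)) / \<sigma> (L n)) + e * (\<sigma> (f n) / \<sigma> (L n)) + c + d / \<sigma> (L n)) \<longlonglongrightarrow> - 0 + e * 1 + c + 0"
      using regular[OF Ltop f]
      by (intro tendsto_intros tendsto_divide_0[OF tendsto_const] filterlim_at_top_imp_at_infinity \<sigma>L) auto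
    then show "(\<lambda>n. - ((\<Psi> (f n) - \<Psi> (L n)) / \<sigma> (L n)) + e * (\<sigma> (f n) / \<sigma> (L n)) + c + d / \<sigma> (L n)) \<longlonglongrightarrow> e + c"
      by simp
    show "\<forall>\<^sub>F n in sequentially. - ((\<Psi> (f n) - \<Psi> (L n)) / \<sigma> (L n)) + e * (\<sigma> (f n) / \<sigma> (L n)) + c + d / \<sigma> (L n)
          = (\<Psi> (L n) - \<Psi> (f n) + e * \<sigma> (f n) + c * \<sigma> (L n) + d) / \<sigma> (L n)"
      using \<sigma>L0 by eventually_elim (simp add: field_simps)
  qed
  \<comment> \<open>Half of the available room \<open>\<epsilon> ln \<theta>\<close> is spent on the error in the moment bounds.\<close>
  define e where "e = \<epsilon> * ln \<theta> / 2"
  have e0: "0 < e" using \<epsilon> l\<theta> by (simp add: e_def)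
  show "(\<lambda>n. prob {\<omega> \<in> space M. \<exists>i\<in>{1..n}. log \<theta> n - \<Psi> (log \<theta> n) / ln \<theta> + \<epsilon> * \<sigma> (log \<theta> n) < new_children 1 n i \<omega>}) \<longlonglongrightarrow> 0"
    unfolding L_def[symmetric] y_def[symmetric]
  proof (rule tendstoI)
    fix \<eta> :: real assume \<eta>: "0 < \<eta>"
    then have "0 < \<eta> / 2" by simp
    then obtain n\<^sub>0 C where C: "0 < C"
      "\<And>n k. n\<^sub>0 \<le> n \<Longrightarrow> prob {\<omega> \<in> space M. \<exists>i\<in>{1..n}. k + n\<^sub>0 \<le> new_children 1 n i \<omega>}
        \<le> \<eta> / 2 + C * n * (\<integral>w. geometric_ratio w ^ k \<partial>\<nu>)"
      by (rule upper_tail_bound) blast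
    define k where "k n = nat \<lceil>y \<epsilon> n\<rceil> - n\<^sub>0" for n
    note k = nat_ceiling_asymp[OF y_L[of \<epsilon>] Ltop, of n\<^sub>0, folded k_def]
    define B where "B n = \<Psi> (L n) - \<Psi> (k n) + e * \<sigma> (k n) + (- \<epsilon> * ln \<theta>) * \<sigma> (L n) + n\<^sub>0 * ln \<theta>" for n
    have "(\<lambda>n. B n / \<sigma> (L n)) \<longlonglongrightarrow> e + (- \<epsilon> * ln \<theta>)"
      unfolding B_def by (rule exponent_lim[OF k(1)])
    moreover have "e + (- \<epsilon> * ln \<theta>) < 0" using \<epsilon> l\<theta> by (simp add: e_def)
    ultimately have "filterlim (\<lambda>n. B n / \<sigma> (L n) * \<sigma> (L n)) at_bot sequentially"
      by (rule filterlim_tendsto_neg_mult_at_bot) (rule \<sigma>L)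
    moreover have "\<forall>\<^sub>F n in sequentially. B n / \<sigma> (L n) * \<sigma> (L n) = B n"
      using \<sigma>L0 by eventually_elim simp
    ultimately have "filterlim B at_bot sequentially"
      by (simp cong: filterlim_cong)
    then have "(\<lambda>n. C * exp (B n)) \<longlonglongrightarrow> C * 0"
      by (intro tendsto_intros filterlim_compose[OF exp_at_bot])
    then have small_B: "\<forall>\<^sub>F n in sequentially. C * exp (B n) < \<eta> / 2"
      using \<eta> by (intro order_tendstoD(2)[of _ "C * 0"]) auto
    have "\<forall>\<^sub>F n in sequentially. (\<integral>w. geometric_ratio w ^ k n \<partial>\<nu>) \<le> exp (- (real (k n) * ln \<theta>) - \<Psi> (k n) + e * \<sigma> (k n))"
      using filterlim_iff[THEN iffD1, OF k(3), rule_format, OF upper[OF e0]] .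
    then show "\<forall>\<^sub>F n in sequentially. dist (prob {\<omega> \<in> space M. \<exists>i\<in>{1..n}. y \<epsilon> n < new_children 1 n i \<omega>}) 0 < \<eta>"
      using small_B k(2) eventually_ge_at_top[of n\<^sub>0] eventually_ge_at_top[of 1]
    proof eventually_elim
      case (elim n)
      note [measurable] = new_children_measurable[OF order_refl]
      have "real (k n) \<ge> y \<epsilon> n - n\<^sub>0" using elim(3) le_of_int_ceiling[of "y \<epsilon> n"] by linarith
      then have "(y \<epsilon> n - n\<^sub>0) * ln \<theta> \<le> k n * ln \<theta>" using l\<theta> by (intro mult_right_mono) auto
      moreover have "(y \<epsilon> n - n\<^sub>0) * ln \<theta> = ln n - \<Psi> (L n) + \<epsilon> * ln \<theta> * \<sigma> (L n) - n\<^sub>0 * ln \<theta>"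
        using l\<theta> L_ln[of n] by (simp add: y_def algebra_simps)
      ultimately have "ln n + (- (real (k n) * ln \<theta>) - \<Psi> (k n) + e * \<sigma> (k n)) \<le> B n"
        by (simp add: B_def)
      then have "exp (ln n + (- (real (k n) * ln \<theta>) - \<Psi> (k n) + e * \<sigma> (k n))) \<le> exp (B n)" by simp
      then have "real n * exp (- (real (k n) * ln \<theta>) - \<Psi> (k n) + e * \<sigma> (k n)) \<le> exp (B n)"
        using elim(5) by (simp only: exp_add) simp
      moreover have "real n * (\<integral>w. geometric_ratio w ^ k n \<partial>\<nu>) \<le> real n * exp (- (real (k n) * ln \<theta>) - \<Psi> (k n) + e * \<sigma> (k n))"
        using elim(1) by (intro mult_left_mono) auto
      ultimately have nB: "C * (real n * (\<integral>w. geometric_ratio w ^ k n \<partial>\<nu>)) \<le> C * exp (B n)"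
        using C(1) by (intro mult_left_mono) auto
      have "prob {\<omega> \<in> space M. \<exists>i\<in>{1..n}. y \<epsilon> n < new_children 1 n i \<omega>}
         \<le> prob {\<omega> \<in> space M. \<exists>i\<in>{1..n}. k n + n\<^sub>0 \<le> new_children 1 n i \<omega>}"
      proof (intro finite_measure_mono subsetI)
        fix \<omega> assume "\<omega> \<in> {\<omega> \<in> space M. \<exists>i\<in>{1..n}. y \<epsilon> n < new_children 1 n i \<omega>}"
        then obtain i where *: "\<omega> \<in> space M" "i \<in> {1..n}" "y \<epsilon> n < new_children 1 n i \<omega>" by auto
        have "real (k n + n\<^sub>0) = \<lceil>y \<epsilon> n\<rceil>" using elim(3) by simp
        moreover have "\<lceil>y \<epsilon> n\<rceil> \<le> int (new_children 1 n i \<omega>)" using * by (simp add: ceiling_le_iff)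
        ultimately have "k n + n\<^sub>0 \<le> new_children 1 n i \<omega>" by linarith
        then show "\<omega> \<in> {\<omega> \<in> space M. \<exists>i\<in>{1..n}. k n + n\<^sub>0 \<le> new_children 1 n i \<omega>}" using * by auto
      qed measurable
      also have "\<dots> \<le> \<eta> / 2 + C * (n * (\<integral>w. geometric_ratio w ^ k n \<partial>\<nu>))"
        using C(2)[OF elim(4), of "k n"] by (simp add: mult.assoc)
      finally show ?case using nB elim(2) by simp
    qed
  qed
  obtain v :: "nat \<Rightarrow> real" where v: "v \<longlonglongrightarrow> 0" "\<forall>\<^sub>F k in sequentially. v k \<in> {0<..<1} \<and>
        exp (- (real k * ln \<theta>) - \<Psi> k - e * \<sigma> k) \<le> measure \<nu> {1 - v k<..} * geometric_ratio (1 - v k) ^ k"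
    using lower[OF e0] by blast
  show "(\<lambda>n. prob {\<omega> \<in> space M. \<forall>i\<in>{1..n}. new_children 1 n i \<omega> < log \<theta> n - \<Psi> (log \<theta> n) / ln \<theta> - \<epsilon> * \<sigma> (log \<theta> n)}) \<longlonglongrightarrow> 0"
  proof (rule tendstoI)
    fix \<eta> :: real assume \<eta>: "0 < \<eta>"
    define s where "s = 1 / (sqrt \<theta> + 1)"
    define r where "r = 1 / sqrt \<theta>"
    from \<eta> have "0 < \<eta> / 2" by simp
    then obtain n\<^sub>0 C where C: "0 < C"
      "\<And>n k v A. n\<^sub>0 \<le> n \<Longrightarrow> v \<in> {0<..<1} \<Longrightarrow>
        A = measure \<nu> {1 - v<..} * (n / C * geometric_ratio (1 - v) ^ k - C * n powr s * r ^ k) \<Longrightarrow>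
        0 < A \<Longrightarrow> prob {\<omega> \<in> space M. \<forall>i\<in>{1..n}. new_children 1 n i \<omega> < k} \<le> \<eta> / 2 + 8 / A"
      unfolding s_def r_def by (rule lower_tail_bound) blast
    have sq: "1 < sqrt \<theta>" using theta_range by simp
    have "inverse (sqrt \<theta> + 1) < inverse 2"
      by (rule less_imp_inverse_less) (use sq in linarith)+
    then have s: "s < 1 / 2" by (simp only: s_def inverse_eq_divide)
    have r0: "0 < r" using sq by (simp add: r_def)
    have lnr: "ln r = - (ln \<theta> / 2)" using theta_range by (simp add: r_def ln_div ln_sqrt)
    define k where "k n = nat \<lceil>y (-\<epsilon>) n\<rceil>" for n
    note k = nat_ceiling_asymp[OF y_L[of "-\<epsilon>"] Ltop, of 0, simplified, folded k_def]
    define B where "B n = \<Psi> (L n) - \<Psi> (k n) + (- e) * \<sigma> (k n) + (\<epsilon> * ln \<theta>) * \<sigma> (L n) + - ln \<theta>" for n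
    have "(\<lambda>n. B n / \<sigma> (L n)) \<longlonglongrightarrow> - e + \<epsilon> * ln \<theta>"
      unfolding B_def by (rule exponent_lim[OF k(1)])
    moreover have "0 < - e + \<epsilon> * ln \<theta>" using \<epsilon> l\<theta> by (simp add: e_def)
    ultimately have "filterlim (\<lambda>n. B n / \<sigma> (L n) * \<sigma> (L n)) at_top sequentially"
      by (rule filterlim_tendsto_pos_mult_at_top) (rule \<sigma>L)
    moreover have "\<forall>\<^sub>F n in sequentially. B n / \<sigma> (L n) * \<sigma> (L n) = B n"
      using \<sigma>L0 by eventually_elim simp
    ultimately have "filterlim B at_top sequentially"
      by (simp cong: filterlim_cong)
    then have "(\<lambda>n. 16 * C * exp (- B n)) \<longlonglongrightarrow> 16 * C * 0"
      by (intro tendsto_intros filterlim_compose[OF exp_at_bot]) (simp add: filterlim_uminus_at_top)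
    then have small_B: "\<forall>\<^sub>F n in sequentially. 16 * C * exp (- B n) < \<eta> / 2"
      using \<eta> by (intro order_tendstoD(2)[of _ "16 * C * 0"]) auto
    have vk: "(\<lambda>n. v (k n)) \<longlonglongrightarrow> 0"
      using v(1) k(3) by (rule filterlim_compose)
    have q_lim: "(\<lambda>n. ln (geometric_ratio (1 - v (k n)))) \<longlonglongrightarrow> - ln \<theta>"
    proof -
      have "(\<lambda>n. ln (geometric_ratio (1 - v (k n)))) \<longlonglongrightarrow> ln ((1 - 0) / (\<mu> + (1 - 0)))"
        unfolding geometric_ratio_def using theta_range by (intro tendsto_intros vk) auto
      then show ?thesis using theta_range by (simp add: ln_div)
    qed
    \<comment> \<open>\<open>exp (D n ln n)\<close> is the ratio of the two terms in the lower bound: \<open>n\<^sup>s r\<^sup>k\<close> over \<open>n q\<^sup>k\<close>.\<close>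
    define D where "D n = s - 1 + (k n / L n) / ln \<theta> * (ln r - ln (geometric_ratio (1 - v (k n))))" for n
    have "D \<longlonglongrightarrow> s - 1 + 1 / ln \<theta> * (ln r - (- ln \<theta>))"
      unfolding D_def[abs_def] using l\<theta> by (intro tendsto_intros k(1) q_lim) auto
    also have "s - 1 + 1 / ln \<theta> * (ln r - (- ln \<theta>)) = s - 1 / 2" using l\<theta> by (simp add: lnr field_simps)
    finally have D_lim: "D \<longlonglongrightarrow> s - 1 / 2" .
    have "filterlim (\<lambda>n. D n * ln (real n)) at_bot sequentially"
      using D_lim by (rule filterlim_tendsto_neg_mult_at_bot) (use s in simp, real_asymp)
    then have "(\<lambda>n. 2 * C\<^sup>2 * exp (D n * ln n)) \<longlonglongrightarrow> 2 * C\<^sup>2 * 0"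
      by (intro tendsto_intros filterlim_compose[OF exp_at_bot])
    then have small_D: "\<forall>\<^sub>F n in sequentially. 2 * C\<^sup>2 * exp (D n * ln n) < 1"
      by (intro order_tendstoD(2)[of _ "2 * C\<^sup>2 * 0"]) auto
    have "\<forall>\<^sub>F n in sequentially. v (k n) \<in> {0<..<1} \<and>
        exp (- (real (k n) * ln \<theta>) - \<Psi> (k n) - e * \<sigma> (k n))
          \<le> measure \<nu> {1 - v (k n)<..} * geometric_ratio (1 - v (k n)) ^ k n"
      using filterlim_iff[THEN iffD1, OF k(3), rule_format, OF v(2)] .
    then show "\<forall>\<^sub>F n in sequentially. dist (prob {\<omega> \<in> space M. \<forall>i\<in>{1..n}. new_children 1 n i \<omega>
         < log \<theta> n - \<Psi> (log \<theta> n) / ln \<theta> - \<epsilon> * \<sigma> (log \<theta> n)}) 0 < \<eta>"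
      using small_B small_D k(2) L0 eventually_ge_at_top[of n\<^sub>0] eventually_ge_at_top[of 2]
    proof eventually_elim
      case (elim n)
      note [measurable] = new_children_measurable[OF order_refl]
      define q where "q = geometric_ratio (1 - v (k n))"
      define m where "m = measure \<nu> {1 - v (k n)<..}"
      define A where "A = m * (n / C * q ^ k n - C * n powr s * r ^ k n)"
      have q0: "0 < q" using elim(1) theta_range by (simp add: q_def geometric_ratio_def)
      have n: "2 \<le> real n" using elim by simp
      have lnn: "0 < ln (real n)" using n by simp
      have kD: "D n * ln n = (s - 1) * ln n + k n * (ln r - ln q)"
      proof -
        have "(k n / L n) / ln \<theta> * ln n = k n" using L_ln[of n, symmetric] elim(5) l\<theta> by simp
        moreover have "D n * ln n = (s - 1) * ln n + ((k n / L n) / ln \<theta> * ln n) * (ln r - ln q)"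
          by (simp only: D_def q_def distrib_right) (simp only: ac_simps)
        ultimately show ?thesis by simp
      qed
      have "exp (D n * ln n) = n powr s * r ^ k n / (n * q ^ k n)"
      proof -
        have "exp (k n * ln r) = r ^ k n" "exp (k n * ln q) = q ^ k n"
          using r0 q0 by (simp_all add: exp_of_nat_mult)
        then show ?thesis
          unfolding kD using n q0
          by (simp add: exp_add exp_diff right_diff_distrib left_diff_distrib powr_def)
      qed
      then have "2 * C\<^sup>2 * (n powr s * r ^ k n) / (n * q ^ k n) < 1"
        using elim(3) by (simp only: times_divide_eq_right)
      moreover have "0 < n * q ^ k n" using n q0 by simp
      ultimately have "2 * C\<^sup>2 * (n powr s * r ^ k n) < n * q ^ k n"
        by (simp only: divide_less_eq_1_pos)
      then have "C * n powr s * r ^ k n \<le> n / C * q ^ k n / 2"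
        using C(1) by (simp add: field_simps power2_eq_square)
      moreover have "n / (2 * C) * q ^ k n = n / C * q ^ k n / 2" by simp
      moreover have "c \<le> b - a" if "a \<le> b / 2" "c = b / 2" for a b c :: real using that by simp
      ultimately have "n / (2 * C) * q ^ k n \<le> n / C * q ^ k n - C * n powr s * r ^ k n" by blast
      then have "m * (n / (2 * C) * q ^ k n) \<le> A"
        unfolding A_def by (rule mult_left_mono) (simp add: m_def)
      moreover have "n / (2 * C) * exp (- (real (k n) * ln \<theta>) - \<Psi> (k n) - e * \<sigma> (k n)) \<le> n / (2 * C) * (m * q ^ k n)"
        using elim(1) C(1) by (intro mult_left_mono) (auto simp: m_def q_def)
      ultimately have A1: "n * exp (- (real (k n) * ln \<theta>) - \<Psi> (k n) - e * \<sigma> (k n)) / (2 * C) \<le> A"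
        by (simp add: algebra_simps)
      have "real (k n) \<le> y (-\<epsilon>) n + 1" using elim(4) by linarith
      then have "k n * ln \<theta> \<le> (y (-\<epsilon>) n + 1) * ln \<theta>" using l\<theta> by (intro mult_right_mono) auto
      moreover have "(y (-\<epsilon>) n + 1) * ln \<theta> = ln n - \<Psi> (L n) - \<epsilon> * ln \<theta> * \<sigma> (L n) + ln \<theta>"
        using l\<theta> L_ln[of n] by (simp add: y_def algebra_simps)
      ultimately have "B n \<le> ln n + (- (real (k n) * ln \<theta>) - \<Psi> (k n) - e * \<sigma> (k n))"
        by (simp add: B_def)
      then have "exp (B n) \<le> exp (ln n + (- (real (k n) * ln \<theta>) - \<Psi> (k n) - e * \<sigma> (k n)))" by simp
      also have "\<dots> = real n * exp (- (real (k n) * ln \<theta>) - \<Psi> (k n) - e * \<sigma> (k n))"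
        using n by (simp only: exp_add) simp
      finally have "exp (B n) / (2 * C) \<le> A" using A1 C(1) by (smt (verit) divide_right_mono)
      moreover have "0 < exp (B n) / (2 * C)" using C(1) by simp
      ultimately have A0: "0 < A" and A2: "8 / A \<le> 8 / (exp (B n) / (2 * C))"
        by (linarith, intro divide_left_mono mult_pos_pos) linarith+
      have "8 / (exp (B n) / (2 * C)) = 16 * C * exp (- B n)" by (simp add: exp_minus field_simps)
      then have "8 / A < \<eta> / 2" using A2 elim(2) by simp
      moreover have "prob {\<omega> \<in> space M. \<forall>i\<in>{1..n}. new_children 1 n i \<omega> < k n} \<le> \<eta> / 2 + 8 / A"
        by (rule C(2)[OF elim(6), of "v (k n)"]) (use elim(1) A0 in \<open>auto simp: A_def m_def q_def\<close>)
      moreover have "prob {\<omega> \<in> space M. \<forall>i\<in>{1..n}. new_children 1 n i \<omega> < y (-\<epsilon>) n}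
           \<le> prob {\<omega> \<in> space M. \<forall>i\<in>{1..n}. new_children 1 n i \<omega> < k n}"
      proof (intro finite_measure_mono subsetI)
        fix \<omega> assume *: "\<omega> \<in> {\<omega> \<in> space M. \<forall>i\<in>{1..n}. new_children 1 n i \<omega> < y (-\<epsilon>) n}"
        have "new_children 1 n i \<omega> < k n" if "i \<in> {1..n}" for i
        proof -
          have "real (new_children 1 n i \<omega>) < y (-\<epsilon>) n" using * that by auto
          also have "\<dots> \<le> k n" using elim(4) by simp
          finally show ?thesis by simp
        qed
        then show "\<omega> \<in> {\<omega> \<in> space M. \<forall>i\<in>{1..n}. new_children 1 n i \<omega> < k n}" using * by auto
      qed measurable
      ultimately show ?case by (simp add: y_def L_def)
    qed
  qed
qed

text \<open>The hypothesis allows a centring that agrees with \<open>L - \<Psi>(L) / ln \<theta> - c \<sigma>(L)\<close> up to \<open>o(\<sigma>(L))\<close> only.\<close>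
lemma centred_max_converges:
  assumes centre: "(\<lambda>n. (a n - (log \<theta> n - \<Psi> (log \<theta> n) / ln \<theta>)) / \<sigma> (log \<theta> n)) \<longlonglongrightarrow> - c"
  shows "converges_in_probability M (centred_max a (\<lambda>n. \<sigma> (log \<theta> n))) c"
  unfolding converges_in_probability_def
proof (intro allI impI)
  fix \<epsilon> :: real assume \<epsilon>: "0 < \<epsilon>"
  define L where "L n = log \<theta> (real n)" for n :: nat
  define y where "y n = L n - \<Psi> (L n) / ln \<theta>" for n
  let ?U = "\<lambda>n. {\<omega> \<in> space M. \<exists>i\<in>{1..n}. y n + \<epsilon> / 2 * \<sigma> (L n) < new_children 1 n i \<omega>}"
  let ?D = "\<lambda>n. {\<omega> \<in> space M. \<forall>i\<in>{1..n}. new_children 1 n i \<omega> < y n - \<epsilon> / 2 * \<sigma> (L n)}"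
  let ?X = "centred_max a (\<lambda>n. \<sigma> (L n))"
  have "0 < \<epsilon> / 2" using \<epsilon> by simp
  note conc = max_degree_concentration[OF this, folded L_def, folded y_def]
  have Ltop: "filterlim L at_top sequentially"
    unfolding L_def using theta_range by real_asymp
  have "filterlim (\<lambda>n. \<sigma> (L n)) at_top sequentially"
    using \<sigma>_top Ltop by (rule filterlim_compose)
  then have \<sigma>L0: "\<forall>\<^sub>F n in sequentially. 0 < \<sigma> (L n)"
    by (simp add: filterlim_at_top_dense)
  have close: "\<forall>\<^sub>F n in sequentially. dist ((a n - y n) / \<sigma> (L n)) (- c) < \<epsilon> / 2"
    using centre \<epsilon> by (intro tendstoD) (auto simp: L_def y_def)
  have "\<forall>\<^sub>F n in sequentially. prob {\<omega> \<in> space M. \<bar>?X n \<omega> - c\<bar> > \<epsilon>} \<le> prob (?U n) + prob (?D n)"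
    using \<sigma>L0 close eventually_ge_at_top[of 1]
  proof eventually_elim
    case (elim n)
    note [measurable] = new_children_measurable[OF order_refl]
    define s where "s = \<sigma> (L n)"
    have s: "0 < s" using elim by (simp add: s_def)
    define d where "d = (a n - y n) / s + c"
    have d: "\<bar>d\<bar> < \<epsilon> / 2" using elim by (simp add: d_def s_def dist_real_def)
    then have "d * s < \<epsilon> / 2 * s" "- (\<epsilon> / 2 * s) < d * s"
      using s mult_strict_right_mono[of d "\<epsilon> / 2" s] mult_strict_right_mono[of "- (\<epsilon> / 2)" d s] by auto
    moreover have "a n = y n + d * s - c * s" using s by (simp add: d_def field_simps)
    ultimately have a: "a n + c * s < y n + \<epsilon> / 2 * s" "y n - \<epsilon> / 2 * s < a n + c * s" by linarith+
    have "{\<omega> \<in> space M. \<bar>?X n \<omega> - c\<bar> > \<epsilon>} \<subseteq> ?U n \<union> ?D n"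
    proof
      fix \<omega> assume "\<omega> \<in> {\<omega> \<in> space M. \<bar>?X n \<omega> - c\<bar> > \<epsilon>}"
      then have \<omega>: "\<omega> \<in> space M" "c + \<epsilon> < ?X n \<omega> \<or> ?X n \<omega> < c - \<epsilon>" by auto
      let ?z = "\<lambda>i. (real (new_children 1 n i \<omega>) - a n) / s"
      have X: "?X n \<omega> = Max (?z ` {1..n})"
        using elim by (simp add: centred_max_def in_degree_eq s_def)
      have ne: "?z ` {1..n} \<noteq> {}" using elim by simp
      from \<omega>(2) show "\<omega> \<in> ?U n \<union> ?D n"
      proof
        assume "c + \<epsilon> < ?X n \<omega>"
        then obtain i where i: "i \<in> {1..n}" "c + \<epsilon> < ?z i"
          using ne by (auto simp: X Max_gr_iff)
        then have "(c + \<epsilon>) * s < real (new_children 1 n i \<omega>) - a n"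
          using s by (simp add: pos_less_divide_eq)
        then have "a n + c * s + \<epsilon> / 2 * s + \<epsilon> / 2 * s < new_children 1 n i \<omega>" by (simp add: algebra_simps)
        then have "y n + \<epsilon> / 2 * s < new_children 1 n i \<omega>" using a by linarith
        then show ?thesis using \<omega> i unfolding s_def by blast
      next
        assume *: "?X n \<omega> < c - \<epsilon>"
        have "new_children 1 n i \<omega> < y n - \<epsilon> / 2 * s" if i: "i \<in> {1..n}" for i
        proof -
          have "?z i < c - \<epsilon>" using * ne i by (auto simp: X Max_less_iff)
          then have "real (new_children 1 n i \<omega>) - a n < (c - \<epsilon>) * s"
            using s by (simp add: pos_divide_less_eq)
          then have "new_children 1 n i \<omega> < a n + c * s - \<epsilon> / 2 * s - \<epsilon> / 2 * s" by (simp add: algebra_simps)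
          then show ?thesis using a by linarith
        qed
        then show ?thesis using \<omega> unfolding s_def by blast
      qed
    qed
    then have "prob {\<omega> \<in> space M. \<bar>?X n \<omega> - c\<bar> > \<epsilon>} \<le> prob (?U n \<union> ?D n)"
      by (intro finite_measure_mono) auto
    also have "\<dots> \<le> prob (?U n) + prob (?D n)" by (intro measure_Un_le) auto
    finally show ?case .
  qed
  then have "(\<lambda>n. prob {\<omega> \<in> space M. \<bar>?X n \<omega> - c\<bar> > \<epsilon>}) \<longlonglongrightarrow> 0"
  proof (rule tendsto_sandwich[OF always_eventually _ tendsto_const, rotated])
    show "(\<lambda>n. prob (?U n) + prob (?D n)) \<longlonglongrightarrow> 0"
      using tendsto_add[OF conc] by simp
  qed simp
  then show "(\<lambda>n. prob {\<omega> \<in> space M. \<bar>centred_max a (\<lambda>n. \<sigma> (log \<theta> n)) n \<omega> - c\<bar> > \<epsilon>}) \<longlonglongrightarrow> 0"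
    by (simp add: L_def)
qed

end

section \<open>Moments in terms of the weight distribution near one\<close>
lemma powr_above_tangent:
  fixes x y \<tau> :: real
  assumes "0 < x" "0 < y" "1 \<le> \<tau>"
  shows "y powr \<tau> + \<tau> * y powr (\<tau> - 1) * (x - y) \<le> x powr \<tau>"
proof -
  have "x powr \<tau> - y powr \<tau> \<ge> (\<tau> * y powr (\<tau> - 1)) * (x - y)"
  proof (rule convex_on_imp_above_tangent[OF powr_convex[OF assms(3)]])
    show "((\<lambda>x. x powr \<tau>) has_real_derivative \<tau> * y powr (\<tau> - 1)) (at y within {0<..})"
      using assms by (auto intro!: derivative_eq_intros)
  qed (use assms in \<open>auto simp: connected_Ioi interior_open\<close>)
  then show ?thesis by simp
qed

lemma linear_minus_log_minimum:
  fixes y B :: real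
  assumes "0 < y" "0 < B"
  shows "B - B * ln B \<le> y - B * ln y"
proof -
  have "B * ln (y / B) \<le> B * (y / B - 1)"
    using assms by (intro mult_left_mono ln_le_minus_one) auto
  then show ?thesis using assms by (simp add: ln_div algebra_simps)
qed

context bounded_weights_tree
begin

text \<open>The logarithmic derivative of \<open>q\<close> at the maximal weight one.\<close>
definition \<kappa> :: real where "\<kappa> = 1 - 1 / \<theta>"

lemma kappa_range: "0 < \<kappa>" "\<kappa> \<le> 1 / 2" and kappa_times_theta: "\<kappa> * \<theta> = \<theta> - 1"
  using theta_range by (auto simp: \<kappa>_def field_simps)

definition tail :: "real \<Rightarrow> real" where
  "tail x = measure \<nu> {1 - 1 / x<..}"

text \<open>\<open>\<theta> q(1 - v) = 1 - \<kappa> v / (1 - v / \<theta>)\<close>, which is at most \<open>1 - \<kappa> v\<close>.\<close>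
lemma geometric_ratio_le_exp:
  assumes "w \<in> {0<..1}"
  shows "geometric_ratio w \<le> exp (- \<kappa> * (1 - w)) / \<theta>"
proof -
  define v where "v = 1 - w"
  have v: "0 \<le> v" "v < 1" using assms by (auto simp: v_def)
  have "(\<theta> - v) * (1 - \<kappa> * v) = \<theta> * (1 - v) + \<kappa> * v\<^sup>2"
  proof -
    have "\<kappa> * \<theta> * v = (\<theta> - 1) * v" by (simp only: kappa_times_theta)
    then show ?thesis by (simp add: algebra_simps power2_eq_square)
  qed
  then have "\<theta> * (1 - v) \<le> (1 - \<kappa> * v) * (\<theta> - v)"
    using kappa_range by (simp add: mult.commute)
  then have "\<theta> * ((1 - v) / (\<theta> - v)) \<le> 1 - \<kappa> * v"
    using theta_range v by (simp add: pos_divide_le_eq)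
  also have "\<dots> \<le> exp (- \<kappa> * v)" using exp_ge_add_one_self[of "- \<kappa> * v"] by simp
  finally have *: "\<theta> * ((1 - v) / (\<theta> - v)) \<le> exp (- \<kappa> * v)" .
  have "\<theta> * geometric_ratio w \<le> exp (- \<kappa> * (1 - w))"
  proof -
    have "geometric_ratio w = (1 - v) / (\<theta> - v)" by (simp add: geometric_ratio_def v_def algebra_simps)
    then show ?thesis using * by (simp add: v_def)
  qed
  then show ?thesis using theta_range by (simp add: pos_le_divide_eq mult.commute)
qed

lemma geometric_ratio_ge_exp:
  assumes "0 \<le> v" "v \<le> 1 / 2"
  shows "exp (- \<kappa> * v - 3 * v\<^sup>2) / \<theta> \<le> geometric_ratio (1 - v)"
proof -
  define x where "x = \<kappa> * v / (1 - v / \<theta>)"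
  have vt: "v / \<theta> \<le> v" "0 \<le> v / \<theta>"
    using theta_range assms by (auto simp: divide_le_eq mult_le_cancel_left1)
  have d: "1 / 2 \<le> 1 - v / \<theta>" using vt assms by linarith
  have kv: "0 \<le> \<kappa> * v" "\<kappa> * v \<le> 1 / 2 * v" using kappa_range assms mult_right_mono[OF kappa_range(2), of v] by auto
  have "1 / (1 - v / \<theta>) \<le> 1 + 2 * (v / \<theta>)"
  proof -
    have "1 / (1 - z) \<le> 1 + 2 * z" if "0 \<le> z" "z \<le> 1 / 2" for z :: real
      using that mult_left_mono[of "2 * z" 1 z] by (simp add: pos_divide_le_eq algebra_simps)
    then show ?thesis by this (use vt d in linarith)+
  qed
  then have inv: "1 / (1 - v / \<theta>) \<le> 1 + 2 * v" using vt by linarith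
  have "x = \<kappa> * v * (1 / (1 - v / \<theta>))" by (simp add: x_def)
  also have "\<dots> \<le> \<kappa> * v * (1 + 2 * v)" using inv kv by (intro mult_left_mono) auto
  also have "\<dots> = \<kappa> * v + 2 * v * (\<kappa> * v)" by (simp add: algebra_simps)
  also have "2 * v * (\<kappa> * v) \<le> 2 * v * (1 / 2 * v)" using kv assms by (intro mult_left_mono) auto
  also have "2 * v * (1 / 2 * v) = v\<^sup>2" by (simp add: power2_eq_square)
  finally have x1: "x \<le> \<kappa> * v + v\<^sup>2" by simp
  have "v\<^sup>2 \<le> 1 / 2 * v" using mult_right_mono[OF assms(2) assms(1)] by (simp add: power2_eq_square)
  then have x2: "x \<le> v" using x1 kv by linarith
  have x0: "0 \<le> x" unfolding x_def by (rule divide_nonneg_nonneg) (use kv d in linarith)+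
  have "x\<^sup>2 \<le> v\<^sup>2" using x0 x2 by (intro power_mono) auto
  then have "- \<kappa> * v - 3 * v\<^sup>2 \<le> - x - 2 * x\<^sup>2" using x1 by simp
  also have "\<dots> \<le> ln (1 - x)" using x0 x2 assms by (intro ln_one_minus_pos_lower_bound) auto
  finally have "exp (- \<kappa> * v - 3 * v\<^sup>2) \<le> exp (ln (1 - x))" by simp
  also have "\<dots> = 1 - x" using x2 assms by simp
  also have "1 - x = \<theta> * geometric_ratio (1 - v)"
  proof -
    have "\<theta> - v > 0" using theta_range assms by linarith
    moreover have "x = \<kappa> * \<theta> * v / (\<theta> - v)"
      using theta_range d by (simp add: x_def field_simps)
    ultimately show ?thesis
      unfolding kappa_times_theta by (simp add: geometric_ratio_def field_simps)
  qed
  finally show ?thesis using theta_range by (simp add: pos_divide_le_eq mult.commute)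
qed

lemma power_exp_divide_theta: "(exp z / \<theta>) ^ k = exp (k * z) * exp (- (real k * ln \<theta>))"
proof -
  have "exp z / \<theta> = exp (z - ln \<theta>)" using theta_range by (simp add: exp_diff)
  then have "(exp z / \<theta>) ^ k = exp (k * (z - ln \<theta>))" by (simp add: exp_of_nat_mult)
  then show ?thesis by (simp add: right_diff_distrib flip: exp_add)
qed

text \<open>With \<open>Y = \<kappa> k (1 - W)\<close> the moment is at most \<open>\<theta>\<^bsup>-k\<^esup> E[exp (- Y)]\<close>. Unit intervals \<open>j \<le> Y < j + 1\<close> keep the loss
  at a constant per interval; and since only \<open>J\<close> of them are needed before \<open>exp (- J)\<close> is negligible,
  no factor as large as \<open>k\<close> is lost.\<close>
lemma moment_le_tail_sum:
  assumes "1 \<le> k"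
  shows "(\<integral>w. geometric_ratio w ^ k \<partial>\<nu>)
      \<le> exp (- (real k * ln \<theta>)) * ((\<Sum>j<J. exp (- real j) * tail (\<kappa> * k / (j + 1))) + exp (- real J))"
proof -
  have \<kappa>k: "0 < \<kappa> * k" using kappa_range assms by simp
  define I :: "nat \<Rightarrow> real \<Rightarrow> real" where "I j = indicator {1 - 1 / (\<kappa> * k / (real j + 1))<..}" for j
  have I: "0 \<le> I j w" "1 - w < (real j + 1) / (\<kappa> * k) \<Longrightarrow> I j w = 1" for j w
    by (auto simp: I_def)
  have int: "integrable \<nu> (I j)" "(\<integral>w. I j w \<partial>\<nu>) = tail (\<kappa> * k / (real j + 1))" for j
    by (simp_all add: I_def tail_def sets_law law.emeasure_eq_measure)
  have "(\<integral>w. geometric_ratio w ^ k \<partial>\<nu>) \<le>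
      (\<integral>w. exp (- (real k * ln \<theta>)) * ((\<Sum>j<J. exp (- real j) * I j w) + exp (- real J)) \<partial>\<nu>)"
  proof (rule integral_mono_AE)
    show "integrable \<nu> (\<lambda>w. geometric_ratio w ^ k)" by (rule integrable_ratio_power)
    show "integrable \<nu> (\<lambda>w. exp (- (real k * ln \<theta>)) * ((\<Sum>j<J. exp (- real j) * I j w) + exp (- real J)))"
      using int by auto
    show "AE w in \<nu>. geometric_ratio w ^ k \<le>
        exp (- (real k * ln \<theta>)) * ((\<Sum>j<J. exp (- real j) * I j w) + exp (- real J))"
      using weights_bounded
    proof eventually_elim
      case (elim w)
      define y where "y = \<kappa> * k * (1 - w)"
      have y0: "0 \<le> y" using \<kappa>k elim by (simp add: y_def)
      have "geometric_ratio w ^ k \<le> (exp (- \<kappa> * (1 - w)) / \<theta>) ^ k"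
        using elim geometric_ratio_range[of w] by (intro power_mono geometric_ratio_le_exp) auto
      also have "\<dots> = exp (- y) * exp (- (real k * ln \<theta>))"
        unfolding power_exp_divide_theta by (simp add: y_def algebra_simps)
      finally have q: "geometric_ratio w ^ k \<le> exp (- (real k * ln \<theta>)) * exp (- y)" by (simp add: mult.commute)
      define j where "j = nat \<lfloor>y\<rfloor>"
      have j: "real j \<le> y" "y < real j + 1" using y0 by (auto simp: j_def)
      have "exp (- y) \<le> (\<Sum>j<J. exp (- real j) * I j w) + exp (- real J)"
      proof (cases "j < J")
        case True
        have "1 - w < (real j + 1) / (\<kappa> * k)"
          using j \<kappa>k by (simp add: y_def pos_less_divide_eq mult.commute)
        then have "exp (- y) \<le> exp (- real j) * I j w" using j I by simp
        also have "\<dots> \<le> (\<Sum>j<J. exp (- real j) * I j w)"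
          using True I by (intro member_le_sum) auto
        finally show ?thesis by (simp add: add_increasing2)
      next
        case False
        then have "exp (- y) \<le> exp (- real J)" using j by simp
        moreover have "0 \<le> (\<Sum>j<J. exp (- real j) * I j w)" using I by (intro sum_nonneg) auto
        ultimately show ?thesis by linarith
      qed
      then show ?case using q by (meson exp_ge_zero mult_left_mono order_trans)
    qed
  qed
  also have "\<dots> = exp (- (real k * ln \<theta>)) * ((\<Sum>j<J. exp (- real j) * tail (\<kappa> * k / (j + 1))) + exp (- real J))"
    using int law.prob_space by (simp add: add.commute)
  finally show ?thesis .
qed

text \<open>The choice \<open>J = \<lceil>\<Psi>(k)\<rceil>\<close> makes the remainder \<open>exp (- J)\<close> at most the claimed order. Here \<open>y\<close> plays the
  role of \<open>j + 1\<close>, and each summand \<open>exp (- y) tail (\<kappa> k / y)\<close> is bounded by the optimum \<open>exp (- \<Psi>(k))\<close> up to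
  the factor \<open>P k\<close>.\<close>
lemma moment_upper_bound:
  fixes P :: "nat \<Rightarrow> real" and \<Psi> \<sigma> :: "real \<Rightarrow> real"
  assumes decay: "\<forall>\<^sub>F k in sequentially. \<forall>y\<in>{1..nat \<lceil>\<Psi> (real k)\<rceil>}. tail (\<kappa> * k / y) \<le> P k * exp (y - \<Psi> k)"
    and nonneg: "\<forall>\<^sub>F k in sequentially. 0 \<le> P k \<and> 0 \<le> \<Psi> (real k)"
    and negligible: "\<forall>\<^sub>F k in sequentially. exp 1 * (\<Psi> k + 1) * P k + 1 \<le> exp (\<epsilon> * \<sigma> (real k))"
  shows "\<forall>\<^sub>F k in sequentially.
     (\<integral>w. geometric_ratio w ^ k \<partial>\<nu>) \<le> exp (- (real k * ln \<theta>) - \<Psi> k + \<epsilon> * \<sigma> k)"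
  using decay nonneg negligible eventually_ge_at_top[of 1]
proof eventually_elim
  case (elim k)
  define J where "J = nat \<lceil>\<Psi> (real k)\<rceil>"
  have J: "\<Psi> k \<le> real J" "real J \<le> \<Psi> k + 1" 
  proof -
    have "real J = of_int \<lceil>\<Psi> k\<rceil>" using elim(2) by (simp add: J_def)
    then show "\<Psi> k \<le> real J" "real J \<le> \<Psi> k + 1" using ceiling_correct[of "\<Psi> k"] by linarith+
  qed
  have "(\<Sum>j<J. exp (- real j) * tail (\<kappa> * k / (j + 1))) \<le> (\<Sum>j<J. exp 1 * P k * exp (- \<Psi> k))"
  proof (intro sum_mono)
    fix j assume "j \<in> {..<J}"
    then have "Suc j \<in> {1..J}" by simp
    then have "tail (\<kappa> * k / (j + 1)) \<le> P k * exp (j + 1 - \<Psi> k)"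
      using elim(1) by (fastforce simp: J_def add.commute)
    then have "exp (- real j) * tail (\<kappa> * k / (j + 1)) \<le> exp (- real j) * (P k * exp (j + 1 - \<Psi> k))"
      by (intro mult_left_mono) auto
    also have "\<dots> = P k * (exp (- real j) * exp (j + 1 - \<Psi> k))" by simp
    also have "exp (- real j) * exp (j + 1 - \<Psi> k) = exp 1 * exp (- \<Psi> k)"
      by (simp flip: exp_add)
    finally show "exp (- real j) * tail (\<kappa> * k / (j + 1)) \<le> exp 1 * P k * exp (- \<Psi> k)" by (simp add: mult_ac)
  qed
  also have "\<dots> = real J * (exp 1 * P k * exp (- \<Psi> k))" by simp
  also have "\<dots> \<le> (\<Psi> k + 1) * (exp 1 * P k * exp (- \<Psi> k))"
    using J elim(2) by (intro mult_right_mono) auto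
  finally have "(\<Sum>j<J. exp (- real j) * tail (\<kappa> * k / (j + 1))) + exp (- real J)
      \<le> (\<Psi> k + 1) * (exp 1 * P k * exp (- \<Psi> k)) + exp (- \<Psi> k)"
    using J by (intro add_mono) auto
  also have "\<dots> = (exp 1 * (\<Psi> k + 1) * P k + 1) * exp (- \<Psi> k)" by (simp add: algebra_simps)
  also have "\<dots> \<le> exp (\<epsilon> * \<sigma> k) * exp (- \<Psi> k)" using elim(3) by (intro mult_right_mono) auto
  finally have "exp (- (real k * ln \<theta>)) * ((\<Sum>j<J. exp (- real j) * tail (\<kappa> * k / (j + 1))) + exp (- real J))
      \<le> exp (- (real k * ln \<theta>)) * (exp (\<epsilon> * \<sigma> k) * exp (- \<Psi> k))"
    by (intro mult_left_mono) auto
  also have "\<dots> = exp (- (real k * ln \<theta>) - \<Psi> k + \<epsilon> * \<sigma> k)" by (simp flip: exp_add)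
  finally show ?case using moment_le_tail_sum[OF elim(4), of J] by linarith
qed

text \<open>It suffices to exhibit a good \<open>x\<close>: weights above \<open>1 - 1 / x\<close> alone give the bound. The term
  \<open>3 k / x\<^sup>2\<close> is the second-order error of \<open>q(1 - v) \<approx> exp (- \<kappa> v) / \<theta>\<close>.\<close>
lemma moment_lower_bound:
  fixes x :: "nat \<Rightarrow> real" and \<Psi> \<sigma> :: "real \<Rightarrow> real"
  assumes x: "filterlim x at_top sequentially"
    and large: "\<forall>\<^sub>F k in sequentially. exp (- \<Psi> (real k) - \<epsilon> * \<sigma> (real k) + \<kappa> * k / x k + 3 * k / (x k)\<^sup>2) \<le> tail (x k)"
  shows "\<exists>v :: nat \<Rightarrow> real. v \<longlonglongrightarrow> 0 \<and> (\<forall>\<^sub>F k in sequentially. v k \<in> {0<..<1} \<and>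
        exp (- (real k * ln \<theta>) - \<Psi> k - \<epsilon> * \<sigma> k) \<le> measure \<nu> {1 - v k<..} * geometric_ratio (1 - v k) ^ k)"
proof (intro exI[of _ "\<lambda>k. 1 / x k"] conjI)
  show "(\<lambda>k. 1 / x k) \<longlonglongrightarrow> 0"
    by (intro tendsto_divide_0[OF tendsto_const] filterlim_at_top_imp_at_infinity x)
  have "\<forall>\<^sub>F k in sequentially. 2 \<le> x k" using x by (simp add: filterlim_at_top)
  with large show "\<forall>\<^sub>F k in sequentially. 1 / x k \<in> {0<..<1} \<and>
        exp (- (real k * ln \<theta>) - \<Psi> k - \<epsilon> * \<sigma> k) \<le> measure \<nu> {1 - 1 / x k<..} * geometric_ratio (1 - 1 / x k) ^ k"
  proof eventually_elim
    case (elim k)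
    define v where "v = 1 / x k"
    have v: "0 < v" "v \<le> 1 / 2" using elim(2) by (auto simp: v_def divide_le_eq)
    define R where "R = \<kappa> * k / x k + 3 * k / (x k)\<^sup>2"
    have "(exp (- \<kappa> * v - 3 * v\<^sup>2) / \<theta>) ^ k = exp (- R) * exp (- (real k * ln \<theta>))"
      unfolding power_exp_divide_theta by (simp add: R_def v_def power_divide algebra_simps)
    moreover have "(exp (- \<kappa> * v - 3 * v\<^sup>2) / \<theta>) ^ k \<le> geometric_ratio (1 - v) ^ k"
      using v theta_range by (intro power_mono geometric_ratio_ge_exp) auto
    ultimately have "exp (- R) * exp (- (real k * ln \<theta>)) \<le> geometric_ratio (1 - v) ^ k" by simp
    moreover have "exp (- \<Psi> k - \<epsilon> * \<sigma> k + R) \<le> tail (x k)" using elim(1) by (simp add: R_def add.assoc)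
    ultimately have "exp (- \<Psi> k - \<epsilon> * \<sigma> k + R) * (exp (- R) * exp (- (real k * ln \<theta>)))
        \<le> tail (x k) * geometric_ratio (1 - v) ^ k"
      by (intro mult_mono) (auto simp: tail_def)
    moreover have "exp (- \<Psi> k - \<epsilon> * \<sigma> k + R) * (exp (- R) * exp (- (real k * ln \<theta>)))
        = exp (- (real k * ln \<theta>) - \<Psi> k - \<epsilon> * \<sigma> k)"
      by (simp flip: exp_add)
    ultimately show ?case using v elim(2) by (simp add: tail_def v_def)
  qed
qed

end

section \<open>Stretched exponential tails\<close>

text \<open>The minimiser \<open>Y\<close> solves \<open>Y\<^bsup>1+\<tau>\<^esup> = \<tau> A\<^bsup>\<tau>\<^esup>\<close>. After scaling \<open>y = Y u\<close>, the inequality becomes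
  \<open>u + u\<^bsup>-\<tau>\<^esup> / \<tau> \<ge> 1 + 1 / \<tau>\<close>, which follows from \<open>u\<^bsup>-\<tau>\<^esup> \<ge> 1 - \<tau> ln u\<close> and \<open>ln u \<le> u - 1\<close>.\<close>
lemma weighted_sum_minimum:
  fixes A \<tau> :: real
  assumes "0 < A" "0 < \<tau>"
  defines "Y \<equiv> (\<tau> * A powr \<tau>) powr (1 / (1 + \<tau>))"
  shows "Y + (A / Y) powr \<tau> = (1 + 1 / \<tau>) * Y"
    and "0 < y \<Longrightarrow> (1 + 1 / \<tau>) * Y \<le> y + (A / y) powr \<tau>"
proof -
  have Y: "0 < Y" using assms by (simp add: Y_def)
  have "Y powr (1 + \<tau>) = \<tau> * A powr \<tau>"
    using assms by (simp add: Y_def powr_powr)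
  then have AY: "A powr \<tau> / Y powr \<tau> = Y / \<tau>"
    using Y assms by (simp add: powr_add field_simps)
  then show "Y + (A / Y) powr \<tau> = (1 + 1 / \<tau>) * Y"
    using Y assms by (simp add: powr_divide algebra_simps)
  assume y: "0 < y"
  define u where "u = y / Y"
  have u: "0 < u" "y = Y * u" using y Y by (auto simp: u_def)
  have "1 + 1 / \<tau> \<le> u + (1 - \<tau> * ln u) / \<tau>"
    using ln_le_minus_one[OF u(1)] assms by (simp add: diff_divide_distrib)
  also have "1 - \<tau> * ln u \<le> u powr (- \<tau>)"
    using exp_ge_add_one_self[of "- \<tau> * ln u"] u by (simp add: powr_def)
  finally have "Y * (1 + 1 / \<tau>) \<le> Y * (u + u powr (- \<tau>) / \<tau>)"
    using Y assms by (simp add: divide_right_mono)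
  also have "\<dots> = y + (Y / \<tau>) * u powr (- \<tau>)" by (simp add: u algebra_simps)
  also have "(Y / \<tau>) * u powr (- \<tau>) = (A / y) powr \<tau>"
    unfolding AY[symmetric] u(2) by (simp only: powr_divide powr_mult powr_minus) (simp add: divide_inverse)
  finally show "(1 + 1 / \<tau>) * Y \<le> y + (A / y) powr \<tau>" by (simp add: mult.commute)
qed

context bounded_weights_tree
begin

lemma tail_comparable:
  assumes "tail \<sim>[at_top] g" "\<And>x. 0 \<le> g x"
  obtains c d where "0 < c" "0 < d" "\<forall>\<^sub>F x in at_top. tail x \<le> c * g x" "\<forall>\<^sub>F x in at_top. d * g x \<le> tail x"
proof -
  have \<Theta>: "tail \<in> \<Theta>[at_top](g)" using assms(1) by (rule asymp_equiv_imp_bigtheta)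
  have t: "0 \<le> tail x" for x by (simp add: tail_def)
  obtain c where "0 < c" "\<forall>\<^sub>F x in at_top. norm (tail x) \<le> c * norm (g x)"
    using bigthetaD1[OF \<Theta>] by (rule landau_o.bigE)
  moreover obtain d where "0 < d" "\<forall>\<^sub>F x in at_top. norm (tail x) \<ge> d * norm (g x)"
    using bigthetaD2[OF \<Theta>] by (rule landau_omega.bigE)
  ultimately show thesis using assms(2) t by (intro that[of c d]) auto
qed

text \<open>In the relevant range \<open>y \<le> \<Psi>(k) + 1\<close> the argument \<open>\<kappa> k / y\<close> of the tail tends to infinity uniformly,
  so the assumed tail asymptotics apply.\<close>
lemma scaled_index_large:
  fixes \<Psi> :: "real \<Rightarrow> real"
  assumes "((\<lambda>x. \<Psi> x / x) \<longlongrightarrow> 0) at_top" "\<forall>\<^sub>F x in at_top. P x"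
  shows "\<forall>\<^sub>F k in sequentially. \<forall>y\<in>{1..nat \<lceil>\<Psi> (real k)\<rceil>}. P (\<kappa> * k / y)"
proof -
  obtain X where X: "\<And>x. X \<le> x \<Longrightarrow> P x" using assms(2) by (auto simp: eventually_at_top_linorder)
  define X' where "X' = max X 1"
  have X': "1 \<le> X'" "\<And>x. X' \<le> x \<Longrightarrow> P x" using X by (auto simp: X'_def)
  have e: "0 < \<kappa> / (2 * X')" using kappa_range X' by simp
  have "(\<lambda>k. \<Psi> (real k) / real k) \<longlonglongrightarrow> 0"
    using assms(1) filterlim_real_sequentially by (rule filterlim_compose)
  then have "\<forall>\<^sub>F k in sequentially. \<Psi> (real k) / real k < \<kappa> / (2 * X')"
    using e by (rule order_tendstoD)
  moreover have "\<forall>\<^sub>F k in sequentially. 1 \<le> \<kappa> / (2 * X') * real k"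
    using e by real_asymp
  ultimately show ?thesis using eventually_ge_at_top[of 1]
  proof eventually_elim
    case (elim k)
    show ?case
    proof
      fix y assume y: "y \<in> {1..nat \<lceil>\<Psi> (real k)\<rceil>}"
      then have "real y \<le> \<Psi> k + 1" by simp linarith
      moreover have "\<Psi> k \<le> \<kappa> / (2 * X') * k" using elim by (simp add: pos_divide_less_eq less_imp_le)
      ultimately have "real y \<le> \<kappa> / (2 * X') * k + \<kappa> / (2 * X') * k" using elim(2) by linarith
      also have "\<dots> = \<kappa> * k / X'" by simp
      finally have "X' \<le> \<kappa> * k / y" using y X' by (simp add: pos_le_divide_eq mult.commute)
      then show "P (\<kappa> * k / y)" by (rule X'(2))
    qed
  qed
qed

text \<open>With \<open>y = \<kappa> k / x\<close> and \<open>A = \<kappa> k / c\<^sub>1\<close> the total cost is \<open>y + (A / y)\<^bsup>\<tau>\<^esup>\<close>, whose minimum is \<open>\<Psi>(k) = D k\<^bsup>1-\<gamma>\<^esup>\<close>,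
  attained at \<open>y = \<eta> k\<^bsup>1-\<gamma>\<^esup>\<close>. Factors polynomial in \<open>k\<close> are invisible on the scale \<open>k\<^bsup>1-\<gamma>\<^esup>\<close>, in particular \<open>x\<^sup>b\<close>.\<close>
theorem stretched_exponential_tail:
  fixes a c\<^sub>1 \<tau> b :: real
  assumes pos: "0 < a" "0 < c\<^sub>1" "0 < \<tau>"
    and asymp: "tail \<sim>[at_top] (\<lambda>x. a * x powr b * exp (- ((x / c\<^sub>1) powr \<tau>)))"
  defines "\<gamma> \<equiv> 1 / (1 + \<tau>)"
  shows "converges_in_probability M (centred_max (\<lambda>n. log \<theta> n) (\<lambda>n. (log \<theta> n) powr (1 - \<gamma>)))
           (- (\<tau> powr \<gamma> / ((1 - \<gamma>) * ln \<theta>)) * ((1 - 1 / \<theta>) / c\<^sub>1) powr (1 - \<gamma>))"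
proof -
  let ?g = "\<lambda>x. a * x powr b * exp (- ((x / c\<^sub>1) powr \<tau>))"
  have \<gamma>: "0 < \<gamma>" "\<gamma> < 1" "\<gamma> * \<tau> = 1 - \<gamma>" "1 + 1 / \<tau> = 1 / (1 - \<gamma>)"
    using pos by (auto simp: \<gamma>_def field_simps)
  have \<kappa>: "0 < \<kappa>" by (rule kappa_range)
  have l\<theta>: "0 < ln \<theta>" using theta_range by simp
  define \<eta> where "\<eta> = \<tau> powr \<gamma> * (\<kappa> / c\<^sub>1) powr (1 - \<gamma>)"
  define D where "D = \<eta> / (1 - \<gamma>)"
  have \<eta>: "0 < \<eta>" "0 < D" using pos \<kappa> \<gamma> by (simp_all add: \<eta>_def D_def)
  define \<sigma> where "\<sigma> x = x powr (1 - \<gamma>)" for x :: real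
  define \<Psi> where "\<Psi> x = D * \<sigma> x" for x
  obtain c d where cd: "0 < c" "0 < d" "\<forall>\<^sub>F x in at_top. tail x \<le> c * ?g x" "\<forall>\<^sub>F x in at_top. d * ?g x \<le> tail x"
    using tail_comparable[OF asymp] pos by auto
  have optimum: "(\<tau> * (\<kappa> * k / c\<^sub>1) powr \<tau>) powr (1 / (1 + \<tau>)) = \<eta> * k powr (1 - \<gamma>)" if "0 < k" for k
  proof -
    have "(\<tau> * (\<kappa> * k / c\<^sub>1) powr \<tau>) powr \<gamma> = \<tau> powr \<gamma> * (\<kappa> / c\<^sub>1 * k) powr (\<gamma> * \<tau>)"
      using pos by (simp add: powr_mult powr_powr mult.commute)
    also have "\<dots> = \<eta> * k powr (1 - \<gamma>)"
      unfolding \<gamma>(3) \<eta>_def mult.assoc powr_mult[of "\<kappa> / c\<^sub>1" k "1 - \<gamma>", symmetric] ..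
    finally show ?thesis by (simp add: \<gamma>_def)
  qed
  have opt_le: "\<Psi> k \<le> y + (\<kappa> * k / y / c\<^sub>1) powr \<tau>" if "0 < k" "0 < y" for k y
  proof -
    have "0 < \<kappa> * k / c\<^sub>1" using that \<kappa> pos by simp
    from weighted_sum_minimum(2)[OF this pos(3) that(2), unfolded optimum[OF that(1)] \<gamma>(4)]
    show ?thesis by (simp add: \<Psi>_def D_def \<sigma>_def mult.commute)
  qed
  have opt_eq: "\<eta> * k powr (1 - \<gamma>) + (\<kappa> * k / (\<eta> * k powr (1 - \<gamma>)) / c\<^sub>1) powr \<tau> = \<Psi> k" if "0 < k" for k
  proof -
    have "0 < \<kappa> * k / c\<^sub>1" using that \<kappa> pos by simp
    from weighted_sum_minimum(1)[OF this pos(3), unfolded optimum[OF that] \<gamma>(4)]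
    show ?thesis by (simp add: \<Psi>_def D_def \<sigma>_def mult.commute)
  qed
  have small: "((\<lambda>x. \<sigma> x / x) \<longlongrightarrow> 0) at_top" "((\<lambda>x. \<Psi> x / x) \<longlongrightarrow> 0) at_top"
    unfolding \<Psi>_def \<sigma>_def using \<gamma>(1,2) by real_asymp+
  have top: "filterlim \<sigma> at_top at_top"
    unfolding \<sigma>_def using \<gamma>(1,2) by real_asymp
  have "converges_in_probability M (centred_max (\<lambda>n. log \<theta> n) (\<lambda>n. \<sigma> (log \<theta> n))) (- (D / ln \<theta>))"
  proof (rule tail_rate.centred_max_converges[OF tail_rate.intro[OF bounded_weights_tree_axioms tail_rate_axioms.intro[OF _ _ top small]]])
    fix \<epsilon> :: real assume \<epsilon>: "0 < \<epsilon>"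
    show "\<forall>\<^sub>F k in sequentially. (\<integral>w. geometric_ratio w ^ k \<partial>\<nu>) \<le> exp (- (real k * ln \<theta>) - \<Psi> k + \<epsilon> * \<sigma> k)"
    proof (rule moment_upper_bound)
      have "\<forall>\<^sub>F x in at_top. 1 \<le> x \<and> tail x \<le> c * ?g x"
        using cd(3) eventually_ge_at_top[of 1] by eventually_elim simp
      from scaled_index_large[OF small(2) this] eventually_ge_at_top[of 1]
      show "\<forall>\<^sub>F k in sequentially. \<forall>y\<in>{1..nat \<lceil>\<Psi> (real k)\<rceil>}. tail (\<kappa> * k / y) \<le> (c * a * (\<kappa> * k) powr \<bar>b\<bar>) * exp (y - \<Psi> k)"
      proof eventually_elim
        case (elim k)
        show ?case
        proof
          fix y assume y: "y \<in> {1..nat \<lceil>\<Psi> (real k)\<rceil>}"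
          define x where "x = \<kappa> * k / y"
          have x: "1 \<le> x" "tail x \<le> c * ?g x" using elim y by (auto simp: x_def)
          have y1: "1 \<le> real y" using y by simp
          have "\<kappa> * k / y \<le> \<kappa> * k / 1" using y1 \<kappa> by (intro divide_left_mono) auto
          then have "x \<le> \<kappa> * k" by (simp add: x_def)
          have "x powr b \<le> x powr \<bar>b\<bar>" using x by (intro powr_mono) auto
          also have "\<dots> \<le> (\<kappa> * k) powr \<bar>b\<bar>" using x \<open>x \<le> \<kappa> * k\<close> by (intro powr_mono2) auto
          finally have xb: "x powr b \<le> (\<kappa> * k) powr \<bar>b\<bar>" .
          have "- ((x / c\<^sub>1) powr \<tau>) \<le> y - \<Psi> k"
            using opt_le[of k y] y1 elim(2) by (simp add: x_def)
          then have "exp (- ((x / c\<^sub>1) powr \<tau>)) \<le> exp (y - \<Psi> k)" by simp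
          then have "x powr b * exp (- ((x / c\<^sub>1) powr \<tau>)) \<le> (\<kappa> * k) powr \<bar>b\<bar> * exp (y - \<Psi> k)"
            using xb by (intro mult_mono) auto
          then have "c * a * (x powr b * exp (- ((x / c\<^sub>1) powr \<tau>))) \<le> c * a * ((\<kappa> * k) powr \<bar>b\<bar> * exp (y - \<Psi> k))"
            using cd pos by (intro mult_left_mono) auto
          then show "tail (\<kappa> * k / y) \<le> (c * a * (\<kappa> * k) powr \<bar>b\<bar>) * exp (y - \<Psi> k)"
            unfolding x_def[symmetric] using x(2) by (simp add: mult_ac)
        qed
      qed
      show "\<forall>\<^sub>F k in sequentially. 0 \<le> c * a * (\<kappa> * real k) powr \<bar>b\<bar> \<and> 0 \<le> \<Psi> (real k)"
        using cd pos \<eta> by (simp add: \<Psi>_def \<sigma>_def)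
      have "0 < c * a" "0 < 1 - \<gamma>" using cd pos \<gamma> by auto
      then show "\<forall>\<^sub>F k in sequentially. exp 1 * (\<Psi> k + 1) * (c * a * (\<kappa> * real k) powr \<bar>b\<bar>) + 1 \<le> exp (\<epsilon> * \<sigma> (real k))"
        unfolding \<Psi>_def \<sigma>_def using \<eta>(2) \<kappa> \<epsilon> abs_ge_zero[of b] by real_asymp
    qed
    define x where "x k = \<kappa> / \<eta> * k powr \<gamma>" for k :: real
    have \<xi>: "0 < \<kappa> / \<eta>" using \<kappa> \<eta> by simp
    show "\<exists>v :: nat \<Rightarrow> real. v \<longlonglongrightarrow> 0 \<and> (\<forall>\<^sub>F k in sequentially. v k \<in> {0<..<1} \<and>
        exp (- (real k * ln \<theta>) - \<Psi> k - \<epsilon> * \<sigma> k) \<le> measure \<nu> {1 - v k<..} * geometric_ratio (1 - v k) ^ k)"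
    proof (rule moment_lower_bound)
      show xtop: "filterlim (\<lambda>k. x (real k)) at_top sequentially"
        unfolding x_def using \<xi> \<gamma>(1) by real_asymp
      have "\<forall>\<^sub>F k in sequentially. 3 * k / (x (real k))\<^sup>2 \<le> \<epsilon> / 2 * \<sigma> (real k)"
      proof -
        have "\<forall>\<^sub>F k in sequentially. 3 / (\<kappa> / \<eta>)\<^sup>2 \<le> \<epsilon> / 2 * real k powr \<gamma>"
          using \<epsilon> \<gamma>(1) by real_asymp
        then show ?thesis using eventually_ge_at_top[of 1]
        proof eventually_elim
          case (elim k)
          have k0: "0 < real k" using elim by simp
          have "3 * k / (x (real k))\<^sup>2 = 3 / (\<kappa> / \<eta>)\<^sup>2 * (k / (k powr \<gamma>)\<^sup>2)"
            unfolding x_def power_mult_distrib by simp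
          also have "\<dots> \<le> \<epsilon> / 2 * real k powr \<gamma> * (k / (k powr \<gamma>)\<^sup>2)"
            using elim by (intro mult_right_mono) auto
          also have "\<dots> = \<epsilon> / 2 * (k / k powr \<gamma>)" using k0 by (simp add: power2_eq_square)
          also have "k / k powr \<gamma> = \<sigma> k" using k0 by (simp add: \<sigma>_def powr_diff)
          finally show ?case .
        qed
      qed
      moreover have "\<forall>\<^sub>F k in sequentially. - ln (d * a) - b * (ln (\<kappa> / \<eta>) + \<gamma> * ln (real k)) \<le> \<epsilon> / 2 * \<sigma> (real k)"
        unfolding \<sigma>_def using \<epsilon> \<gamma>(1,2) by real_asymp
      moreover have "\<forall>\<^sub>F k in sequentially. d * ?g (x (real k)) \<le> tail (x (real k))"
        using cd(4) xtop by (rule eventually_compose_filterlim)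
      ultimately show "\<forall>\<^sub>F k in sequentially. exp (- \<Psi> (real k) - \<epsilon> * \<sigma> (real k) + \<kappa> * k / x k + 3 * k / (x k)\<^sup>2) \<le> tail (x k)"
        using eventually_ge_at_top[of 1]
      proof eventually_elim
        case (elim k)
        have k0: "0 < real k" using elim by simp
        have x0: "0 < x k" using \<kappa> \<eta> k0 by (simp add: x_def)
        have pk: "real k = k powr \<gamma> * k powr (1 - \<gamma>)" using k0 by (simp flip: powr_add)
        have kx: "\<kappa> * k / x k = \<eta> * k powr (1 - \<gamma>)"
          using k0 \<kappa> \<eta> by (subst pk) (simp add: x_def)
        have xk: "x k = \<kappa> * k / (\<eta> * k powr (1 - \<gamma>))"
          using k0 \<kappa> \<eta> by (subst (2) pk) (simp add: x_def)
        have "ln (x k) = ln (\<kappa> / \<eta>) + \<gamma> * ln k"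
          unfolding x_def using \<kappa> \<eta> k0 by (subst ln_mult) (auto simp: ln_powr)
        then have "d * ?g (x k) = exp (ln (d * a) + b * (ln (\<kappa> / \<eta>) + \<gamma> * ln k) - (x k / c\<^sub>1) powr \<tau>)"
          using cd pos x0 by (simp add: exp_add exp_diff exp_minus powr_def divide_inverse)
        moreover have "- \<Psi> k - \<epsilon> * \<sigma> k + \<kappa> * k / x k + 3 * k / (x k)\<^sup>2
            \<le> ln (d * a) + b * (ln (\<kappa> / \<eta>) + \<gamma> * ln k) - (x k / c\<^sub>1) powr \<tau>"
          using opt_eq[OF k0] elim(1,2) unfolding kx xk[symmetric] by simp
        ultimately show ?case using elim(3) by (smt (verit) exp_le_cancel_iff)
      qed
    qed
  next
    fix f L :: "nat \<Rightarrow> real" assume L: "filterlim L at_top sequentially" "(\<lambda>n. f n / L n) \<longlonglongrightarrow> 1"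
    have L0: "\<forall>\<^sub>F n in sequentially. 0 < L n" using L(1) by (simp add: filterlim_at_top_dense)
    have "(\<lambda>n. (f n / L n) powr (1 - \<gamma>)) \<longlonglongrightarrow> 1 powr (1 - \<gamma>)"
      by (intro tendsto_intros L) auto
    then have R: "(\<lambda>n. (f n / L n) powr (1 - \<gamma>)) \<longlonglongrightarrow> 1" by simp
    have f0: "\<forall>\<^sub>F n in sequentially. 0 < f n / L n" using L(2) by (rule order_tendstoD) simp
    have eq: "\<forall>\<^sub>F n in sequentially. 0 < \<sigma> (L n) \<and> (f n / L n) powr (1 - \<gamma>) = \<sigma> (f n) / \<sigma> (L n)"
      using L0 f0 by eventually_elim (simp add: \<sigma>_def powr_divide zero_less_divide_iff)
    then have 1: "(\<lambda>n. \<sigma> (f n) / \<sigma> (L n)) \<longlonglongrightarrow> 1"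
      by (intro Lim_transform_eventually[OF R]) (auto elim: eventually_mono)
    have "(\<lambda>n. D * (\<sigma> (f n) / \<sigma> (L n) - 1)) \<longlonglongrightarrow> D * (1 - 1)" by (intro tendsto_intros 1)
    moreover have "\<forall>\<^sub>F n in sequentially. D * (\<sigma> (f n) / \<sigma> (L n) - 1) = (\<Psi> (f n) - \<Psi> (L n)) / \<sigma> (L n)"
      using eq by eventually_elim (simp add: \<Psi>_def field_simps)
    ultimately have "(\<lambda>n. (\<Psi> (f n) - \<Psi> (L n)) / \<sigma> (L n)) \<longlonglongrightarrow> D * (1 - 1)"
      by (rule Lim_transform_eventually)
    with 1 show "(\<lambda>n. (\<Psi> (f n) - \<Psi> (L n)) / \<sigma> (L n)) \<longlonglongrightarrow> 0 \<and> (\<lambda>n. \<sigma> (f n) / \<sigma> (L n)) \<longlonglongrightarrow> 1" by simp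
  next
    have "filterlim (\<lambda>n. log \<theta> (real n)) at_top sequentially" using theta_range by real_asymp
    then have "\<forall>\<^sub>F n in sequentially. 0 < log \<theta> (real n)" by (simp add: filterlim_at_top_dense)
    then have "\<forall>\<^sub>F n in sequentially. D / ln \<theta> =
        (log \<theta> (real n) - (log \<theta> (real n) - \<Psi> (log \<theta> (real n)) / ln \<theta>)) / \<sigma> (log \<theta> (real n))"
      by eventually_elim (simp add: \<Psi>_def \<sigma>_def)
    then show "(\<lambda>n. (log \<theta> (real n) - (log \<theta> (real n) - \<Psi> (log \<theta> (real n)) / ln \<theta>)) / \<sigma> (log \<theta> (real n))) \<longlonglongrightarrow> - (- (D / ln \<theta>))"
      by (intro Lim_transform_eventually[OF tendsto_const]) simp
  qed
  then show ?thesis by (simp add: D_def \<eta>_def \<sigma>_def \<kappa>_def)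
qed

section \<open>Stretched exponential tails on the logarithmic scale\<close>

text \<open>With \<open>c = c\<^sub>1\<^bsup>-\<tau>\<^esup>\<close>, \<open>t = ln (\<kappa> k)\<close> and \<open>y = \<kappa> k / x\<close> the total cost is \<open>y + c (t - ln y)\<^bsup>\<tau>\<^esup>\<close>. By convexity it is at
  least \<open>y + c t\<^bsup>\<tau>\<^esup> - B ln y\<close> with \<open>B = \<tau> c t\<^bsup>\<tau>-1\<^esup>\<close>, and the minimum of \<open>y - B ln y\<close> is \<open>B - B ln B\<close>, attained at
  \<open>y = B\<close>. The resulting \<open>Q t = c t\<^bsup>\<tau>\<^esup> + B - B ln B\<close> is not the exact minimum of the cost, but at \<open>y = B\<close> the cost exceeds
  it by \<open>o(t\<^bsup>\<tau>-1\<^esup>)\<close> only. Expanding \<open>Q (ln \<kappa> + ln L)\<close> in \<open>ln L\<close> produces the constants \<open>C\<^sub>1\<close>, \<open>C\<^sub>2\<close> and \<open>C\<^sub>3\<close>.\<close>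
theorem log_stretched_exponential_tail:
  fixes a c\<^sub>1 \<tau> b :: real
  assumes pos: "0 < a" "0 < c\<^sub>1" and \<tau>: "1 < \<tau>"
    and asymp: "tail \<sim>[at_top] (\<lambda>x. a * (ln x) powr b * exp (- ((ln x / c\<^sub>1) powr \<tau>)))"
  defines "C\<^sub>1 \<equiv> (ln \<theta>) powr (\<tau> - 1) * c\<^sub>1 powr (- \<tau>)"
    and "C\<^sub>2 \<equiv> (ln \<theta>) powr (\<tau> - 1) * \<tau> * (\<tau> - 1) * c\<^sub>1 powr (- \<tau>)"
    and "C\<^sub>3 \<equiv> (log \<theta> (ln \<theta>) * (\<tau> - 1) * ln \<theta> - ln (exp 1 * c\<^sub>1 powr \<tau> * (1 - 1 / \<theta>) / \<tau>))
                  * (ln \<theta>) powr (\<tau> - 2) * \<tau> * c\<^sub>1 powr (- \<tau>)"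
  shows "converges_in_probability M
          (centred_max
            (\<lambda>n. log \<theta> n - C\<^sub>1 * (log \<theta> (log \<theta> n)) powr \<tau>
               + C\<^sub>2 * (log \<theta> (log \<theta> n)) powr (\<tau> - 1) * log \<theta> (log \<theta> (log \<theta> n)))
            (\<lambda>n. (log \<theta> (log \<theta> n)) powr (\<tau> - 1)))
          C\<^sub>3"
proof -
  let ?g = "\<lambda>x. a * (ln x) powr b * exp (- ((ln x / c\<^sub>1) powr \<tau>))"
  have \<kappa>: "0 < \<kappa>" by (rule kappa_range)
  define \<beta> where "\<beta> = ln \<theta>"
  have \<beta>: "0 < \<beta>" using theta_range by (simp add: \<beta>_def)
  define c where "c = c\<^sub>1 powr (- \<tau>)"
  have c: "0 < c" using pos by (simp add: c_def)
  define m where "m = ln \<kappa>"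
  define C where "C = 1 - ln (\<tau> * c)"
  define Q where "Q t = c * (t powr \<tau> + \<tau> * t powr (\<tau> - 1) * (C - (\<tau> - 1) * ln t))" for t
  define \<Psi> where "\<Psi> x = Q (m + ln x)" for x
  define \<sigma> where "\<sigma> x = (ln x / \<beta>) powr (\<tau> - 1)" for x
  define B where "B t = \<tau> * c * t powr (\<tau> - 1)" for t
  define u where "u t = (1 - C) + (\<tau> - 1) * ln t" for t
  have B_u: "0 < B t" "ln (B t) = u t" if "0 < t" for t
    using that \<tau> c by (simp_all add: B_def u_def C_def ln_mult ln_powr)
  have Q_B: "Q t = c * t powr \<tau> + B t - B t * u t" for t
    by (simp add: Q_def B_def u_def algebra_simps)
  have lnk: "m + ln x = ln (\<kappa> * x)" if "0 < x" for x
    using that \<kappa> by (simp add: m_def ln_mult)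
  have g_eq: "(z / c\<^sub>1) powr \<tau> = c * z powr \<tau>" for z
    by (simp only: powr_divide c_def powr_minus) (simp add: divide_inverse)
  obtain K d where Kd: "0 < K" "0 < d" "\<forall>\<^sub>F x in at_top. tail x \<le> K * ?g x" "\<forall>\<^sub>F x in at_top. d * ?g x \<le> tail x"
    using tail_comparable[OF asymp] pos by auto
  have Q_bounds: "\<forall>\<^sub>F t in at_top. 0 \<le> Q t \<and> Q t \<le> 2 * c * t powr \<tau>"
    unfolding Q_def using c \<tau> by (intro eventually_conj; real_asymp)
  have shift: "filterlim (\<lambda>x. m + ln x) at_top at_top" by real_asymp
  have shift_k: "filterlim (\<lambda>k. m + ln (real k)) at_top sequentially" by real_asymp
  have ln_k: "filterlim (\<lambda>k. ln (real k)) at_top sequentially" by real_asymp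
  have small_\<sigma>: "((\<lambda>x. \<sigma> x / x) \<longlongrightarrow> 0) at_top"
    unfolding \<sigma>_def using \<beta> \<tau> by real_asymp
  have top: "filterlim \<sigma> at_top at_top"
    unfolding \<sigma>_def using \<beta> \<tau> by real_asymp
  have small_\<Psi>: "((\<lambda>x. \<Psi> x / x) \<longlongrightarrow> 0) at_top"
  proof (rule tendsto_sandwich[OF _ _ tendsto_const])
    show "((\<lambda>x. 2 * c * (m + ln x) powr \<tau> / x) \<longlongrightarrow> 0) at_top"
      using \<tau> c by real_asymp
    have "\<forall>\<^sub>F x in at_top. 0 \<le> \<Psi> x \<and> \<Psi> x \<le> 2 * c * (m + ln x) powr \<tau>"
      unfolding \<Psi>_def using Q_bounds shift by (rule eventually_compose_filterlim)
    then have *: "\<forall>\<^sub>F x in at_top. 0 < x \<and> 0 \<le> \<Psi> x \<and> \<Psi> x \<le> 2 * c * (m + ln x) powr \<tau>"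
      using eventually_gt_at_top[of 0] by eventually_elim simp
    then show "\<forall>\<^sub>F x in at_top. 0 \<le> \<Psi> x / x" by eventually_elim simp
    from * show "\<forall>\<^sub>F x in at_top. \<Psi> x / x \<le> 2 * c * (m + ln x) powr \<tau> / x"
      by eventually_elim (simp add: divide_right_mono)
  qed
  have main: "converges_in_probability M (centred_max (\<lambda>n. log \<theta> n - C\<^sub>1 * (log \<theta> (log \<theta> n)) powr \<tau>
               + C\<^sub>2 * (log \<theta> (log \<theta> n)) powr (\<tau> - 1) * log \<theta> (log \<theta> (log \<theta> n))) (\<lambda>n. \<sigma> (log \<theta> n))) C\<^sub>3"
  proof (rule tail_rate.centred_max_converges[OF tail_rate.intro[OF bounded_weights_tree_axioms tail_rate_axioms.intro[OF _ _ top small_\<sigma> small_\<Psi>]]])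
    fix \<epsilon> :: real assume \<epsilon>: "0 < \<epsilon>"
    show "\<forall>\<^sub>F k in sequentially. (\<integral>w. geometric_ratio w ^ k \<partial>\<nu>) \<le> exp (- (real k * ln \<theta>) - \<Psi> k + \<epsilon> * \<sigma> k)"
    proof (rule moment_upper_bound)
      have "\<forall>\<^sub>F x in at_top. exp 1 \<le> x \<and> tail x \<le> K * ?g x"
        using Kd(3) eventually_ge_at_top[of "exp 1"] by eventually_elim simp
      from scaled_index_large[OF small_\<Psi> this] eventually_ge_at_top[of 1]
      show "\<forall>\<^sub>F k in sequentially. \<forall>y\<in>{1..nat \<lceil>\<Psi> (real k)\<rceil>}. tail (\<kappa> * k / y) \<le> (K * a * (m + ln k) powr \<bar>b\<bar>) * exp (y - \<Psi> k)"
      proof eventually_elim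
        case (elim k)
        show ?case
        proof
          fix y assume y: "y \<in> {1..nat \<lceil>\<Psi> (real k)\<rceil>}"
          define x where "x = \<kappa> * k / y"
          define t where "t = m + ln k"
          have k0: "0 < real k" and y1: "1 \<le> real y" using elim(2) y by auto
          have x: "exp 1 \<le> x" "tail x \<le> K * ?g x" using elim(1) y unfolding x_def by blast+
          have x0: "0 < x" using x(1) exp_gt_zero[of "1::real"] by linarith
          have t_eq: "t = ln (\<kappa> * k)" using lnk[OF k0] by (simp add: t_def)
          have lx: "ln x = t - ln y" unfolding t_eq x_def using \<kappa> k0 y1 by (subst ln_div) auto
          have lx1: "1 \<le> ln x" using x(1) x0 by (simp add: ln_ge_iff)
          have ly: "0 \<le> ln (real y)" using y1 by simp
          have t0: "0 < t" using lx lx1 ly by linarith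
          have "ln x powr b \<le> ln x powr \<bar>b\<bar>" using lx1 by (intro powr_mono) auto
          also have "\<dots> \<le> t powr \<bar>b\<bar>" using lx lx1 ly by (intro powr_mono2) auto
          finally have xb: "ln x powr b \<le> t powr \<bar>b\<bar>" .
          have "t powr \<tau> + \<tau> * t powr (\<tau> - 1) * (ln x - t) \<le> ln x powr \<tau>"
            using powr_above_tangent[of "ln x" t \<tau>] lx1 t0 \<tau> by simp
          then have "c * (t powr \<tau> + \<tau> * t powr (\<tau> - 1) * (ln x - t)) \<le> c * ln x powr \<tau>"
            using c by (intro mult_left_mono) auto
          then have "c * t powr \<tau> - B t * ln y \<le> c * ln x powr \<tau>"
            by (simp add: B_def lx algebra_simps)
          moreover have "B t - B t * u t \<le> y - B t * ln y"
            using linear_minus_log_minimum[of y "B t"] y1 B_u[OF t0] by simp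
          ultimately have "- (c * ln x powr \<tau>) \<le> y - \<Psi> k"
            by (simp add: \<Psi>_def Q_B flip: t_def)
          then have "exp (- ((ln x / c\<^sub>1) powr \<tau>)) \<le> exp (y - \<Psi> k)" by (simp add: g_eq)
          then have "ln x powr b * exp (- ((ln x / c\<^sub>1) powr \<tau>)) \<le> t powr \<bar>b\<bar> * exp (y - \<Psi> k)"
            using xb by (intro mult_mono) auto
          then have "K * a * (ln x powr b * exp (- ((ln x / c\<^sub>1) powr \<tau>))) \<le> K * a * (t powr \<bar>b\<bar> * exp (y - \<Psi> k))"
            using Kd pos by (intro mult_left_mono) auto
          then show "tail (\<kappa> * k / y) \<le> (K * a * (m + ln k) powr \<bar>b\<bar>) * exp (y - \<Psi> k)"
            unfolding x_def[symmetric] t_def[symmetric] using x(2) by (simp add: mult_ac)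
        qed
      qed
      have Q_k: "\<forall>\<^sub>F k in sequentially. 0 \<le> \<Psi> (real k) \<and> \<Psi> (real k) \<le> 2 * c * (m + ln (real k)) powr \<tau>"
        unfolding \<Psi>_def using Q_bounds shift_k by (rule eventually_compose_filterlim)
      then show "\<forall>\<^sub>F k in sequentially. 0 \<le> K * a * (m + ln (real k)) powr \<bar>b\<bar> \<and> 0 \<le> \<Psi> (real k)"
        by eventually_elim (use Kd pos in simp)
      have "0 < K * a" using Kd pos by simp
      then have "\<forall>\<^sub>F s in at_top. exp 1 * (2 * c * (m + s) powr \<tau> + 1) * (K * a * (m + s) powr \<bar>b\<bar>) + 1 \<le> exp (\<epsilon> * (s / \<beta>) powr (\<tau> - 1))"
        using c \<tau> \<beta> \<epsilon> abs_ge_zero[of b] by real_asymp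
      then have "\<forall>\<^sub>F k in sequentially. exp 1 * (2 * c * (m + ln (real k)) powr \<tau> + 1) * (K * a * (m + ln (real k)) powr \<bar>b\<bar>) + 1
           \<le> exp (\<epsilon> * (ln (real k) / \<beta>) powr (\<tau> - 1))"
        using ln_k by (rule eventually_compose_filterlim)
      then show "\<forall>\<^sub>F k in sequentially. exp 1 * (\<Psi> k + 1) * (K * a * (m + ln (real k)) powr \<bar>b\<bar>) + 1 \<le> exp (\<epsilon> * \<sigma> (real k))"
        using Q_k
      proof eventually_elim
        case (elim k)
        have "exp 1 * (\<Psi> k + 1) * (K * a * (m + ln (real k)) powr \<bar>b\<bar>)
            \<le> exp 1 * (2 * c * (m + ln (real k)) powr \<tau> + 1) * (K * a * (m + ln (real k)) powr \<bar>b\<bar>)"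
          using elim(2) Kd pos by (intro mult_right_mono mult_left_mono) auto
        then show ?case using elim(1) unfolding \<sigma>_def by linarith
      qed
    qed
    define x where "x k = \<kappa> * k / B (m + ln k)" for k :: real
    show "\<exists>v :: nat \<Rightarrow> real. v \<longlonglongrightarrow> 0 \<and> (\<forall>\<^sub>F k in sequentially. v k \<in> {0<..<1} \<and>
        exp (- (real k * ln \<theta>) - \<Psi> k - \<epsilon> * \<sigma> k) \<le> measure \<nu> {1 - v k<..} * geometric_ratio (1 - v k) ^ k)"
    proof (rule moment_lower_bound)
      have x_eq: "x (real k) = exp (m + ln k) / B (m + ln k)" if "1 \<le> k" for k :: nat
        using that \<kappa> by (simp add: x_def exp_add m_def)
      have "filterlim (\<lambda>t. exp t / B t) at_top at_top"
        unfolding B_def using \<tau> c by real_asymp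
      then have "filterlim (\<lambda>k. exp (m + ln (real k)) / B (m + ln (real k))) at_top sequentially"
        using shift_k by (rule filterlim_compose)
      moreover have "\<forall>\<^sub>F k in sequentially. exp (m + ln (real k)) / B (m + ln (real k)) = x (real k)"
        using eventually_ge_at_top[of 1] by eventually_elim (simp add: x_eq)
      ultimately show xtop: "filterlim (\<lambda>k. x (real k)) at_top sequentially"
        by (simp cong: filterlim_cong)
      \<comment> \<open>The first term of \<open>h\<close> bounds the convexity gap at \<open>y = B t\<close>, by a second tangent, taken at \<open>t - u t\<close>.\<close>
      define h where "h t = c * \<tau> * u t * (t powr (\<tau> - 1) - (t - u t) powr (\<tau> - 1))
          + 3 * (B t)\<^sup>2 / (\<kappa> * exp t) - ln (d * a) - b * ln (t - u t)" for t
      have "\<forall>\<^sub>F t in at_top. h t \<le> \<epsilon> * ((t - m) / \<beta>) powr (\<tau> - 1) \<and> 1 \<le> t \<and> 1 \<le> t - u t"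
        unfolding h_def u_def B_def using c \<tau> \<beta> \<epsilon> \<kappa> by (intro eventually_conj; real_asymp)
      from eventually_compose_filterlim[OF this shift_k] eventually_compose_filterlim[OF Kd(4) xtop]
        eventually_ge_at_top[of 1]
      show "\<forall>\<^sub>F k in sequentially. exp (- \<Psi> (real k) - \<epsilon> * \<sigma> (real k) + \<kappa> * k / x k + 3 * k / (x k)\<^sup>2) \<le> tail (x k)"
      proof eventually_elim
        case (elim k)
        define t where "t = m + ln k"
        have k0: "0 < real k" using elim by simp
        have h: "h t \<le> \<epsilon> * \<sigma> k" "1 \<le> t" "1 \<le> t - u t"
          using elim(1) by (simp_all add: t_def \<sigma>_def)
        have Bt: "0 < B t" "ln (B t) = u t" using B_u[of t] h by auto
        have et: "exp t = \<kappa> * k" using k0 \<kappa> by (simp add: t_def exp_add m_def)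
        have xk: "x k = exp t / B t" using x_eq[of k] elim by (simp add: t_def)
        have x0: "0 < x k" using Bt by (simp add: xk)
        have lnx: "ln (x k) = t - u t" unfolding xk using Bt by (subst ln_div) auto
        have kx: "\<kappa> * k / x k = B t" unfolding xk et[symmetric] by simp
        have k2: "3 * k / (x k)\<^sup>2 = 3 * (B t)\<^sup>2 / (\<kappa> * exp t)"
          unfolding xk et using k0 \<kappa> Bt by (simp add: power2_eq_square field_simps)
        have "d * ?g (x k) = exp (ln (d * a) + b * ln (t - u t) - c * (t - u t) powr \<tau>)"
          unfolding lnx g_eq using Kd pos h by (simp add: exp_add exp_diff exp_minus powr_def divide_inverse)
        moreover have "- \<Psi> k - \<epsilon> * \<sigma> k + B t + 3 * (B t)\<^sup>2 / (\<kappa> * exp t)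
            \<le> ln (d * a) + b * ln (t - u t) - c * (t - u t) powr \<tau>"
        proof -
          have "(t - u t) powr \<tau> + \<tau> * (t - u t) powr (\<tau> - 1) * u t \<le> t powr \<tau>"
            using powr_above_tangent[of t "t - u t" \<tau>] h \<tau> by simp
          then have "c * ((t - u t) powr \<tau> + \<tau> * (t - u t) powr (\<tau> - 1) * u t) \<le> c * t powr \<tau>"
            using c by (intro mult_left_mono) auto
          moreover have "c * \<tau> * u t * (t powr (\<tau> - 1) - (t - u t) powr (\<tau> - 1))
              = B t * u t - c * (\<tau> * (t - u t) powr (\<tau> - 1) * u t)"
            by (simp add: B_def algebra_simps)
          moreover have "\<Psi> k = c * t powr \<tau> + B t - B t * u t" by (simp add: \<Psi>_def Q_B flip: t_def)
          ultimately show ?thesis using h(1) unfolding h_def distrib_left by linarith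
        qed
        ultimately show ?case using elim(2) unfolding kx k2 by (smt (verit) exp_le_cancel_iff)
      qed
    qed
  next
    fix f L :: "nat \<Rightarrow> real" assume L: "filterlim L at_top sequentially" "(\<lambda>n. f n / L n) \<longlonglongrightarrow> 1"
    define q where "q n = ln (f n / L n)" for n
    have "q \<longlonglongrightarrow> ln 1" unfolding q_def[abs_def] by (intro tendsto_intros L) auto
    then have q0: "q \<longlonglongrightarrow> 0" by simp
    have f0: "\<forall>\<^sub>F n in sequentially. 0 < f n / L n" using L(2) by (rule order_tendstoD) simp
    have L1: "\<forall>\<^sub>F n in sequentially. 1 < L n" using L(1) by (simp add: filterlim_at_top_dense)
    have lnL: "filterlim (\<lambda>n. ln (L n)) at_top sequentially"
      using ln_at_top L(1) by (rule filterlim_compose)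
    have fL: "\<forall>\<^sub>F n in sequentially. ln (f n) = ln (L n) + q n"
      using f0 L1 by eventually_elim (simp add: q_def ln_div zero_less_divide_iff)
    have "(\<lambda>n. (1 + q n / ln (L n)) powr (\<tau> - 1)) \<longlonglongrightarrow> (1 + 0) powr (\<tau> - 1)"
      by (intro tendsto_intros tendsto_divide_0[OF q0] filterlim_at_top_imp_at_infinity lnL) auto
    then have R: "(\<lambda>n. (1 + q n / ln (L n)) powr (\<tau> - 1)) \<longlonglongrightarrow> 1" by simp
    have "\<forall>\<^sub>F n in sequentially. (1 + q n / ln (L n)) powr (\<tau> - 1) = \<sigma> (f n) / \<sigma> (L n)"
      using fL L1
    proof eventually_elim
      case (elim n)
      have "0 < ln (L n)" using elim by simp
      then have "1 + q n / ln (L n) = (ln (f n) / \<beta>) / (ln (L n) / \<beta>)"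
        using elim(1) \<beta> by (simp add: field_simps)
      then show ?case by (simp only: \<sigma>_def powr_divide)
    qed
    then have 1: "(\<lambda>n. \<sigma> (f n) / \<sigma> (L n)) \<longlonglongrightarrow> 1"
      by (rule Lim_transform_eventually[OF R])
    \<comment> \<open>\<open>Q'\<close> is the derivative of \<open>Q\<close>. It is of order \<open>t\<^bsup>\<tau>-1\<^esup>\<close>, hence of the order of \<open>\<sigma>\<close>, and \<open>f / L \<longrightarrow> 1\<close> moves the argument
      of \<open>Q\<close> by \<open>o(1)\<close>.\<close>
    define Q' where "Q' v = c * (\<tau> * v powr (\<tau> - 1) + \<tau> * (\<tau> - 1) * v powr (\<tau> - 2) * (C - (\<tau> - 1) * ln v)
        - \<tau> * (\<tau> - 1) * v powr (\<tau> - 2))" for v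
    have deriv: "(Q has_real_derivative Q' v) (at v)" if "0 < v" for v
    proof -
      have "v powr (\<tau> - 1) * (1 / v) = v powr (\<tau> - 2)"
        using that by (simp add: powr_diff field_simps power2_eq_square)
      then show ?thesis
        unfolding Q_def[abs_def] using that
        by (auto intro!: derivative_eq_intros simp: Q'_def algebra_simps)
    qed
    have "((\<lambda>v. Q' v / v powr (\<tau> - 1)) \<longlongrightarrow> c * \<tau>) at_top"
      unfolding Q'_def using c \<tau> by real_asymp
    then have "\<forall>\<^sub>F v in at_top. dist (Q' v / v powr (\<tau> - 1)) (c * \<tau>) < c * \<tau>"
      using c \<tau> by (intro tendstoD) auto
    then have "\<forall>\<^sub>F v in at_top. 0 < v \<and> \<bar>Q' v\<bar> \<le> 2 * c * \<tau> * v powr (\<tau> - 1)"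
      using eventually_gt_at_top[of 0]
    proof eventually_elim
      case (elim v)
      have p: "0 < v powr (\<tau> - 1)" using elim by simp
      have "\<bar>Q' v / v powr (\<tau> - 1)\<bar> \<le> 2 * c * \<tau>" using elim(1) by (simp add: dist_real_def)
      then show ?case using p elim by (simp add: abs_divide pos_divide_le_eq)
    qed
    then obtain v\<^sub>0 where v\<^sub>0: "\<And>v. v\<^sub>0 \<le> v \<Longrightarrow> 0 < v \<and> \<bar>Q' v\<bar> \<le> 2 * c * \<tau> * v powr (\<tau> - 1)"
      by (auto simp: eventually_at_top_linorder)
    have diff: "\<bar>Q (t + e) - Q t\<bar> \<le> 2 * c * \<tau> * (t + 1) powr (\<tau> - 1) * \<bar>e\<bar>" if "v\<^sub>0 + 1 \<le> t" "\<bar>e\<bar> \<le> 1" for t e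
    proof -
      have "norm (Q (t + e) - Q t) \<le> 2 * c * \<tau> * (t + 1) powr (\<tau> - 1) * norm (t + e - t)"
      proof (rule field_differentiable_bound[where S = "{t - 1..t + 1}"])
        fix z assume z: "z \<in> {t - 1..t + 1}"
        then have z0: "0 < z" "\<bar>Q' z\<bar> \<le> 2 * c * \<tau> * z powr (\<tau> - 1)" using v\<^sub>0[of z] that by auto
        then show "(Q has_field_derivative Q' z) (at z within {t - 1..t + 1})"
          using has_field_derivative_at_within[OF deriv] by blast
        have "2 * c * \<tau> * z powr (\<tau> - 1) \<le> 2 * c * \<tau> * (t + 1) powr (\<tau> - 1)"
          using z z0 c \<tau> by (intro mult_left_mono powr_mono2) auto
        then show "norm (Q' z) \<le> 2 * c * \<tau> * (t + 1) powr (\<tau> - 1)" using z0 by simp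
      qed (use that in auto)
      then show ?thesis by simp
    qed
    have "(\<lambda>n. (\<Psi> (f n) - \<Psi> (L n)) / \<sigma> (L n)) \<longlonglongrightarrow> 0"
    proof (rule Lim_null_comparison)
      have "((\<lambda>s. (m + s + 1) powr (\<tau> - 1) / (s / \<beta>) powr (\<tau> - 1)) \<longlongrightarrow> inverse (inverse \<beta> powr (\<tau> - 1))) at_top"
        using \<tau> \<beta> by real_asymp
      then have "(\<lambda>n. (m + ln (L n) + 1) powr (\<tau> - 1) / (ln (L n) / \<beta>) powr (\<tau> - 1)) \<longlonglongrightarrow> inverse (inverse \<beta> powr (\<tau> - 1))"
        using lnL by (rule filterlim_compose)
      then have "(\<lambda>n. 2 * c * \<tau> * ((m + ln (L n) + 1) powr (\<tau> - 1) / (ln (L n) / \<beta>) powr (\<tau> - 1)) * \<bar>q n\<bar>)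
           \<longlonglongrightarrow> 2 * c * \<tau> * inverse (inverse \<beta> powr (\<tau> - 1)) * \<bar>0\<bar>"
        by (intro tendsto_intros q0)
      then show "(\<lambda>n. 2 * c * \<tau> * ((m + ln (L n) + 1) powr (\<tau> - 1) / (ln (L n) / \<beta>) powr (\<tau> - 1)) * \<bar>q n\<bar>) \<longlonglongrightarrow> 0"
        by simp
      have "\<forall>\<^sub>F n in sequentially. v\<^sub>0 + 1 - m \<le> ln (L n)" using lnL by (simp add: filterlim_at_top)
      moreover have "\<forall>\<^sub>F n in sequentially. dist (q n) 0 < 1" using q0 by (rule tendstoD) simp
      ultimately show "\<forall>\<^sub>F n in sequentially. norm ((\<Psi> (f n) - \<Psi> (L n)) / \<sigma> (L n))
          \<le> 2 * c * \<tau> * ((m + ln (L n) + 1) powr (\<tau> - 1) / (ln (L n) / \<beta>) powr (\<tau> - 1)) * \<bar>q n\<bar>"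
        using fL
      proof eventually_elim
        case (elim n)
        have "\<bar>Q (m + ln (L n) + q n) - Q (m + ln (L n))\<bar> \<le> 2 * c * \<tau> * (m + ln (L n) + 1) powr (\<tau> - 1) * \<bar>q n\<bar>"
          using elim(1,2) by (intro diff) auto
        then have "\<bar>\<Psi> (f n) - \<Psi> (L n)\<bar> \<le> 2 * c * \<tau> * (m + ln (L n) + 1) powr (\<tau> - 1) * \<bar>q n\<bar>"
          using elim(3) by (simp add: \<Psi>_def add.assoc)
        then have "\<bar>\<Psi> (f n) - \<Psi> (L n)\<bar> / \<sigma> (L n) \<le> 2 * c * \<tau> * (m + ln (L n) + 1) powr (\<tau> - 1) * \<bar>q n\<bar> / \<sigma> (L n)"
          by (intro divide_right_mono) (auto simp: \<sigma>_def)
        then show ?case by (simp add: \<sigma>_def abs_divide)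
      qed
    qed
    with 1 show "(\<lambda>n. (\<Psi> (f n) - \<Psi> (L n)) / \<sigma> (L n)) \<longlonglongrightarrow> 0 \<and> (\<lambda>n. \<sigma> (f n) / \<sigma> (L n)) \<longlonglongrightarrow> 1" by simp
  next
    \<comment> \<open>With \<open>s = ln L = \<beta> l\<close> and \<open>l = log\<^sub>\<theta> L\<close>, the quotient \<open>Q (m + s) / s\<^bsup>\<tau>-1\<^esup>\<close> minus its two divergent terms.\<close>
    define R where "R s = Q (m + s) / s powr (\<tau> - 1) - c * (s - \<tau> * (\<tau> - 1) * ln s)" for s
    have R_lim: "(R \<longlongrightarrow> c * \<tau> * (m + C)) at_top"
    proof (rule Lim_transform_eventually)
      define A1 where "A1 s = ((m + s) powr \<tau> - s powr \<tau> - \<tau> * s powr (\<tau> - 1) * m) / s powr (\<tau> - 1)" for s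
      define A2 where "A2 s = ((m + s) powr (\<tau> - 1) * ln (m + s) - s powr (\<tau> - 1) * ln s) / s powr (\<tau> - 1)" for s
      define A3 where "A3 s = (m + s) powr (\<tau> - 1) / s powr (\<tau> - 1)" for s
      have A: "(A1 \<longlongrightarrow> 0) at_top" "(A2 \<longlongrightarrow> 0) at_top" "(A3 \<longlongrightarrow> 1) at_top"
        unfolding A1_def A2_def A3_def using \<tau> by real_asymp+
      have "((\<lambda>s. c * (A1 s + \<tau> * m + \<tau> * C * A3 s - \<tau> * (\<tau> - 1) * A2 s)) \<longlongrightarrow> c * (0 + \<tau> * m + \<tau> * C * 1 - \<tau> * (\<tau> - 1) * 0)) at_top"
        by (intro tendsto_intros A)
      then show "((\<lambda>s. c * (A1 s + \<tau> * m + \<tau> * C * A3 s - \<tau> * (\<tau> - 1) * A2 s)) \<longlongrightarrow> c * \<tau> * (m + C)) at_top"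
        by (simp add: algebra_simps)
      show "\<forall>\<^sub>F s in at_top. c * (A1 s + \<tau> * m + \<tau> * C * A3 s - \<tau> * (\<tau> - 1) * A2 s) = R s"
        using eventually_gt_at_top[of 0]
      proof eventually_elim
        case (elim s)
        define p where "p = s powr (\<tau> - 1)"
        define r where "r = (m + s) powr (\<tau> - 1)"
        have p: "0 < p" "s powr \<tau> = s * p" using elim by (simp_all add: p_def powr_diff)
        show ?case
          unfolding A1_def A2_def A3_def R_def Q_def p_def[symmetric] r_def[symmetric] p(2)
          using p(1) by (simp add: field_simps)
      qed
    qed
    have l_top: "filterlim (\<lambda>n. log \<theta> (log \<theta> (real n))) at_top sequentially"
      using theta_range by real_asymp
    have L_top: "filterlim (\<lambda>n. log \<theta> (real n)) at_top sequentially"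
      using theta_range by real_asymp
    have "filterlim (\<lambda>n. ln (log \<theta> (real n))) at_top sequentially"
      using ln_at_top L_top by (rule filterlim_compose)
    then have "(\<lambda>n. R (ln (log \<theta> (real n)))) \<longlonglongrightarrow> c * \<tau> * (m + C)"
      by (rule filterlim_compose[OF R_lim])
    then have "(\<lambda>n. \<beta> powr (\<tau> - 2) * (R (ln (log \<theta> (real n))) - c * \<tau> * (\<tau> - 1) * ln \<beta>))
        \<longlonglongrightarrow> \<beta> powr (\<tau> - 2) * (c * \<tau> * (m + C) - c * \<tau> * (\<tau> - 1) * ln \<beta>)"
      by (intro tendsto_intros)
    also have "\<beta> powr (\<tau> - 2) * (c * \<tau> * (m + C) - c * \<tau> * (\<tau> - 1) * ln \<beta>) = - C\<^sub>3"
    proof -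
      have e1: "ln (exp 1 * c\<^sub>1 powr \<tau> * (1 - 1 / \<theta>) / \<tau>) = 1 + \<tau> * ln c\<^sub>1 + m - ln \<tau>"
        using pos \<tau> \<kappa> unfolding \<kappa>_def[symmetric] by (simp add: ln_mult ln_div ln_powr m_def)
      have e2: "C = 1 - ln \<tau> + \<tau> * ln c\<^sub>1"
        using pos \<tau> by (simp add: C_def c_def ln_mult ln_powr)
      have e3: "log \<theta> \<beta> * (\<tau> - 1) * \<beta> = (\<tau> - 1) * ln \<beta>"
        using \<beta> by (simp add: log_def \<beta>_def)
      show ?thesis
        unfolding C\<^sub>3_def c_def[symmetric] \<beta>_def[symmetric] e1 e2 e3 by (simp add: algebra_simps)
    qed
    finally show "(\<lambda>n. (log \<theta> (real n) - C\<^sub>1 * (log \<theta> (log \<theta> (real n))) powr \<tau>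
               + C\<^sub>2 * (log \<theta> (log \<theta> (real n))) powr (\<tau> - 1) * log \<theta> (log \<theta> (log \<theta> (real n)))
          - (log \<theta> (real n) - \<Psi> (log \<theta> (real n)) / ln \<theta>)) / \<sigma> (log \<theta> (real n))) \<longlonglongrightarrow> - C\<^sub>3"
    proof (rule Lim_transform_eventually)
      have "\<forall>\<^sub>F n in sequentially. 0 < log \<theta> (log \<theta> (real n))" using l_top by (simp add: filterlim_at_top_dense)
      then show "\<forall>\<^sub>F n in sequentially. \<beta> powr (\<tau> - 2) * (R (ln (log \<theta> (real n))) - c * \<tau> * (\<tau> - 1) * ln \<beta>) =
          (log \<theta> (real n) - C\<^sub>1 * (log \<theta> (log \<theta> (real n))) powr \<tau>
               + C\<^sub>2 * (log \<theta> (log \<theta> (real n))) powr (\<tau> - 1) * log \<theta> (log \<theta> (log \<theta> (real n)))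
          - (log \<theta> (real n) - \<Psi> (log \<theta> (real n)) / ln \<theta>)) / \<sigma> (log \<theta> (real n))"
      proof eventually_elim
        case (elim n)
        define l where "l = log \<theta> (log \<theta> (real n))"
        have l: "0 < l" using elim by (simp add: l_def)
        have s: "ln (log \<theta> (real n)) = \<beta> * l" using \<beta> by (simp add: l_def log_def \<beta>_def)
        define p where "p = l powr (\<tau> - 1)"
        define z where "z = \<beta> powr (\<tau> - 2)"
        have p: "0 < p" "l powr \<tau> = l * p" using l by (simp_all add: p_def powr_diff)
        have z: "0 < z" "\<beta> powr (\<tau> - 1) = \<beta> * z"
        proof -
          have "\<beta> powr (1 + (\<tau> - 2)) = \<beta> powr 1 * \<beta> powr (\<tau> - 2)" by (rule powr_add)
          then show "0 < z" "\<beta> powr (\<tau> - 1) = \<beta> * z" using \<beta> by (simp_all add: z_def)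
        qed
        have \<sigma>L: "\<sigma> (log \<theta> (real n)) = p" using \<beta> by (simp add: \<sigma>_def s p_def)
        have sp: "(\<beta> * l) powr (\<tau> - 1) = \<beta> * z * p" by (simp only: powr_mult z p_def)
        have ll: "log \<theta> l = ln l / \<beta>" "ln (\<beta> * l) = ln \<beta> + ln l"
          using l \<beta> by (simp_all add: log_def \<beta>_def ln_mult)
        have \<Psi>L: "\<Psi> (log \<theta> (real n)) = Q (m + \<beta> * l)" by (simp add: \<Psi>_def s)
        have C12: "C\<^sub>1 = \<beta> * z * c" "C\<^sub>2 = \<beta> * z * \<tau> * (\<tau> - 1) * c"
          by (simp_all only: C\<^sub>1_def C\<^sub>2_def \<beta>_def[symmetric] z c_def)
        show ?case
          unfolding R_def s sp \<sigma>L \<Psi>L l_def[symmetric] ll C12 p(2) p_def[symmetric] z_def[symmetric] \<beta>_def[symmetric]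
          using p(1) z(1) \<beta> by (simp add: field_simps)
      qed
    qed
  qed
  have "\<sigma> (log \<theta> (real n)) = (log \<theta> (log \<theta> (real n))) powr (\<tau> - 1)" for n :: nat
    by (simp add: \<sigma>_def \<beta>_def log_def)
  then show ?thesis using main by simp
qed

end

section \<open>The maximal degree in the two regimes\<close>
theorem theorem2p7:
  fixes M :: "'a measure" and \<nu> :: "real measure"
    and W :: "nat \<Rightarrow> 'a \<Rightarrow> real" and parent :: "nat \<Rightarrow> 'a \<Rightarrow> nat" and \<theta> :: real
  assumes wrt: "weighted_recursive_tree M \<nu> W parent"
    and theta: "\<theta> = 1 + (\<integral>x. x \<partial>\<nu>)"
    and support: "AE x in \<nu>. x \<in> {0<..1}" "Sup {x. cdf \<nu> x < 1} = 1"
    and near_zero: "\<exists>C \<rho> x\<^sub>1 :: real. C > 0 \<and> \<rho> > 0 \<and> x\<^sub>1 \<in> {0<..<1} \<and>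
          (\<forall>x\<in>{0..x\<^sub>1}. cdf \<nu> x \<le> C * x powr \<rho>)"
    and gumbel: "\<exists>a b :: nat \<Rightarrow> real. (\<forall>n. a n > 0) \<and>
          weak_conv_m (\<lambda>n. distr M borel (\<lambda>\<omega>. (Max ((\<lambda>i. W i \<omega>) ` {1..n}) - b n) / a n))
            gumbel_distribution"
  shows
    "(\<forall>a c\<^sub>1 \<tau> b :: real. a > 0 \<longrightarrow> c\<^sub>1 > 0 \<longrightarrow> \<tau> > 0 \<longrightarrow>
       (\<lambda>x. measure \<nu> {1 - 1 / x<..}) \<sim>[at_top]
         (\<lambda>x. a * x powr b * exp (- ((x / c\<^sub>1) powr \<tau>))) \<longrightarrow>
       (let \<gamma> = 1 / (1 + \<tau>) in
        converges_in_probability M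
          (\<lambda>n \<omega>. Max ((\<lambda>i. (wrt_indegree parent n i \<omega> - log \<theta> n) / (log \<theta> n) powr (1 - \<gamma>)) ` {1..n}))
          (- (\<tau> powr \<gamma> / ((1 - \<gamma>) * ln \<theta>)) * ((1 - 1 / \<theta>) / c\<^sub>1) powr (1 - \<gamma>))))
     \<and>
     (\<forall>a c\<^sub>1 b \<tau> :: real. a > 0 \<longrightarrow> c\<^sub>1 > 0 \<longrightarrow> \<tau> > 1 \<longrightarrow>
       (\<lambda>x. measure \<nu> {1 - 1 / x<..}) \<sim>[at_top]
         (\<lambda>x. a * (ln x) powr b * exp (- ((ln x / c\<^sub>1) powr \<tau>))) \<longrightarrow>
       (let C\<^sub>1 = (ln \<theta>) powr (\<tau> - 1) * c\<^sub>1 powr (- \<tau>);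
            C\<^sub>2 = (ln \<theta>) powr (\<tau> - 1) * \<tau> * (\<tau> - 1) * c\<^sub>1 powr (- \<tau>);
            C\<^sub>3 = (log \<theta> (ln \<theta>) * (\<tau> - 1) * ln \<theta>
                    - ln (exp 1 * c\<^sub>1 powr \<tau> * (1 - 1 / \<theta>) / \<tau>))
                  * (ln \<theta>) powr (\<tau> - 2) * \<tau> * c\<^sub>1 powr (- \<tau>)
        in
        converges_in_probability M
          (\<lambda>n \<omega>. Max ((\<lambda>i.
              (wrt_indegree parent n i \<omega> - log \<theta> n
                + C\<^sub>1 * (log \<theta> (log \<theta> n)) powr \<tau>
                - C\<^sub>2 * (log \<theta> (log \<theta> n)) powr (\<tau> - 1) * log \<theta> (log \<theta> (log \<theta> n)))
              / (log \<theta> (log \<theta> n)) powr (\<tau> - 1)) ` {1..n}))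
          C\<^sub>3))"
proof -
  interpret bounded_weights_tree M \<nu> W parent \<theta>
    by (intro bounded_weights_tree.intro bounded_weights_tree_axioms.intro wrt theta support(1))
  have tail_eq: "tail = (\<lambda>x. measure \<nu> {1 - 1 / x<..})"
    by (simp add: fun_eq_iff tail_def)
  show ?thesis
    unfolding Let_def
  proof (intro conjI allI impI)
    fix a c\<^sub>1 \<tau> b :: real
    assume "a > 0" "c\<^sub>1 > 0" "\<tau> > 0"
      "(\<lambda>x. measure \<nu> {1 - 1 / x<..}) \<sim>[at_top] (\<lambda>x. a * x powr b * exp (- ((x / c\<^sub>1) powr \<tau>)))"
    then show "converges_in_probability M
        (\<lambda>n \<omega>. Max ((\<lambda>i. (wrt_indegree parent n i \<omega> - log \<theta> n) / (log \<theta> n) powr (1 - 1 / (1 + \<tau>))) ` {1..n}))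
        (- (\<tau> powr (1 / (1 + \<tau>)) / ((1 - 1 / (1 + \<tau>)) * ln \<theta>)) * ((1 - 1 / \<theta>) / c\<^sub>1) powr (1 - 1 / (1 + \<tau>)))"
      using stretched_exponential_tail[of a c\<^sub>1 \<tau> b] unfolding tail_eq centred_max_def[abs_def] by simp
  next
    fix a c\<^sub>1 b \<tau> :: real
    assume asm: "a > 0" "c\<^sub>1 > 0" "\<tau> > 1"
      "(\<lambda>x. measure \<nu> {1 - 1 / x<..}) \<sim>[at_top] (\<lambda>x. a * (ln x) powr b * exp (- ((ln x / c\<^sub>1) powr \<tau>)))"
    have regroup: "z - L + P - R = z - (L - P + R)" for z L P R :: real by simp
    show "converges_in_probability M
        (\<lambda>n \<omega>. Max ((\<lambda>i. (wrt_indegree parent n i \<omega> - log \<theta> n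
            + (ln \<theta>) powr (\<tau> - 1) * c\<^sub>1 powr (- \<tau>) * (log \<theta> (log \<theta> n)) powr \<tau>
            - (ln \<theta>) powr (\<tau> - 1) * \<tau> * (\<tau> - 1) * c\<^sub>1 powr (- \<tau>)
                * (log \<theta> (log \<theta> n)) powr (\<tau> - 1) * log \<theta> (log \<theta> (log \<theta> n)))
            / (log \<theta> (log \<theta> n)) powr (\<tau> - 1)) ` {1..n}))
        ((log \<theta> (ln \<theta>) * (\<tau> - 1) * ln \<theta> - ln (exp 1 * c\<^sub>1 powr \<tau> * (1 - 1 / \<theta>) / \<tau>))
            * (ln \<theta>) powr (\<tau> - 2) * \<tau> * c\<^sub>1 powr (- \<tau>))"
      using log_stretched_exponential_tail[of a c\<^sub>1 \<tau> b] asm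
      unfolding tail_eq centred_max_def[abs_def] regroup by blast
  qed
qed

end
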